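(* Let $k\ge1$ be an integer and $\beta\in\mathbb{N}^d$. Let $\phi$ be a real-valued function defined in a neighborhood of the origin in $\mathbb{R}^d$, with $\phi(\mathbf 0)=0$ and $\nabla\phi(\mathbf 0)=\mathbf 0$, which is either analytic nondegenerate or $k$-nondegenerate. Let $\eta:\mathbb{R}^d\to\mathbb{R}$ be $C^k$ with support in $[1,4]^d$. Then there is $s\in(0,1)$ such that for all $\varepsilon\in(0,1)^d$ with $\|\varepsilon\|<s$, all $\lambda>2$, all integers $0\le N\le k-1$, and all $\alpha\in\mathcal N(\phi)$, $$\left|\int_{\mathbb{R}^d}e^{i\lambda\phi(x)}x^\beta\,\eta(\varepsilon_1^{-1}x_1,\dots,\varepsilon_d^{-1}x_d)\,dx\right|\ \lesssim\ \lambda^{-N}\varepsilon^{-(N\alpha-\beta-\mathbf 1)},$$ where the implicit constant is independent of $\varepsilon$ and $\lambda$. If in addition $\phi$ and $\eta$ are smooth ($C^\infty$), then the estimate holds for all integers $0\le N<\infty$.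
   Context: Notation: $\mathbb{N}=\{0,1,2,\dots\}$, $\mathbb{R}_{\ge}=[0,\infty)$, $\mathbf 1=(1,\dots,1)\in\mathbb{R}^d$. $\|\cdot\|$ is the $\ell^\infty$ norm on $\mathbb{R}^d$. For vectors, $xy=(x_1y_1,\dots,x_dy_d)$, so $\|x\nabla\phi(x)\|=\max_{1\le j\le d}|x_j\partial_j\phi(x)|$; and $\varepsilon^{v}=\varepsilon_1^{v_1}\cdots\varepsilon_d^{v_d}$ for $\varepsilon\in(0,1)^d$, $v\in\mathbb{R}^d$. $A\lesssim B$ means $A\le CB$ for a positive constant $C$. Newton polyhedron: for $\phi$ analytic near the origin with $\phi(x)=\sum_\alpha c_\alpha x^\alpha$, $\operatorname{supp}(\phi)=\{\alpha\in\mathbb{N}^d:c_\alpha\ne0\}$, and $\mathcal N(\phi)$ is the convex hull of $\bigcup_{\alpha\in\operatorname{supp}(\phi)}(\alpha+\mathbb{R}_{\ge}^d)$. For a compact face $F$ of $\mathcal N(\phi)$, $\phi_F(x)=\sum_{\alpha\in F}c_\alpha x^\alpha$. $\phi$ is analytic nondegenerate if it is analytic near the origin and for every compact face $F$ of $\mathcal N(\phi)$ and every $x\in\mathbb{R}^d$ with $x_1\cdots x_d\neq0$ one has $\|x\nabla\phi_F(x)\|\ne0$. A polynomial $P$ is convenient if $\mathcal N(P)$ intersects each coordinate axis. If $\phi$ is $C^k$ near the origin, let $P_k$ be its Taylor polynomial at the origin of order at most $k$. $\phi$ is $k$-nondegenerate if $P_k$ is convenient and analytic nondegenerate; in that case $\mathcal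 N(\phi):=\mathcal N(P_k)$. *)

theory Defs
  imports "HOL-Analysis.Analysis"
begin

section \<open>Multi-indices and powers\<close>

text \<open>Multi-indices are vectors of type \<^typ>\<open>nat ^ 'd\<close>; \<open>rvec\<close> embeds them into
  \<^typ>\<open>real ^ 'd\<close>.\<close>

definition rvec :: "nat ^ 'd \<Rightarrow> real ^ 'd" where
  "rvec a = (\<chi> j. real (a $ j))"

definition mpow :: "real ^ 'd \<Rightarrow> nat ^ 'd \<Rightarrow> real" where
  "mpow x a = (\<Prod>j\<in>UNIV. (x $ j) ^ (a $ j))"

definition mpowr :: "real ^ 'd \<Rightarrow> real ^ 'd \<Rightarrow> real" where
  "mpowr e v = (\<Prod>j\<in>UNIV. (e $ j) powr (v $ j))"

section \<open>Partial derivatives and differentiability classes\<close>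

definition partial :: "'d \<Rightarrow> (real ^ 'd \<Rightarrow> real) \<Rightarrow> real ^ 'd \<Rightarrow> real" where
  "partial j f x = frechet_derivative f (at x) (axis j 1)"

definition grad :: "(real ^ 'd \<Rightarrow> real) \<Rightarrow> real ^ 'd \<Rightarrow> real ^ 'd" where
  "grad f x = (\<chi> j. partial j f x)"

text \<open>Meant for open \<open>U\<close>.\<close>

primrec Ck_on :: "nat \<Rightarrow> (real ^ 'd) set \<Rightarrow> (real ^ 'd \<Rightarrow> real) \<Rightarrow> bool" where
  "Ck_on 0 U f \<longleftrightarrow> continuous_on U f"
| "Ck_on (Suc n) U f \<longleftrightarrow> (\<forall>x\<in>U. f differentiable (at x)) \<and> (\<forall>j. Ck_on n U (partial j f))"

definition smooth_on :: "(real ^ 'd) set \<Rightarrow> (real ^ 'd \<Rightarrow> real) \<Rightarrow> bool" where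
  "smooth_on U f \<longleftrightarrow> (\<forall>n. Ck_on n U f)"

definition Ck_near_0 :: "nat \<Rightarrow> (real ^ 'd \<Rightarrow> real) \<Rightarrow> bool" where
  "Ck_near_0 k f \<longleftrightarrow> (\<exists>U. open U \<and> 0 \<in> U \<and> Ck_on k U f)"

definition smooth_near_0 :: "(real ^ 'd \<Rightarrow> real) \<Rightarrow> bool" where
  "smooth_near_0 f \<longleftrightarrow> (\<exists>U. open U \<and> 0 \<in> U \<and> smooth_on U f)"

text \<open>The derivative of multi-index \<open>a\<close> differentiates \<open>a $ j\<close> times in direction \<open>j\<close>. The
  index type carries no order, so the order of differentiation is chosen arbitrarily; for
  functions that are sufficiently often continuously differentiable it is immaterial.\<close>

definition mderiv :: "nat ^ 'd \<Rightarrow> (real ^ 'd \<Rightarrow> real) \<Rightarrow> real ^ 'd \<Rightarrow> real" where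
  "mderiv a f = foldr partial (SOME js. \<forall>j. count_list js j = a $ j) f"

definition taylor_poly :: "nat \<Rightarrow> (real ^ 'd \<Rightarrow> real) \<Rightarrow> real ^ 'd \<Rightarrow> real" where
  "taylor_poly k f x =
     (\<Sum>a\<in>{a. (\<Sum>j\<in>UNIV. a $ j) \<le> k}. mderiv a f 0 / (\<Prod>j\<in>UNIV. fact (a $ j)) * mpow x a)"

section \<open>Analyticity and Newton polyhedra\<close>

definition has_power_series :: "(real ^ 'd \<Rightarrow> real) \<Rightarrow> (nat ^ 'd \<Rightarrow> real) \<Rightarrow> bool" where
  "has_power_series f c \<longleftrightarrow>
     (\<exists>r>0. \<forall>x. infnorm x < r \<longrightarrow> ((\<lambda>a. c a * mpow x a) has_sum f x) UNIV)"

definition analytic_near_0 :: "(real ^ 'd \<Rightarrow> real) \<Rightarrow> bool" where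
  "analytic_near_0 f \<longleftrightarrow> (\<exists>c. has_power_series f c)"

text \<open>The following notions are only meaningful for functions analytic near the origin (where
  the coefficients are unique); this includes polynomial functions.\<close>

definition pcoeff :: "(real ^ 'd \<Rightarrow> real) \<Rightarrow> nat ^ 'd \<Rightarrow> real" where
  "pcoeff f = (THE c. has_power_series f c)"

definition psupp :: "(real ^ 'd \<Rightarrow> real) \<Rightarrow> (nat ^ 'd) set" where
  "psupp f = {a. pcoeff f a \<noteq> 0}"

definition newton_polyhedron :: "(real ^ 'd \<Rightarrow> real) \<Rightarrow> (real ^ 'd) set" where
  "newton_polyhedron f = convex hull (\<Union>a\<in>psupp f. {rvec a + y |y. \<forall>j. 0 \<le> y $ j})"

text \<open>Meant for compact \<open>F\<close>, so that the sum is finite.\<close>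

definition face_part :: "(real ^ 'd \<Rightarrow> real) \<Rightarrow> (real ^ 'd) set \<Rightarrow> real ^ 'd \<Rightarrow> real" where
  "face_part f F x = (\<Sum>a\<in>{a. rvec a \<in> F}. pcoeff f a * mpow x a)"

text \<open>The empty set is a face in the sense of \<^const>\<open>face_of\<close> and has to be excluded.\<close>

definition analytic_nondegenerate :: "(real ^ 'd \<Rightarrow> real) \<Rightarrow> bool" where
  "analytic_nondegenerate f \<longleftrightarrow>
     analytic_near_0 f \<and>
     (\<forall>F. F face_of newton_polyhedron f \<and> F \<noteq> {} \<and> compact F \<longrightarrow>
       (\<forall>x. (\<Prod>j\<in>UNIV. x $ j) \<noteq> 0 \<longrightarrow>
         infnorm (\<chi> j. x $ j * partial j (face_part f F) x) \<noteq> 0))"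

definition convenient :: "(real ^ 'd \<Rightarrow> real) \<Rightarrow> bool" where
  "convenient P \<longleftrightarrow> (\<forall>j. \<exists>t. axis j t \<in> newton_polyhedron P)"

definition k_nondegenerate :: "nat \<Rightarrow> (real ^ 'd \<Rightarrow> real) \<Rightarrow> bool" where
  "k_nondegenerate k f \<longleftrightarrow>
     Ck_near_0 k f \<and> convenient (taylor_poly k f) \<and> analytic_nondegenerate (taylor_poly k f)"

end

theory Submission
  imports Defs
begin

text \<open>After the substitution \<open>x = \<epsilon> y\<close> the phase is \<open>\<lambda> \<phi>(\<epsilon> y)\<close> with \<open>y\<close> in a fixed box. Let \<open>V\<close> be a
  finite set of minimal exponents of \<open>\<phi>\<close> (Dickson's lemma) and \<open>M(\<epsilon>) = \<Sum>v\<in>V. \<epsilon>\<^sup>v\<close>; then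
  \<open>\<epsilon>\<^sup>\<alpha> \<le> M(\<epsilon>)\<close> for every \<open>\<alpha>\<close> in the Newton polyhedron. The functions \<open>\<phi>(\<epsilon> y) / M(\<epsilon>)\<close> have
  uniformly bounded derivatives, and their gradient is bounded away from 0: along a sequence
  violating this, the monomials of size comparable to \<open>M(\<epsilon>)\<close> are those of a compact face, and a
  limit point would be a zero of the gradient of the face polynomial. In the \<open>k\<close>-nondegenerate case
  the Taylor remainder is \<open>o(|\<epsilon>|\<^sup>k)\<close>, and \<open>|\<epsilon>|\<^sup>k \<le> M(\<epsilon>)\<close> because the Taylor polynomial is convenient.
  Integrating by parts \<open>N\<close> times gains \<open>(\<lambda> M(\<epsilon>))\<^sup>-\<^sup>N \<le> (\<lambda> \<epsilon>\<^sup>\<alpha>)\<^sup>-\<^sup>N\<close>.\<close>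

subsection \<open>Partial derivatives\<close>

text \<open>The obstacle is uniformity: the coordinates of \<open>e\<close> (the parameter
  \<epsilon>) may tend to 0 at unrelated rates, so no fixed weight and no fixed face describes the
  dominant monomials. Compactness replaces a case distinction over faces: the ratios of e^v to M(e)
  lie in [0,1], so along a subsequence all of them, and \<open>y\<close>, converge. The set W of
  exponents with positive limit is not visibly a face, since the rates need not come from a curve
  t^q. It becomes one by splitting -ln e: on differences of exponents in W it converges, and that
  limit p is absorbed into the limit point; the remainder, taken at one late index, is a vector q
  with positive entries that is constant on W and larger on the rest of the support. All estimates
  use M(e) as the size of the phase; \<alpha> enters only at the end. The gradient of the phase
  enters the amplitude, which is then differentiated up to N times, so N + 1 derivatives of the
  phase are needed: hence N <= k - 1. For smooth k-nondegenerate phases the Taylor polynomial says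
  nothing about orders above k; rescaling gives these a factor of at most |e|^k.\<close>

lemma partial_eq: "(f has_derivative f') (at x) \<Longrightarrow> partial j f x = f' (axis j 1)"
  unfolding partial_def by (metis frechet_derivative_at)

lemma has_derivative_frechet:
  "f differentiable at x \<Longrightarrow> (f has_derivative frechet_derivative f (at x)) (at x)"
  by (simp add: frechet_derivative_works)

lemma frechet_derivative_partial:
  assumes "f differentiable at x"
  shows "frechet_derivative f (at x) h = (\<Sum>j\<in>UNIV. h $ j * partial j f x)"
proof -
  have lin: "linear (frechet_derivative f (at x))"
    using assms linear_frechet_derivative by blast
  have "h = (\<Sum>j\<in>UNIV. h $ j *\<^sub>R axis j 1)"
    using basis_expansion[of h] by (simp add: scalar_mult_eq_scaleR)
  then have "frechet_derivative f (at x) h = frechet_derivative f (at x) (\<Sum>j\<in>UNIV. h $ j *\<^sub>R axis j 1)"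
    by simp
  also have "\<dots> = (\<Sum>j\<in>UNIV. h $ j * partial j f x)"
    by (simp add: linear_sum[OF lin] linear_scale[OF lin] partial_def)
  finally show ?thesis .
qed

lemma has_derivative_partial:
  assumes "f differentiable at x"
  shows "(f has_derivative (\<lambda>h. \<Sum>j\<in>UNIV. h $ j * partial j f x)) (at x)"
proof -
  have "frechet_derivative f (at x) = (\<lambda>h. \<Sum>j\<in>UNIV. h $ j * partial j f x)"
    using frechet_derivative_partial[OF assms] by blast
  then show ?thesis using has_derivative_frechet[OF assms] by simp
qed

lemma differentiable_cong_open:
  assumes "open U" "x \<in> U" "\<And>y. y \<in> U \<Longrightarrow> f y = g y" "f differentiable at x"
  shows "g differentiable at x"
  using assms unfolding differentiable_def
  by (metis has_derivative_transform_within_open)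

lemma partial_cong:
  assumes "open U" "x \<in> U" "\<And>y. y \<in> U \<Longrightarrow> f y = g y"
  shows "partial j f x = partial j g x"
proof -
  have "(f has_derivative D) (at x) \<longleftrightarrow> (g has_derivative D) (at x)" for D
    using assms by (metis has_derivative_transform_within_open)
  then show ?thesis unfolding partial_def frechet_derivative_def by simp
qed

lemma partial_add:
  "f differentiable at x \<Longrightarrow> g differentiable at x \<Longrightarrow>
    partial j (\<lambda>x. f x + g x) x = partial j f x + partial j g x"
  by (rule partial_eq[THEN trans, OF has_derivative_add[OF has_derivative_frechet has_derivative_frechet]])
     (auto simp: partial_def)

lemma partial_diff:
  "f differentiable at x \<Longrightarrow> g differentiable at x \<Longrightarrow>
    partial j (\<lambda>x. f x - g x) x = partial j f x - partial j g x"
  by (rule partial_eq[THEN trans, OF has_derivative_diff[OF has_derivative_frechet has_derivative_frechet]])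
     (auto simp: partial_def)

lemma partial_mult:
  "f differentiable at x \<Longrightarrow> g differentiable at x \<Longrightarrow>
    partial j (\<lambda>x. f x * g x) x = partial j f x * g x + f x * partial j g x"
  by (rule partial_eq[THEN trans, OF has_derivative_mult[OF has_derivative_frechet has_derivative_frechet]])
     (auto simp: partial_def)

lemma partial_inverse:
  assumes "f differentiable at x" "f x \<noteq> 0"
  shows "partial j (\<lambda>x. inverse (f x)) x = - (partial j f x * (inverse (f x) * inverse (f x)))"
  by (rule partial_eq[THEN trans, OF Deriv.has_derivative_inverse[OF assms(2) has_derivative_frechet[OF assms(1)]]])
     (auto simp: partial_def)

lemma partial_const: "partial j (\<lambda>_. c) x = 0"
  by (rule partial_eq[THEN trans, OF has_derivative_const]) simp

lemma has_real_derivative_line: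
  fixes f :: "real ^ 'd \<Rightarrow> real"
  assumes "f differentiable at (x + t *\<^sub>R v)"
  shows "((\<lambda>t. f (x + t *\<^sub>R v)) has_real_derivative (\<Sum>j\<in>UNIV. v $ j * partial j f (x + t *\<^sub>R v))) (at t)"
proof -
  have 1: "((\<lambda>t. x + t *\<^sub>R v) has_derivative (\<lambda>s. s *\<^sub>R v)) (at t)"
    by (auto intro!: derivative_eq_intros)
  have "((\<lambda>t. f (x + t *\<^sub>R v)) has_derivative (\<lambda>s. \<Sum>j\<in>UNIV. (s *\<^sub>R v) $ j * partial j f (x + t *\<^sub>R v))) (at t)"
    using has_derivative_compose[OF 1 has_derivative_partial[OF assms]] by simp
  then show ?thesis
    by (rule has_derivative_imp_has_field_derivative) (simp add: sum_distrib_left sum_distrib_right mult_ac)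
qed

lemma has_real_derivative_axis:
  fixes f :: "real ^ 'd \<Rightarrow> real"
  assumes "f differentiable at (x + t *\<^sub>R axis j 1)"
  shows "((\<lambda>t. f (x + t *\<^sub>R axis j 1)) has_real_derivative partial j f (x + t *\<^sub>R axis j 1)) (at t)"
proof -
  have "(\<Sum>i\<in>UNIV. axis j 1 $ i * partial i f (x + t *\<^sub>R axis j 1)) = partial j f (x + t *\<^sub>R axis j 1)"
    by (simp add: axis_def if_distrib[where f="\<lambda>a. a * _"] sum.If_cases cong: if_cong)
  then show ?thesis using has_real_derivative_line[OF assms] by simp
qed

subsection \<open>Differentiability classes\<close>

lemma Ck_on_cong:
  assumes "open U" "\<And>y. y \<in> U \<Longrightarrow> f y = g y" "Ck_on n U f"
  shows "Ck_on n U g"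
  using assms(2,3)
proof (induction n arbitrary: f g)
  case 0
  then show ?case by (auto cong: continuous_on_cong)
next
  case (Suc n)
  have "g differentiable at x" if "x \<in> U" for x
    using Suc.prems that differentiable_cong_open[OF \<open>open U\<close> that] by (metis Ck_on.simps(2))
  moreover have "Ck_on n U (partial j g)" for j
  proof (rule Suc.IH)
    show "partial j f y = partial j g y" if "y \<in> U" for y
      by (rule partial_cong[OF \<open>open U\<close> that Suc.prems(1)])
    show "Ck_on n U (partial j f)" using Suc.prems(2) by simp
  qed
  ultimately show ?case by simp
qed

lemma Ck_on_subset: "Ck_on n U f \<Longrightarrow> V \<subseteq> U \<Longrightarrow> Ck_on n V f"
  by (induction n arbitrary: f) (auto intro: continuous_on_subset)

lemma Ck_on_Suc_imp: "Ck_on (Suc n) U f \<Longrightarrow> Ck_on n U f"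
proof (induction n arbitrary: f)
  case 0
  then show ?case
    by (auto intro!: continuous_at_imp_continuous_on differentiable_imp_continuous_within)
next
  case (Suc n)
  then show ?case by (metis Ck_on.simps(2))
qed

lemma Ck_on_mono: "Ck_on n U f \<Longrightarrow> m \<le> n \<Longrightarrow> Ck_on m U f"
proof (induction n)
  case (Suc n)
  then show ?case using Ck_on_Suc_imp le_Suc_eq by metis
qed simp

lemma Ck_on_continuous: "Ck_on n U f \<Longrightarrow> continuous_on U f"
  using Ck_on_mono[of n U f 0] by simp

lemma Ck_on_foldr:
  "Ck_on n U f \<Longrightarrow> length js + m \<le> n \<Longrightarrow> Ck_on m U (foldr partial js f)"
proof (induction js arbitrary: m)
  case Nil
  then show ?case by (auto intro: Ck_on_mono)
next
  case (Cons j js)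
  then have "Ck_on (Suc m) U (foldr partial js f)" by (intro Cons.IH) auto
  then show ?case by simp
qed

subsection \<open>Symmetry of second derivatives\<close>

text \<open>Mean value theorem twice: in direction \<open>i\<close> for the increment in direction
  \<open>j\<close>, then in direction \<open>j\<close> for \<open>partial i f\<close>. The left side
  is symmetric in \<open>i\<close> and \<open>j\<close> and the right side is not, which is what
  \<open>partial_commute\<close> exploits.\<close>

lemma second_difference:
  fixes f :: "real ^ 'd \<Rightarrow> real"
  assumes U: "cball x (2 * h) \<subseteq> U" "h > 0"
    and f: "\<And>y. y \<in> U \<Longrightarrow> f differentiable at y"
    and fi: "\<And>y. y \<in> U \<Longrightarrow> partial i f differentiable at y"
  shows "\<exists>y\<in>cball x (2 * h). f (x + h *\<^sub>R axis i 1 + h *\<^sub>R axis j 1) - f (x + h *\<^sub>R axis i 1)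
      - f (x + h *\<^sub>R axis j 1) + f x = h * (h * partial j (partial i f) y)"
proof -
  have mem: "x + s *\<^sub>R axis i 1 + t *\<^sub>R axis j 1 \<in> cball x (2 * h)" if "0 \<le> s" "s \<le> h" "0 \<le> t" "t \<le> h" for s t
  proof -
    have "norm (s *\<^sub>R axis i 1 + t *\<^sub>R axis j (1::real)) \<le> s + t"
      using that norm_triangle_ineq[of "s *\<^sub>R axis i (1::real)" "t *\<^sub>R axis j 1"] by (simp add: norm_axis_1)
    then show ?thesis using that by (simp add: dist_norm norm_minus_commute algebra_simps)
  qed
  define g where "g = (\<lambda>s. f (x + h *\<^sub>R axis j 1 + s *\<^sub>R axis i 1) - f (x + s *\<^sub>R axis i 1))"
  define g' where "g' = (\<lambda>s. partial i f (x + h *\<^sub>R axis j 1 + s *\<^sub>R axis i 1) - partial i f (x + s *\<^sub>R axis i 1))"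
  have "(g has_real_derivative g' s) (at s)" if "0 \<le> s" "s \<le> h" for s
    unfolding g_def g'_def
    using that mem[of s h] mem[of s 0] U
    by (intro DERIV_diff has_real_derivative_axis f) (auto simp: algebra_simps)
  then obtain s where s: "0 < s" "s < h" "g h - g 0 = (h - 0) * g' s"
    using MVT2[of 0 h g g'] U by auto
  define k where "k = (\<lambda>t. partial i f (x + s *\<^sub>R axis i 1 + t *\<^sub>R axis j 1))"
  define k' where "k' = (\<lambda>t. partial j (partial i f) (x + s *\<^sub>R axis i 1 + t *\<^sub>R axis j 1))"
  have "(k has_real_derivative k' t) (at t)" if "0 \<le> t" "t \<le> h" for t
    unfolding k_def k'_def
    using that mem[of s t] U s
    by (intro has_real_derivative_axis fi) (auto simp: algebra_simps)
  then obtain t where t: "0 < t" "t < h" "k h - k 0 = (h - 0) * k' t"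
    using MVT2[of 0 h k k'] U by auto
  have "g h - g 0 = h * (h * k' t)"
    using s t by (simp add: g'_def k_def algebra_simps)
  then show ?thesis
    using mem[of s t] s t
    by (intro bexI[of _ "x + s *\<^sub>R axis i 1 + t *\<^sub>R axis j 1"])
       (simp_all add: g_def k'_def add_ac)
qed

text \<open>Schwarz's theorem. Both orders of differencing describe the same number, so the two
  mixed derivatives agree at points \<open>z\<close> and \<open>y\<close> near \<open>x\<close>;
  continuity brings both points back to \<open>x\<close>.\<close>

lemma partial_commute:
  fixes f :: "real ^ 'd \<Rightarrow> real"
  assumes "open U" "Ck_on 2 U f" "x \<in> U"
  shows "partial i (partial j f) x = partial j (partial i f) x"
proof (rule ccontr)
  assume ne: "partial i (partial j f) x \<noteq> partial j (partial i f) x"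
  define e where "e = \<bar>partial i (partial j f) x - partial j (partial i f) x\<bar> / 2"
  have e: "e > 0" using ne by (simp add: e_def)
  have diff: "\<And>y. y \<in> U \<Longrightarrow> f differentiable at y" "\<And>y i. y \<in> U \<Longrightarrow> partial i f differentiable at y"
    and cont: "continuous_on U (partial i (partial j f))" for i j
    using assms(2) by (auto simp: numeral_2_eq_2)
  have "\<exists>d>0. \<forall>y\<in>ball x d. y \<in> U \<and> \<bar>partial i (partial j f) y - partial i (partial j f) x\<bar> < e" for i j
  proof -
    have "isCont (partial i (partial j f)) x"
      using cont assms continuous_on_eq_continuous_at by blast
    then obtain d1 where d1: "d1 > 0" "\<And>y. dist y x < d1 \<Longrightarrow> \<bar>partial i (partial j f) y - partial i (partial j f) x\<bar> < e"
      using e unfolding continuous_at dist_real_def LIM_def by (metis abs_0 diff_self dist_real_def)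
    obtain d2 where "d2 > 0" "ball x d2 \<subseteq> U" using assms open_contains_ball by blast
    with d1 show ?thesis by (intro exI[of _ "min d1 d2"]) (auto simp: dist_commute)
  qed
  then obtain d1 d2 where d: "d1 > 0" "\<And>y. y \<in> ball x d1 \<Longrightarrow> y \<in> U \<and> \<bar>partial i (partial j f) y - partial i (partial j f) x\<bar> < e"
    "d2 > 0" "\<And>y. y \<in> ball x d2 \<Longrightarrow> y \<in> U \<and> \<bar>partial j (partial i f) y - partial j (partial i f) x\<bar> < e"
    by metis
  define h where "h = min d1 d2 / 4"
  have h: "h > 0" "2 * h < d1" "2 * h < d2" using d by (auto simp: h_def)
  have sub: "cball x (2 * h) \<subseteq> ball x d1" "cball x (2 * h) \<subseteq> ball x d2" using h by auto
  then have "cball x (2 * h) \<subseteq> U" using d by blast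
  note S = second_difference[OF this h(1) diff(1) diff(2)]
  obtain y where y: "y \<in> cball x (2 * h)" "f (x + h *\<^sub>R axis i 1 + h *\<^sub>R axis j 1) - f (x + h *\<^sub>R axis i 1)
      - f (x + h *\<^sub>R axis j 1) + f x = h * (h * partial j (partial i f) y)" using S by blast
  obtain z where z: "z \<in> cball x (2 * h)" "f (x + h *\<^sub>R axis j 1 + h *\<^sub>R axis i 1) - f (x + h *\<^sub>R axis j 1)
      - f (x + h *\<^sub>R axis i 1) + f x = h * (h * partial i (partial j f) z)" using S by blast
  have "h * (h * partial j (partial i f) y) = h * (h * partial i (partial j f) z)"
    using y(2) z(2) by (simp add: algebra_simps)
  then have "partial i (partial j f) z = partial j (partial i f) y" using h by auto
  moreover have "\<bar>partial i (partial j f) z - partial i (partial j f) x\<bar> < e"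
    "\<bar>partial j (partial i f) y - partial j (partial i f) x\<bar> < e" using d y(1) z(1) sub by blast+
  ultimately show False unfolding e_def by (smt (verit) field_sum_of_halves)
qed

lemma foldr_partial_move:
  assumes "open U" "Ck_on (Suc (length ys + length zs)) U f" "x \<in> U"
  shows "foldr partial (ys @ j # zs) f x = foldr partial (j # ys @ zs) f x"
  using assms(2,3)
proof (induction ys arbitrary: x)
  case Nil
  then show ?case by simp
next
  case (Cons i ys)
  have "foldr partial ((i # ys) @ j # zs) f x = partial i (foldr partial (ys @ j # zs) f) x" by simp
  also have "\<dots> = partial i (foldr partial (j # ys @ zs) f) x"
  proof (rule partial_cong[OF assms(1)])
    show "foldr partial (ys @ j # zs) f y = foldr partial (j # ys @ zs) f y" if "y \<in> U" for y
      using Cons.prems that by (intro Cons.IH) (auto intro: Ck_on_Suc_imp simp del: Ck_on.simps)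
  qed fact
  also have "\<dots> = partial j (partial i (foldr partial (ys @ zs) f)) x"
  proof -
    have "Ck_on 2 U (foldr partial (ys @ zs) f)"
      using Cons.prems(1) by (rule Ck_on_foldr) simp
    from partial_commute[OF assms(1) this Cons.prems(2), of i j] show ?thesis by simp
  qed
  finally show ?case by simp
qed

text \<open>Makes the arbitrary order of differentiation in \<open>mderiv\<close> harmless: only the
  multiset of directions counts. \<open>foldr_partial_move\<close> supplies the step of pulling one
  direction to the front.\<close>

lemma foldr_partial_perm:
  assumes "open U" "mset xs = mset ys" "Ck_on (length xs) U f" "x \<in> U"
  shows "foldr partial xs f x = foldr partial ys f x"
  using assms(2-)
proof (induction xs arbitrary: ys x)
  case Nil
  then have "ys = []" by simp
  then show ?case by simp
next
  case (Cons j xs)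
  have "j \<in> set ys" using mset_eq_setD[OF Cons.prems(1)] by auto
  then obtain us vs where ys: "ys = us @ j # vs" by (meson split_list)
  have Ck: "Ck_on (length xs) U f"
    using Ck_on_mono[OF Cons.prems(2), of "length xs"] by simp
  have m: "mset xs = mset (us @ vs)" using Cons.prems(1) unfolding ys by simp
  then have len: "length xs = length us + length vs"
    by (metis mset_eq_length length_append)
  have "foldr partial (j # xs) f x = partial j (foldr partial (us @ vs) f) x"
  proof (subst foldr_Cons, subst o_apply, rule partial_cong[OF assms(1)])
    show "foldr partial xs f y = foldr partial (us @ vs) f y" if "y \<in> U" for y
      using Cons.IH[OF m Ck that] .
  qed fact
  also have "\<dots> = foldr partial ys f x"
  proof -
    have "Ck_on (Suc (length us + length vs)) U f"
      using Cons.prems(2) by (metis len length_Cons)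
    from foldr_partial_move[OF assms(1) this Cons.prems(3), of j] show ?thesis
      by (metis ys append_Cons foldr_Cons o_apply)
  qed
  finally show ?case .
qed

subsection \<open>Power series in several variables\<close>

lemma infnorm_le_iff: "infnorm (x :: real ^ 'd) \<le> r \<longleftrightarrow> (\<forall>j. \<bar>x $ j\<bar> \<le> r)"
proof -
  have "{\<bar>x $ i\<bar> |i. i \<in> UNIV} = range (\<lambda>i. \<bar>x $ i\<bar>)" by auto
  then have "infnorm x = Max (range (\<lambda>i. \<bar>x $ i\<bar>))"
    by (simp add: infnorm_cart cSup_eq_Max)
  then show ?thesis by simp
qed

lemma infnorm_less_iff: "infnorm (x :: real ^ 'd) < r \<longleftrightarrow> (\<forall>j. \<bar>x $ j\<bar> < r)"
proof -
  have "{\<bar>x $ i\<bar> |i. i \<in> UNIV} = range (\<lambda>i. \<bar>x $ i\<bar>)" by auto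
  then have "infnorm x = Max (range (\<lambda>i. \<bar>x $ i\<bar>))"
    by (simp add: infnorm_cart cSup_eq_Max)
  then show ?thesis by simp
qed

lemma open_infnorm_less: "open {x :: real ^ 'd. infnorm x < r}"
  by (intro open_Collect_less continuous_intros)

lemma convex_infnorm_less: "convex {x :: real ^ 'd. infnorm x < r}"
proof -
  have "{x :: real ^ 'd. infnorm x < r} = box (\<chi> j. - r) (\<chi> j. r)"
    by (auto simp: infnorm_less_iff mem_box_cart abs_less_iff minus_less_iff)
  then show ?thesis by (simp add: convex_box)
qed

section \<open>Degrees, monomials and their derivatives\<close>

definition deg :: "nat ^ 'd \<Rightarrow> nat" where
  "deg a = (\<Sum>j\<in>UNIV. a $ j)"

lemma component_le_deg: "a $ j \<le> deg a"
  unfolding deg_def by (rule member_le_sum) auto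

lemma finite_deg_le: "finite {a :: nat ^ 'd. deg a \<le> k}"
proof (rule finite_subset)
  show "{a :: nat ^ 'd. deg a \<le> k} \<subseteq> vec_lambda ` (UNIV \<rightarrow>\<^sub>E {..k})"
  proof
    fix a :: "nat ^ 'd" assume "a \<in> {a. deg a \<le> k}"
    then have "(\<lambda>j. a $ j) \<in> UNIV \<rightarrow>\<^sub>E {..k}"
      using component_le_deg[of a] order_trans by fastforce
    then show "a \<in> vec_lambda ` (UNIV \<rightarrow>\<^sub>E {..k})"
      by (intro image_eqI[of _ _ "\<lambda>j. a $ j"]) (auto simp: vec_eq_iff)
  qed
qed (intro finite_imageI finite_PiE, auto)

lemma deg_add: "deg (a + b) = deg a + deg b"
  by (simp add: deg_def sum.distrib)

lemma deg_axis: "deg (axis j n) = n"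
  by (simp add: deg_def axis_def)

lemma mpow_zero: "mpow x 0 = 1"
  by (simp add: mpow_def)

lemma mpow_add: "mpow x (a + b) = mpow x a * mpow x b"
  by (simp add: mpow_def power_add prod.distrib)

lemma mpow_mult: "mpow (\<chi> j. x $ j * y $ j) a = mpow x a * mpow y a"
  by (simp add: mpow_def power_mult_distrib prod.distrib)

lemma mpow_axis: "mpow x (axis j 1) = x $ j"
  by (simp add: mpow_def axis_def if_distrib[where f="power _"] cong: if_cong)

lemma mpow_const: "mpow (\<chi> j. t) a = t ^ deg a"
  by (simp add: mpow_def deg_def power_sum)

lemma mpow_nonneg: "(\<And>j. 0 \<le> x $ j) \<Longrightarrow> 0 \<le> mpow x a"
  by (simp add: mpow_def prod_nonneg)

lemma mpow_pos: "(\<And>j. 0 < x $ j) \<Longrightarrow> 0 < mpow x a"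
  by (simp add: mpow_def prod_pos)

lemma mpow_le_1: "(\<And>j. 0 \<le> x $ j \<and> x $ j \<le> 1) \<Longrightarrow> mpow x a \<le> 1"
  unfolding mpow_def by (intro prod_le_1) (auto simp: power_le_one)

lemma mpow_mono: "(\<And>j. 0 \<le> x $ j \<and> x $ j \<le> y $ j) \<Longrightarrow> mpow x a \<le> mpow y a"
  unfolding mpow_def by (intro prod_mono) (auto intro: power_mono)

lemma abs_mpow_le:
  assumes "\<And>j. \<bar>x $ j\<bar> \<le> t"
  shows "\<bar>mpow x a\<bar> \<le> t ^ deg a"
proof -
  have "\<bar>mpow x a\<bar> = mpow (\<chi> j. \<bar>x $ j\<bar>) a" by (simp add: mpow_def abs_prod power_abs)
  also have "\<dots> \<le> mpow (\<chi> j. t) a" using assms by (intro mpow_mono) auto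
  finally show ?thesis by (simp add: mpow_const)
qed

text \<open>The partial derivative of a monomial. The truncated subtraction is harmless: where it
  truncates, the factor \<open>a $ j\<close> is 0.\<close>

definition dmpow :: "'d \<Rightarrow> nat ^ 'd \<Rightarrow> real ^ 'd \<Rightarrow> real" where
  "dmpow j a x = real (a $ j) * mpow x (a - axis j 1)"

lemma mpow_has_derivative:
  fixes a :: "nat ^ 'd"
  shows "((\<lambda>x. mpow x a) has_derivative (\<lambda>h. \<Sum>j\<in>UNIV. h $ j * dmpow j a x)) (at x within S)"
proof -
  have *: "((\<lambda>x :: real ^ 'd. (x $ j) ^ n) has_derivative (\<lambda>h. h $ j * (real n * x $ j ^ (n - 1)))) (at x within S)"
    for j n by (auto intro!: derivative_eq_intros bounded_linear_imp_has_derivative)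
  have "((\<lambda>x. mpow x a) has_derivative
      (\<lambda>h. \<Sum>j\<in>UNIV. (h $ j * (real (a $ j) * x $ j ^ (a $ j - 1))) * (\<Prod>i\<in>UNIV - {j}. x $ i ^ a $ i))) (at x within S)"
    unfolding mpow_def by (intro has_derivative_prod *)
  moreover have *: "(h $ j * (real (a $ j) * x $ j ^ (a $ j - 1))) * (\<Prod>i\<in>UNIV - {j}. x $ i ^ a $ i) = h $ j * dmpow j a x" for h :: "real ^ 'd" and j
  proof -
    have "mpow x (a - axis j 1) = x $ j ^ ((a - axis j 1) $ j) * (\<Prod>i\<in>UNIV - {j}. x $ i ^ ((a - axis j 1) $ i))"
      unfolding mpow_def by (subst prod.remove[of _ j]) auto
    also have "(\<Prod>i\<in>UNIV - {j}. x $ i ^ ((a - axis j 1) $ i)) = (\<Prod>i\<in>UNIV - {j}. x $ i ^ a $ i)"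
      by (intro prod.cong) (auto simp: axis_def)
    finally show ?thesis by (simp add: dmpow_def axis_def)
  qed
  ultimately show ?thesis by (simp only: *)
qed

lemma component_mult_dmpow: "x $ j * dmpow j a x = real (a $ j) * mpow x a"
proof (cases "a $ j = 0")
  case False
  then have "a = axis j 1 + (a - axis j 1)" by (auto simp: vec_eq_iff axis_def)
  then have "mpow x a = x $ j * mpow x (a - axis j 1)" by (metis mpow_add mpow_axis)
  then show ?thesis by (simp add: dmpow_def)
qed (simp add: dmpow_def)

lemma abs_dmpow_le:
  assumes "\<And>j. \<bar>x $ j\<bar> \<le> t"
  shows "\<bar>dmpow j a x\<bar> \<le> real (deg a) * t ^ (deg a - 1)"
proof (cases "a $ j = 0")
  case True
  have "0 \<le> t" using assms[of j] by simp
  with True show ?thesis by (simp add: dmpow_def)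
next
  case False
  then have "a = axis j 1 + (a - axis j 1)" by (auto simp: vec_eq_iff axis_def)
  then have "deg a = 1 + deg (a - axis j 1)" by (metis deg_add deg_axis)
  then show ?thesis
    unfolding dmpow_def abs_mult
    using abs_mpow_le[OF assms, of "a - axis j 1"] component_le_deg[of a j]
    by (intro mult_mono) auto
qed

text \<open>\<open>has_power_series\<close> with the radius made explicit. Termwise differentiation
  preserves this radius, which keeps inductions over derivatives on one fixed cube.\<close>

definition ps :: "real \<Rightarrow> (nat ^ 'd \<Rightarrow> real) \<Rightarrow> (real ^ 'd \<Rightarrow> real) \<Rightarrow> bool" where
  "ps r c f \<longleftrightarrow> (\<forall>x. infnorm x < r \<longrightarrow> ((\<lambda>a. c a * mpow x a) has_sum f x) UNIV)"

definition shift :: "'d \<Rightarrow> (nat ^ 'd \<Rightarrow> real) \<Rightarrow> nat ^ 'd \<Rightarrow> real" where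
  "shift j c a = real (a $ j + 1) * c (a + axis j 1)"

lemma has_power_series_ps: "has_power_series f c \<longleftrightarrow> (\<exists>r>0. ps r c f)"
  by (simp add: has_power_series_def ps_def)

text \<open>Evaluate the series at the constant vector \<open>t\<close>, where the monomial of
  \<open>a\<close> is \<open>t ^ deg a\<close>; unconditional summability of reals is
  absolute.\<close>

lemma ps_summable:
  fixes f :: "real ^ 'd \<Rightarrow> real"
  assumes "ps r c f" "0 \<le> t" "t < r"
  shows "(\<lambda>a. \<bar>c a\<bar> * t ^ deg a) summable_on UNIV"
proof -
  have "infnorm (\<chi> j::'d. t) < r" using assms by (simp add: infnorm_less_iff)
  then have "(\<lambda>a. c a * mpow (\<chi> j. t) a) summable_on UNIV"
    using assms unfolding ps_def summable_on_def by blast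
  then have "(\<lambda>a. norm (c a * mpow (\<chi> j. t) a)) summable_on UNIV"
    by (rule iffD1[OF summable_on_iff_abs_summable_on_real])
  then show ?thesis using assms by (simp add: abs_mult mpow_const)
qed

text \<open>The factor \<open>n\<close> produced by differentiating is absorbed by enlarging the
  radius from \<open>t\<close> to \<open>t'\<close>. This gives the majorant for the differentiated
  series.\<close>

lemma nat_mult_power_bound:
  assumes "0 \<le> t" "t < (t' :: real)"
  obtains K where "K \<ge> 0" "\<And>n. real n * t ^ (n - 1) \<le> K * t' ^ n"
proof -
  have q: "norm (t / t') < 1" using assms by simp
  have "(\<lambda>n. real n * (t / t') ^ n + (t / t') ^ n) \<longlonglongrightarrow> 0 + 0"
    using powser_times_n_limit_0[OF q] LIMSEQ_power_zero[OF q] by (intro tendsto_add)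
  then have "Bseq (\<lambda>n. real n * (t / t') ^ n + (t / t') ^ n)" by (intro convergent_imp_Bseq convergentI)
  then obtain B where B: "B > 0" "\<And>n. norm (real n * (t / t') ^ n + (t / t') ^ n) \<le> B"
    by (auto elim: BseqE)
  have "real n * t ^ (n - 1) \<le> B / t' * t' ^ n" for n
  proof (cases n)
    case 0
    then show ?thesis using B assms by simp
  next
    case (Suc m)
    have "real (Suc m) * (t / t') ^ m \<le> B"
      using B(2)[of m] by (simp add: algebra_simps)
    then have "real (Suc m) * t ^ m \<le> B * t' ^ m" using assms by (simp add: field_simps)
    then show ?thesis using Suc assms by simp
  qed
  with B assms show ?thesis by (intro that[of "B / t'"]) auto
qed

lemma shift_has_sum_iff:
  fixes c :: "nat ^ 'd \<Rightarrow> real"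
  shows "((\<lambda>a. c a * dmpow j a x) has_sum s) UNIV \<longleftrightarrow> ((\<lambda>a. shift j c a * mpow x a) has_sum s) UNIV"
proof -
  have inj: "inj (\<lambda>a :: nat ^ 'd. a + axis j 1)" by (simp add: inj_on_def)
  have out: "a $ j = 0" if "a \<notin> range (\<lambda>a :: nat ^ 'd. a + axis j 1)" for a
  proof (rule ccontr)
    assume "a $ j \<noteq> 0"
    then have "a = (a - axis j 1) + axis j 1" by (auto simp: vec_eq_iff axis_def)
    then show False using that by blast
  qed
  have "((\<lambda>a. c a * dmpow j a x) has_sum s) UNIV \<longleftrightarrow> ((\<lambda>a. c a * dmpow j a x) has_sum s) (range (\<lambda>a. a + axis j 1))"
    using out by (intro has_sum_cong_neutral) (auto simp: dmpow_def)
  also have "\<dots> \<longleftrightarrow> ((\<lambda>a. c a * dmpow j a x) \<circ> (\<lambda>a. a + axis j 1) has_sum s) UNIV"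
    by (rule has_sum_reindex[OF inj])
  also have "(\<lambda>a. c a * dmpow j a x) \<circ> (\<lambda>a. a + axis j 1) = (\<lambda>a. shift j c a * mpow x a)"
    by (auto simp: fun_eq_iff shift_def dmpow_def axis_def)
  finally show ?thesis .
qed

text \<open>Term-by-term differentiation. The theorem \<open>has_derivative_series\<close> is about
  sequences, so the unordered sum over exponents is transported to \<open>nat\<close> along a
  bijection \<open>e\<close>; uniform convergence of the derivatives is the Weierstrass
  test.\<close>

lemma ps_has_derivative:
  fixes f :: "real ^ 'd \<Rightarrow> real"
  assumes ps: "ps r c f" and x0: "infnorm x0 < r"
  shows "(f has_derivative (\<lambda>h. \<Sum>j\<in>UNIV. h $ j * (\<Sum>\<^sub>\<infinity>a. c a * dmpow j a x0))) (at x0)"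
    and "(\<lambda>a. c a * dmpow j a x0) summable_on UNIV"
proof -
  \<comment> \<open>Two intermediate radii: the derivatives converge uniformly on the cube of radius
    \<open>t\<close>, with a majorant that is summable at \<open>t'\<close>.\<close>
  obtain t where t: "infnorm x0 < t" "t < r" using x0 dense by blast
  obtain t' where t': "t < t'" "t' < r" using t(2) dense by blast
  have t0: "0 \<le> t" using t infnorm_pos_le[of x0] by linarith
  obtain K where K: "K \<ge> 0" "\<And>n. real n * t ^ (n - 1) \<le> K * t' ^ n"
    using nat_mult_power_bound[OF t0 t'(1)] by blast
  define S where "S = {x :: real ^ 'd. infnorm x < t}"
  define M where "M = (\<lambda>a :: nat ^ 'd. K * (\<bar>c a\<bar> * t' ^ deg a))"
  have M: "M summable_on UNIV"
    unfolding M_def using ps_summable[OF ps, of t'] t0 t' by (intro summable_on_cmult_right) auto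
  have le: "norm (c a * dmpow j a x) \<le> M a" if "x \<in> S" for a j x
  proof -
    have "\<bar>dmpow j a x\<bar> \<le> real (deg a) * t ^ (deg a - 1)"
      using that by (intro abs_dmpow_le) (auto simp: S_def infnorm_less_iff intro: less_imp_le)
    also have "\<dots> \<le> K * t' ^ deg a" by (rule K)
    finally have "\<bar>c a\<bar> * \<bar>dmpow j a x\<bar> \<le> \<bar>c a\<bar> * (K * t' ^ deg a)" by (intro mult_left_mono) auto
    then show ?thesis by (simp add: M_def abs_mult mult_ac)
  qed
  have sm: "(\<lambda>a. c a * dmpow j a x) summable_on UNIV" if "x \<in> S" for j x
    using Infinite_Sum.abs_summable_on_comparison_test'[OF M le[OF that, of _ j]]
    by (rule iffD2[OF summable_on_iff_abs_summable_on_real])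
  show "(\<lambda>a. c a * dmpow j a x0) summable_on UNIV" using sm t by (simp add: S_def)
  define e where "e = from_nat_into (UNIV :: (nat ^ 'd) set)"
  have inf: "infinite (UNIV :: (nat ^ 'd) set)"
  proof
    assume "finite (UNIV :: (nat ^ 'd) set)"
    then have "finite (range (\<lambda>n. axis undefined n :: nat ^ 'd))" by (rule finite_subset[rotated]) auto
    then have "finite (UNIV :: nat set)" by (rule finite_imageD) (auto simp: inj_on_def axis_eq_axis)
    then show False by simp
  qed
  have e: "bij e" unfolding e_def by (rule bij_betw_from_nat_into) (use inf in auto)
  \<comment> \<open>The images of initial segments eventually contain every finite set of exponents,
    so limits over finite subsets become limits of partial sums.\<close>
  have lim: "filterlim (\<lambda>n. e ` {..<n}) (finite_subsets_at_top UNIV) sequentially"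
  proof -
    have "filterlim (\<lambda>n. {..<n}) (finite_subsets_at_top UNIV) (sequentially :: nat filter)"
      by (rule filterlim_lessThan_at_top)
    then show ?thesis
      unfolding filterlim_finite_subsets_at_top
    proof safe
      fix X :: "(nat ^ 'd) set" assume "finite X"
        and A: "\<forall>X. finite X \<and> X \<subseteq> (UNIV :: nat set) \<longrightarrow> (\<forall>\<^sub>F y in sequentially. finite {..<y} \<and> X \<subseteq> {..<y} \<and> {..<y} \<subseteq> UNIV)"
      have "finite (inv e ` X)" using \<open>finite X\<close> by simp
      then have "\<forall>\<^sub>F y in sequentially. inv e ` X \<subseteq> {..<y}" using A by (auto elim: eventually_mono)
      then show "\<forall>\<^sub>F y in sequentially. finite (e ` {..<y}) \<and> X \<subseteq> e ` {..<y} \<and> e ` {..<y} \<subseteq> UNIV"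
      proof (rule eventually_mono)
        fix y assume "inv e ` X \<subseteq> {..<y}"
        then have "e ` (inv e ` X) \<subseteq> e ` {..<y}" by blast
        moreover have "e ` (inv e ` X) = X" using e by (simp add: bij_is_surj image_f_inv_f)
        ultimately show "finite (e ` {..<y}) \<and> X \<subseteq> e ` {..<y} \<and> e ` {..<y} \<subseteq> UNIV" by simp
      qed
    qed
  qed
  have sum_e: "sum g (e ` {..<n}) = (\<Sum>i<n. g (e i))" for g :: "nat ^ 'd \<Rightarrow> real" and n
    by (subst sum.reindex) (use e in \<open>auto intro: inj_on_subset simp: bij_def\<close>)
  define g where "g = (\<lambda>j x. \<Sum>\<^sub>\<infinity>a. c a * dmpow j a x)"
  have ul: "uniform_limit S (\<lambda>n x. \<Sum>i<n. c (e i) * dmpow j (e i) x) (g j) sequentially" for j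
  proof -
    have "uniform_limit S (\<lambda>X x. \<Sum>a\<in>X. c a * dmpow j a x) (g j) (finite_subsets_at_top UNIV)"
      unfolding g_def by (rule Weierstrass_m_test_general[OF le M])
    from filterlim_compose[OF this lim] show ?thesis by (simp only: sum_e)
  qed
  have "\<exists>F. \<forall>x\<in>S. (\<lambda>n. c (e n) * mpow x (e n)) sums F x \<and>
      (F has_derivative (\<lambda>h. \<Sum>j\<in>UNIV. h $ j * g j x)) (at x within S)"
  proof (rule has_derivative_series)
    show "convex S" unfolding S_def by (rule convex_infnorm_less)
    show "x0 \<in> S" using t by (simp add: S_def)
    show "((\<lambda>x. c (e n) * mpow x (e n)) has_derivative (\<lambda>h. \<Sum>j\<in>UNIV. h $ j * (c (e n) * dmpow j (e n) x))) (at x within S)" for n x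
      using has_derivative_mult_right[OF mpow_has_derivative[of "e n" x S], of "c (e n)"]
      by (simp add: sum_distrib_left mult.left_commute)
    have "((\<lambda>a. c a * mpow x0 a) has_sum f x0) UNIV" using ps x0 by (simp add: ps_def)
    then have "((\<lambda>n. c (e n) * mpow x0 (e n)) has_sum f x0) UNIV"
      by (subst has_sum_reindex_bij_betw[OF e])
    then show "(\<lambda>n. c (e n) * mpow x0 (e n)) sums f x0" by (rule has_sum_imp_sums)
    fix d :: real assume "d > 0"
    \<comment> \<open>The error in the derivative applied to \<open>h\<close> is a sum of one term
      per coordinate.\<close>
    define d' where "d' = d / real CARD('d)"
    have d': "d' > 0" using \<open>d > 0\<close> by (simp add: d'_def)
    have "\<forall>\<^sub>F n in sequentially. \<forall>j. \<forall>x\<in>S. dist (\<Sum>i<n. c (e i) * dmpow j (e i) x) (g j x) < d'"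
      by (rule eventually_all_finite) (use uniform_limitD[OF ul d'] in auto)
    then show "\<forall>\<^sub>F n in sequentially. \<forall>x\<in>S. \<forall>h. norm ((\<Sum>i<n. \<Sum>j\<in>UNIV. h $ j * (c (e i) * dmpow j (e i) x))
        - (\<Sum>j\<in>UNIV. h $ j * g j x)) \<le> d * norm h"
    proof (rule eventually_mono, intro ballI allI)
      fix n x and h :: "real ^ 'd"
      assume A: "\<forall>j. \<forall>x\<in>S. dist (\<Sum>i<n. c (e i) * dmpow j (e i) x) (g j x) < d'" and x: "x \<in> S"
      have "(\<Sum>i<n. \<Sum>j\<in>UNIV. h $ j * (c (e i) * dmpow j (e i) x)) - (\<Sum>j\<in>UNIV. h $ j * g j x)
         = (\<Sum>j\<in>UNIV. h $ j * ((\<Sum>i<n. c (e i) * dmpow j (e i) x) - g j x))"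
        by (subst sum.swap) (simp add: sum_distrib_left right_diff_distrib sum_subtractf)
      also have "norm \<dots> \<le> (\<Sum>j\<in>(UNIV :: 'd set). norm h * d')"
      proof (rule sum_norm_le)
        fix j :: 'd
        have "\<bar>(\<Sum>i<n. c (e i) * dmpow j (e i) x) - g j x\<bar> \<le> d'"
          using A x by (auto simp: dist_real_def less_imp_le)
        then show "norm (h $ j * ((\<Sum>i<n. c (e i) * dmpow j (e i) x) - g j x)) \<le> norm h * d'"
          using component_le_norm_cart[of h j] d' by (simp add: abs_mult mult_mono)
      qed
      also have "\<dots> = d * norm h" by (simp add: d'_def)
      finally show "norm ((\<Sum>i<n. \<Sum>j\<in>UNIV. h $ j * (c (e i) * dmpow j (e i) x))
        - (\<Sum>j\<in>UNIV. h $ j * g j x)) \<le> d * norm h" .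
    qed
  qed
  then obtain F where F: "\<And>x. x \<in> S \<Longrightarrow> (\<lambda>n. c (e n) * mpow x (e n)) sums F x"
    "\<And>x. x \<in> S \<Longrightarrow> (F has_derivative (\<lambda>h. \<Sum>j\<in>UNIV. h $ j * g j x)) (at x within S)" by blast
  have Ff: "F x = f x" if "x \<in> S" for x
  proof -
    have "((\<lambda>a. c a * mpow x a) has_sum f x) UNIV" using ps that t by (simp add: ps_def S_def)
    then have "((\<lambda>n. c (e n) * mpow x (e n)) has_sum f x) UNIV"
      by (subst has_sum_reindex_bij_betw[OF e])
    then show ?thesis using F(1)[OF that] has_sum_imp_sums sums_unique2 by blast
  qed
  have S: "open S" "x0 \<in> S" using t by (auto simp: S_def open_infnorm_less)
  have "(F has_derivative (\<lambda>h. \<Sum>j\<in>UNIV. h $ j * g j x0)) (at x0)"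
    using F(2)[OF S(2)] at_within_open[OF S(2,1)] by simp
  then show "(f has_derivative (\<lambda>h. \<Sum>j\<in>UNIV. h $ j * (\<Sum>\<^sub>\<infinity>a. c a * dmpow j a x0))) (at x0)"
    unfolding g_def using has_derivative_transform_within_open S Ff by blast
qed

lemma ps_differentiable: "ps r c f \<Longrightarrow> infnorm x < r \<Longrightarrow> f differentiable at x"
  using ps_has_derivative(1) unfolding differentiable_def by blast

lemma ps_partial_has_sum:
  assumes "ps r c f" "infnorm x < r"
  shows "((\<lambda>a. c a * dmpow j a x) has_sum partial j f x) UNIV"
proof -
  have "partial j f x = (\<Sum>i\<in>UNIV. axis j 1 $ i * (\<Sum>\<^sub>\<infinity>a. c a * dmpow i a x))"
    by (rule partial_eq[OF ps_has_derivative(1)[OF assms]])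
  also have "\<dots> = (\<Sum>\<^sub>\<infinity>a. c a * dmpow j a x)"
    by (simp add: axis_def if_distrib[where f="\<lambda>a. a * _"] sum.If_cases cong: if_cong)
  finally show ?thesis using ps_has_derivative(2)[OF assms, of j] by (simp add: has_sum_infsum)
qed

lemma ps_partial: "ps r c f \<Longrightarrow> ps r (shift j c) (partial j f)"
  using ps_partial_has_sum unfolding ps_def shift_has_sum_iff[symmetric] by blast

lemma ps_foldr: "ps r c f \<Longrightarrow> ps r (foldr shift js c) (foldr partial js f)"
  by (induction js) (auto intro: ps_partial)

lemma ps_Ck_on: "ps r c f \<Longrightarrow> Ck_on n {x. infnorm x < r} f"
proof (induction n arbitrary: c f)
  case 0
  then show ?case
    by (auto intro!: continuous_at_imp_continuous_on differentiable_imp_continuous_within ps_differentiable)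
next
  case (Suc n)
  then show ?case by (auto intro: ps_differentiable ps_partial)
qed

lemma ps_at_0:
  assumes "ps r c f" "r > 0"
  shows "f 0 = c 0"
proof -
  have "((\<lambda>a. c a * mpow 0 a) has_sum f 0) UNIV" using assms by (simp add: ps_def infnorm_0)
  moreover have "((\<lambda>a. c a * mpow 0 a) has_sum c 0) UNIV"
  proof (rule has_sum_finite_neutralI)
    show "finite {0 :: nat ^ 'a}" by simp
    show "c a * mpow 0 a = 0" if "a \<in> UNIV - {0}" for a
    proof -
      have "\<exists>j. a $ j \<noteq> 0" using that by (simp add: vec_eq_iff)
      then obtain j where "a $ j \<noteq> 0" by blast
      then have "(\<Prod>j\<in>UNIV. (0::real) ^ (a $ j)) = 0" by (intro prod_zero) (auto intro!: bexI[of _ j] simp: power_0_left)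
      then show ?thesis by (simp add: mpow_def)
    qed
  qed (auto simp: mpow_def)
  ultimately show ?thesis by (rule has_sum_unique)
qed

text \<open>The multi-index of the iterated derivative \<open>foldr partial js\<close>. Lists are
  the working form because inductions peel off one derivative at a time.\<close>

definition counts :: "'d list \<Rightarrow> nat ^ 'd" where
  "counts js = (\<chi> j. count_list js j)"

lemma counts_Cons: "counts (j # js) = counts js + axis j 1"
  by (auto simp: counts_def vec_eq_iff axis_def)

lemma counts_Nil: "counts [] = 0"
  by (simp add: counts_def vec_eq_iff)

text \<open>Read as a contrapositive: an exponent of a derivative, raised by
  \<open>counts js\<close>, is an exponent of the original series. This is what
  \<open>ps_deriv_bound\<close> needs.\<close>

lemma foldr_shift_eq_0: "c (a + counts js) = 0 \<Longrightarrow> foldr shift js c a = 0"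
proof (induction js arbitrary: a)
  case (Cons j js)
  then have "c ((a + axis j 1) + counts js) = 0" by (simp add: counts_Cons add_ac)
  from Cons.IH[OF this] show ?case by (simp add: shift_def)
qed (simp add: counts_Nil)

text \<open>The factorials are multiplied out, so that the induction meets no division; at
  \<open>a = 0\<close> this is the formula for the Taylor coefficients.\<close>

lemma foldr_shift_counts:
  "foldr shift js c a * (\<Prod>j\<in>UNIV. fact (a $ j)) = (\<Prod>j\<in>UNIV. fact ((a + counts js) $ j)) * c (a + counts js)"
proof (induction js arbitrary: a)
  case (Cons i js)
  have "(\<Prod>j\<in>UNIV. fact ((a + axis i 1) $ j) :: real) = real (a $ i + 1) * (\<Prod>j\<in>UNIV. fact (a $ j))"
  proof -
    have "(\<Prod>j\<in>UNIV. fact ((a + axis i 1) $ j) :: real) = (\<Prod>j\<in>UNIV. (if j = i then real (a $ i + 1) else 1) * fact (a $ j))"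
      by (intro prod.cong) (auto simp: axis_def)
    also have "\<dots> = real (a $ i + 1) * (\<Prod>j\<in>UNIV. fact (a $ j))" by (simp add: prod.distrib)
    finally show ?thesis .
  qed
  then show ?case using Cons.IH[of "a + axis i 1"]
    by (simp add: counts_Cons shift_def add_ac mult_ac)
qed (simp add: counts_Nil)

lemma foldr_shift_0: "foldr shift js c 0 = (\<Prod>j\<in>UNIV. fact (counts js $ j)) * c (counts js)"
  using foldr_shift_counts[of js c 0] by simp

lemma ex_counts: "\<exists>js. counts js = a"
proof (induction "deg a" arbitrary: a)
  case 0
  then have "a = 0" by (simp add: deg_def vec_eq_iff)
  then show ?case using counts_Nil by blast
next
  case (Suc n)
  then have "\<exists>j. a $ j \<noteq> 0" by (intro ccontr[of "\<exists>j. a $ j \<noteq> 0"]) (simp add: deg_def)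
  then obtain j where "a $ j \<noteq> 0" by blast
  then have a: "a = (a - axis j 1) + axis j 1" by (auto simp: vec_eq_iff axis_def)
  then have "deg a = deg (a - axis j 1) + 1" by (metis deg_add deg_axis)
  then obtain js where "counts js = a - axis j 1" using Suc by (metis Suc_eq_plus1 Suc_inject)
  then show ?case using a counts_Cons by metis
qed

lemma length_eq_deg: "length js = deg (counts js)"
  by (induction js) (simp_all add: counts_Nil counts_Cons deg_add deg_axis, simp add: deg_def)

lemma ps_derivatives_at_0:
  assumes "ps r c f" "r > 0"
  shows "foldr partial js f 0 = (\<Prod>j\<in>UNIV. fact (counts js $ j)) * c (counts js)"
  using ps_at_0[OF ps_foldr[OF assms(1)] assms(2)] foldr_shift_0 by metis

text \<open>Both coefficient families are read off from the same derivatives at 0. Hence the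
  definite description in \<open>pcoeff\<close> denotes, see \<open>pcoeff_eq\<close>.\<close>

lemma ps_unique:
  fixes c c' :: "nat ^ 'd \<Rightarrow> real"
  assumes "ps r c f" "r > 0" "ps r' c' f" "r' > 0"
  shows "c = c'"
proof
  fix a :: "nat ^ 'd"
  obtain js where "counts js = a" using ex_counts by blast
  then have "(\<Prod>j\<in>UNIV. fact (a $ j)) * c a = (\<Prod>j\<in>UNIV. fact (a $ j)) * c' a"
    using ps_derivatives_at_0[OF assms(1,2), of js] ps_derivatives_at_0[OF assms(3,4), of js] by simp
  moreover have "(\<Prod>j\<in>UNIV. fact (a $ j) :: real) \<noteq> 0" by simp
  ultimately show "c a = c' a" by simp
qed

lemma pcoeff_eq: "ps r c f \<Longrightarrow> r > 0 \<Longrightarrow> pcoeff f = c"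
  unfolding pcoeff_def by (rule the_equality) (auto simp: has_power_series_ps intro: ps_unique)

lemma analytic_near_0_ps: "analytic_near_0 f \<longleftrightarrow> (\<exists>r>0. ps r (pcoeff f) f)"
  unfolding analytic_near_0_def has_power_series_ps by (metis pcoeff_eq)

subsection \<open>Subsequences and Dickson's lemma\<close>

text \<open>A monotone subsequence that is not increasing is decreasing; in the naturals it reaches
  its minimum and stays there, so its tail is weakly increasing.\<close>

lemma nat_incseq_subseq:
  fixes s :: "nat \<Rightarrow> nat"
  obtains r where "strict_mono r" "incseq (s \<circ> r)"
proof -
  obtain g where g: "strict_mono g" "monoseq (\<lambda>n. s (g n))" using seq_monosub by blast
  show ?thesis
  proof (cases "incseq (s \<circ> g)")
    case True
    then show ?thesis using g that by blast
  next
    case False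
    then have dec: "s (g n) \<le> s (g m)" if "m \<le> n" for m n
      using g(2) that unfolding monoseq_def incseq_def o_def by blast
    define k where "k = (LEAST k. k \<in> range (\<lambda>n. s (g n)))"
    have "k \<in> range (\<lambda>n. s (g n))" unfolding k_def by (rule LeastI_ex) blast
    then obtain N where N: "s (g N) = k" by auto
    have "s (g (N + n)) = k" for n
    proof (rule antisym)
      show "s (g (N + n)) \<le> k" using dec[of N "N + n"] N by simp
      show "k \<le> s (g (N + n))" unfolding k_def by (rule Least_le) blast
    qed
    then have "incseq (s \<circ> (\<lambda>n. g (N + n)))" by (simp add: incseq_def)
    moreover have "strict_mono (\<lambda>n. g (N + n))" using g(1) by (simp add: strict_mono_def)
    ultimately show ?thesis using that by blast
  qed
qed

lemma vec_incseq_subseq: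
  fixes s :: "nat \<Rightarrow> nat ^ 'd"
  assumes "finite J"
  shows "\<exists>r. strict_mono r \<and> (\<forall>j\<in>J. incseq (\<lambda>n. s (r n) $ j))"
  using assms
proof (induction J)
  case empty
  then show ?case by (auto intro!: exI[of _ id] strict_mono_id)
next
  case (insert j J)
  then obtain r where r: "strict_mono r" "\<And>j. j \<in> J \<Longrightarrow> incseq (\<lambda>n. s (r n) $ j)" by auto
  obtain r' where r': "strict_mono r'" "incseq ((\<lambda>n. s (r n) $ j) \<circ> r')"
    using nat_incseq_subseq by blast
  have "incseq (\<lambda>n. s (r (r' n)) $ i)" if "i \<in> J" for i
    using r(2)[OF that] r'(1) unfolding incseq_def by (simp add: strict_mono_less_eq)
  with r r' show ?case
    by (intro exI[of _ "r \<circ> r'"]) (auto simp: strict_mono_def o_def)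
qed

text \<open>\<open>V\<close> is the set of minimal elements. Descent on \<open>deg\<close> finds one
  below every element of \<open>S\<close>; infinitely many of them would give, by
  \<open>vec_incseq_subseq\<close>, two distinct comparable ones.\<close>

lemma dickson:
  fixes S :: "(nat ^ 'd) set"
  obtains V where "finite V" "V \<subseteq> S" "\<And>a. a \<in> S \<Longrightarrow> \<exists>v\<in>V. v \<le> a"
proof -
  define V where "V = {v \<in> S. \<forall>u\<in>S. u \<le> v \<longrightarrow> u = v}"
  have "\<exists>v\<in>V. v \<le> a" if "a \<in> S" for a
    using that
  proof (induction "deg a" arbitrary: a rule: less_induct)
    case less
    show ?case
    proof (cases "a \<in> V")
      case True
      then show ?thesis by (auto simp: less_eq_vec_def)
    next
      case False
      then obtain u where u: "u \<in> S" "u \<le> a" "u \<noteq> a" using less.prems unfolding V_def by blast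
      then obtain j where "u $ j \<noteq> a $ j" by (auto simp: vec_eq_iff)
      then have "deg u < deg a" using u(2) unfolding deg_def less_eq_vec_def
        by (intro sum_strict_mono_ex1) (auto intro!: exI[of _ j] simp: le_neq_implies_less)
      then obtain v where "v \<in> V" "v \<le> u" using less.hyps u(1) by blast
      then show ?thesis using u(2) by (auto simp: less_eq_vec_def intro: order_trans)
    qed
  qed
  moreover have "finite V"
  proof (rule ccontr)
    assume "infinite V"
    then obtain s :: "nat \<Rightarrow> nat ^ 'd" where s: "inj s" "range s \<subseteq> V"
      using infinite_countable_subset by blast
    obtain r where r: "strict_mono r" "\<And>j. incseq (\<lambda>n. s (r n) $ j)"
      using vec_incseq_subseq[of "UNIV :: 'd set" s] by auto
    have "s (r 0) \<le> s (r 1)" using r(2) by (auto simp: less_eq_vec_def incseq_def)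
    moreover have "s (r 0) \<in> V" "s (r 1) \<in> V" using s by auto
    ultimately have "s (r 0) = s (r 1)" unfolding V_def by blast
    then have "r 0 = r 1" using s(1) by (simp add: inj_def)
    then show False using r(1) by (metis strict_mono_eq zero_neq_one)
  qed
  ultimately show ?thesis using that[of V] by (auto simp: V_def)
qed

lemma bounded_family_subseq:
  fixes X :: "'i \<Rightarrow> nat \<Rightarrow> real"
  assumes "finite J" "\<And>i. i \<in> J \<Longrightarrow> bounded (range (X i))"
  shows "\<exists>r. strict_mono r \<and> (\<forall>i\<in>J. convergent (\<lambda>n. X i (r n)))"
  using assms
proof (induction J)
  case empty
  then show ?case by (auto intro!: exI[of _ id] strict_mono_id)
next
  case (insert j J)
  then obtain r where r: "strict_mono r" "\<And>i. i \<in> J \<Longrightarrow> convergent (\<lambda>n. X i (r n))" by auto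
  have "bounded (range (\<lambda>n. X j (r n)))"
    using insert.prems[of j] by (rule bounded_subset) auto
  then obtain l r' where r': "strict_mono r'" "((\<lambda>n. X j (r n)) \<circ> r') \<longlonglongrightarrow> l"
    using bounded_imp_convergent_subsequence by blast
  have "convergent (\<lambda>n. X i (r (r' n)))" if "i \<in> J" for i
    using convergent_subseq_convergent[OF r(2)[OF that] r'(1)] by (simp add: o_def)
  with r r' show ?case
    by (intro exI[of _ "r \<circ> r'"]) (auto simp: strict_mono_def convergent_def o_def)
qed

subsection \<open>Newton polyhedra\<close>

lemma mpow_exp:
  assumes "\<And>j. 0 < e $ j"
  shows "mpow e a = exp ((\<chi> j. ln (e $ j)) \<bullet> rvec a)"
proof -
  have "exp ((\<chi> j. ln (e $ j)) \<bullet> rvec a) = (\<Prod>j\<in>UNIV. exp (real (a $ j) * ln (e $ j)))"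
    by (simp add: inner_vec_def rvec_def exp_sum mult.commute)
  also have "\<dots> = mpow e a"
    unfolding mpow_def using assms by (intro prod.cong) (auto simp: exp_of_nat_mult)
  finally show ?thesis by simp
qed

lemma mpowr_exp:
  assumes "\<And>j. 0 < e $ j"
  shows "mpowr e v = exp ((\<chi> j. ln (e $ j)) \<bullet> v)"
  using assms by (auto simp: mpowr_def inner_vec_def exp_sum powr_def mult.commute intro!: prod.cong)
    (metis less_irrefl)

text \<open>Linear in logarithmic coordinates: with \<open>l\<close> the vector of
  \<open>ln (e $ j)\<close>, all negative, \<open>mpowr e x\<close> is the exponential of
  \<open>l \<bullet> x\<close>. The half-space \<open>l \<bullet> x \<le> m\<close> is convex and
  contains every orthant \<open>rvec a + y\<close>, hence the polyhedron. This reduces an arbitrary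
  real point \<alpha> to the finitely many exponents in \<open>V\<close>.\<close>

lemma newton_mpowr_le:
  fixes e :: "real ^ 'd"
  assumes V: "finite V" "\<And>a. a \<in> psupp f \<Longrightarrow> \<exists>v\<in>V. v \<le> a"
    and e: "\<And>j. 0 < e $ j \<and> e $ j < 1" and a: "\<alpha> \<in> newton_polyhedron f"
  shows "mpowr e \<alpha> \<le> (\<Sum>v\<in>V. mpow e v)"
proof -
  define l where "l = (\<chi> j. ln (e $ j))"
  define m where "m = ln (\<Sum>v\<in>V. mpow e v)"
  have "psupp f \<noteq> {}" using a unfolding newton_polyhedron_def by auto
  then have "V \<noteq> {}" using V(2) by blast
  then have pos: "0 < (\<Sum>v\<in>V. mpow e v)" using V(1) e by (intro sum_pos mpow_pos) auto
  have l0: "0 \<le> y $ j \<Longrightarrow> l $ j * y $ j \<le> 0" for y j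
    using e[of j] by (simp add: l_def mult_nonpos_nonneg)
  have "newton_polyhedron f \<subseteq> {x. l \<bullet> x \<le> m}"
    unfolding newton_polyhedron_def
  proof (rule hull_minimal, safe)
    fix a and y :: "real ^ 'd" assume a: "a \<in> psupp f" and y: "\<forall>j. 0 \<le> y $ j"
    obtain v where v: "v \<in> V" "v \<le> a" using V(2) a by blast
    have "l \<bullet> y \<le> 0" using l0 y by (auto simp: inner_vec_def intro: sum_nonpos)
    moreover have "l \<bullet> rvec a \<le> l \<bullet> rvec v"
      unfolding inner_vec_def using v(2) e
      by (intro sum_mono) (auto simp: l_def rvec_def less_eq_vec_def intro!: mult_left_mono_neg)
    moreover have "l \<bullet> rvec v = ln (mpow e v)" unfolding l_def using mpow_exp[of e v] e by simp
    moreover have "ln (mpow e v) \<le> m" unfolding m_def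
      using V(1) v(1) e mpow_pos[of e] by (subst ln_le_cancel_iff) (auto simp: pos less_imp_le intro!: member_le_sum)
    ultimately show "l \<bullet> (rvec a + y) \<le> m" by (simp add: inner_add_right)
  qed (simp add: convex_halfspace_le)
  then have "l \<bullet> \<alpha> \<le> m" using a by blast
  then have "exp (l \<bullet> \<alpha>) \<le> exp m" by simp
  moreover have "mpowr e \<alpha> = exp (l \<bullet> \<alpha>)" unfolding l_def using mpowr_exp e by blast
  ultimately show ?thesis using pos by (simp add: m_def)
qed

text \<open>Every exponent \<open>a + b\<close> that occurs splits as \<open>v + w\<close> with
  \<open>v\<close> in \<open>V\<close>. The monomial of \<open>v\<close> is at most the sum over
  \<open>V\<close>, and the one of \<open>w\<close> is still geometrically small, so the whole
  infinite series costs only a constant. Used with \<open>b = 0\<close> for tails and with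
  \<open>b = counts js\<close> for derivatives.\<close>

lemma ps_bound:
  fixes g :: "real ^ 'd \<Rightarrow> real"
  assumes ps: "ps r d g" and s: "0 < s" "s \<le> 1" "5 * s < r" and V: "finite V"
    and d: "\<And>a. d a \<noteq> 0 \<Longrightarrow> \<exists>v\<in>V. v \<le> a + b"
  shows "\<exists>B\<ge>0. \<forall>e y. (\<forall>j. 0 < e $ j \<and> e $ j < s) \<longrightarrow> (\<forall>j. \<bar>y $ j\<bar> \<le> 5) \<longrightarrow>
     \<bar>mpow e b * g (e * y)\<bar> \<le> B * (\<Sum>v\<in>V. mpow e v)"
proof -
  \<comment> \<open>\<open>D\<close> bounds all degrees in \<open>V\<close> at once;
    \<open>s ^ D\<close> is the price for splitting \<open>v\<close> off an exponent.
    \<open>T\<close> is the value of the absolute series at radius \<open>5 * s\<close>, which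
    dominates all points \<open>e * y\<close>.\<close>
  define D where "D = (\<Sum>v\<in>V. deg v)"
  define T where "T = (\<Sum>\<^sub>\<infinity>a. \<bar>d a\<bar> * (5 * s) ^ deg a)"
  have T: "((\<lambda>a. \<bar>d a\<bar> * (5 * s) ^ deg a) has_sum T) UNIV"
    unfolding T_def using ps_summable[OF ps, of "5 * s"] s by (simp add: has_sum_infsum)
  have T0: "T \<ge> 0" using T s by (auto intro!: has_sum_nonneg[OF T])
  have main: "\<bar>mpow e b * g (e * y)\<bar> \<le> T / s ^ D * (\<Sum>v\<in>V. mpow e v)"
    if e: "\<forall>j. 0 < e $ j \<and> e $ j < s" and y: "\<forall>j. \<bar>y $ j\<bar> \<le> 5" for e y
  proof -
    have e0: "mpow e v \<ge> 0" for v using e by (intro mpow_nonneg) (auto intro: less_imp_le)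
    define M where "M = (\<Sum>v\<in>V. mpow e v)"
    have M: "M \<ge> 0" unfolding M_def using e0 by (intro sum_nonneg) auto
    have "infnorm (e * y) < r" unfolding infnorm_less_iff
    proof
      fix j
      have "\<bar>(e * y) $ j\<bar> = e $ j * \<bar>y $ j\<bar>" using e by (simp add: abs_mult abs_of_pos)
      also have "\<dots> \<le> s * 5" using e y s by (intro mult_mono) (auto intro: less_imp_le)
      finally show "\<bar>(e * y) $ j\<bar> < r" using s by linarith
    qed
    then have hs: "((\<lambda>a. d a * mpow (e * y) a) has_sum g (e * y)) UNIV" using ps by (simp add: ps_def)
    then have 1: "((\<lambda>a. mpow e b * (d a * mpow (e * y) a)) has_sum (mpow e b * g (e * y))) UNIV"
      by (rule has_sum_cmult_right)
    have 2: "((\<lambda>a. \<bar>d a\<bar> * (5 * s) ^ deg a * (M / s ^ D)) has_sum (T * (M / s ^ D))) UNIV"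
      by (rule has_sum_cmult_left[OF T])
    have "norm (mpow e b * g (e * y)) \<le> T * (M / s ^ D)"
    proof (rule norm_infsum_le[OF 1 2])
      fix a
      show "norm (mpow e b * (d a * mpow (e * y) a)) \<le> \<bar>d a\<bar> * (5 * s) ^ deg a * (M / s ^ D)"
      proof (cases "d a = 0")
        case False
        then obtain v where v: "v \<in> V" "v \<le> a + b" using d by blast
        define w where "w = a + b - v"
        have w: "a + b = v + w" using v(2) by (simp add: w_def vec_eq_iff less_eq_vec_def)
        have dD: "deg v \<le> D" unfolding D_def using v(1) V by (intro member_le_sum) auto
        have "mpow e w \<le> s ^ deg w" using abs_mpow_le[of e s w] e by (auto simp: abs_of_pos less_imp_le)
        also have "\<dots> \<le> s ^ deg a / s ^ D"
        proof -
          have "deg a \<le> deg w + D" using dD arg_cong[OF w, of deg] by (simp add: deg_add)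
          then have "s ^ (deg w + D) \<le> s ^ deg a" using s by (intro power_decreasing) auto
          then show ?thesis using s by (simp add: power_add field_simps)
        qed
        finally have "mpow e v * mpow e w \<le> M * (s ^ deg a / s ^ D)"
          unfolding M_def using V v(1) e0 s by (intro mult_mono member_le_sum sum_nonneg) auto
        then have 3: "mpow e (a + b) \<le> M * (s ^ deg a / s ^ D)" by (simp add: w mpow_add)
        have 4: "\<bar>mpow y a\<bar> \<le> 5 ^ deg a" using y by (intro abs_mpow_le) auto
        have "norm (mpow e b * (d a * mpow (e * y) a)) = \<bar>d a\<bar> * (mpow e (a + b) * \<bar>mpow y a\<bar>)"
          using mpow_mult[of e y a] e0 by (simp add: times_vec_def mpow_add abs_mult)
        also have "\<dots> \<le> \<bar>d a\<bar> * (M * (s ^ deg a / s ^ D) * 5 ^ deg a)"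
          using 3 4 M e0 s by (intro mult_left_mono mult_mono) auto
        finally show ?thesis by (simp add: power_mult_distrib field_simps)
      qed (use M s in auto)
    qed
    then show ?thesis by (simp add: M_def)
  qed
  show ?thesis using T0 s main by (intro exI[of _ "T / s ^ D"]) auto
qed

text \<open>The orthogonal projection \<open>p' n\<close> of \<open>l n\<close> to the span of
  \<open>D\<close> converges, to \<open>p\<close>. The difference \<open>l n - p' n\<close> vanishes
  on \<open>D\<close> exactly, for each \<open>n\<close>, and still tends to infinity on
  \<open>A\<close>; as \<open>A\<close> is finite, one late index makes it positive on all of
  \<open>A\<close>, and that vector is \<open>q\<close>.\<close>

lemma asymptotic_functional:
  fixes l :: "nat \<Rightarrow> 'a :: euclidean_space"
  assumes D: "\<And>u. u \<in> D \<Longrightarrow> convergent (\<lambda>n. l n \<bullet> u)"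
    and A: "finite A" "\<And>u. u \<in> A \<Longrightarrow> filterlim (\<lambda>n. l n \<bullet> u) at_top sequentially"
  shows "\<exists>q p. (\<forall>u\<in>D. q \<bullet> u = 0 \<and> (\<lambda>n. l n \<bullet> u) \<longlonglongrightarrow> p \<bullet> u) \<and> (\<forall>u\<in>A. q \<bullet> u > 0)"
proof -
  obtain B where B: "B \<subseteq> span D" "pairwise orthogonal B" "\<And>x. x \<in> B \<Longrightarrow> norm x = 1"
    "independent B" "span B = span D"
    using orthonormal_basis_subspace[OF subspace_span, of D] by metis
  have fin: "finite B" using B(4) independent_imp_finite by blast
  have conv: "convergent (\<lambda>n. l n \<bullet> u)" if "u \<in> span D" for u
    using that
  proof (induction rule: span_induct)
    case base
    show ?case
      by (rule subspaceI) (auto simp: inner_add_right convergent_const intro!: convergent_add convergent_mult)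
  next
    case (step x)
    then show ?case by (rule D)
  qed
  define p' where "p' = (\<lambda>n. \<Sum>b\<in>B. (l n \<bullet> b) *\<^sub>R b)"
  define p where "p = (\<Sum>b\<in>B. lim (\<lambda>n. l n \<bullet> b) *\<^sub>R b)"
  have p': "p' \<longlonglongrightarrow> p" unfolding p'_def p_def
    using conv B(1) by (intro tendsto_sum tendsto_scaleR tendsto_const) (auto simp: convergent_LIMSEQ_iff)
  have expand: "p' n \<bullet> u = l n \<bullet> u" if "u \<in> span D" for u n
  proof -
    have "u = (\<Sum>b\<in>B. (u \<bullet> b) *\<^sub>R b)"
      using orthonormal_basis_expand[OF B(2,3) _ fin, of u] that B(5) by simp
    then have "l n \<bullet> u = (\<Sum>b\<in>B. (u \<bullet> b) * (l n \<bullet> b))"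
      by (metis (no_types, lifting) inner_scaleR_right inner_sum_right sum.cong)
    then show ?thesis by (simp add: p'_def inner_sum_left inner_commute[of u] mult.commute)
  qed
  have 1: "(\<lambda>n. l n \<bullet> u) \<longlonglongrightarrow> p \<bullet> u" if "u \<in> D" for u
    using tendsto_inner[OF p' tendsto_const[of u]] expand that by (simp add: span_base)
  have "\<forall>\<^sub>F n in sequentially. \<forall>u\<in>A. (l n - p' n) \<bullet> u > 0"
  proof (rule eventually_ball_finite[OF A(1)], safe)
    fix u assume "u \<in> A"
    have "filterlim (\<lambda>n. - (p' n \<bullet> u) + l n \<bullet> u) at_top sequentially"
      using tendsto_minus[OF tendsto_inner[OF p' tendsto_const[of u]]] A(2)[OF \<open>u \<in> A\<close>]
      by (rule filterlim_tendsto_add_at_top)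
    then show "\<forall>\<^sub>F n in sequentially. (l n - p' n) \<bullet> u > 0"
      by (auto simp: inner_diff_left filterlim_at_top_dense dest: spec[of _ 0])
  qed
  then obtain n where n: "\<forall>u\<in>A. (l n - p' n) \<bullet> u > 0"
    using eventually_happens' sequentially_bot by blast
  show ?thesis
    by (rule exI[of _ "l n - p' n"], rule exI[of _ p])
       (use n 1 expand in \<open>auto simp: inner_diff_left span_base\<close>)
qed

text \<open>The open half-space together with the part \<open>F\<close> of its boundary is convex
  and contains \<open>G\<close>, so the hull meets the supporting hyperplane exactly in
  \<open>F\<close>. Here \<open>G\<close> may be an infinite union of orthants.\<close>

lemma convex_hull_supporting:
  fixes q :: "'a :: euclidean_space"
  assumes G: "\<And>g. g \<in> G \<Longrightarrow> q \<bullet> g > m \<or> g \<in> F"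
    and F: "convex F" "\<And>x. x \<in> F \<Longrightarrow> q \<bullet> x = m" "F \<subseteq> convex hull G"
  shows "F face_of convex hull G"
proof -
  define T where "T = {x. q \<bullet> x > m} \<union> F"
  have "convex T"
    unfolding convex_def
  proof (intro ballI allI impI)
    fix x y and u v :: real assume A: "x \<in> T" "y \<in> T" "0 \<le> u" "0 \<le> v" "u + v = 1"
    show "u *\<^sub>R x + v *\<^sub>R y \<in> T"
    proof (cases "x \<in> F \<and> y \<in> F \<or> u = 0 \<or> v = 0")
      case True
      then show ?thesis using A F(1) by (auto simp: T_def convex_def)
    next
      case False
      then have uv: "u > 0" "v > 0" using A by auto
      have ge: "q \<bullet> x \<ge> m" "q \<bullet> y \<ge> m" using A F(2) by (auto simp: T_def less_imp_le)
      have "u * m + v * m < u * (q \<bullet> x) + v * (q \<bullet> y)"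
      proof (cases "x \<in> F")
        case True
        then have "q \<bullet> y > m" using False A by (auto simp: T_def)
        then show ?thesis using uv ge by (intro add_le_less_mono) auto
      next
        case False
        then have "q \<bullet> x > m" using A by (auto simp: T_def)
        then show ?thesis using uv ge by (intro add_less_le_mono) auto
      qed
      moreover have "u * m + v * m = m" using A(5) by (metis distrib_right mult_1)
      ultimately show ?thesis by (simp add: T_def inner_add_right)
    qed
  qed
  moreover have "G \<subseteq> T" using G by (auto simp: T_def)
  ultimately have T: "convex hull G \<subseteq> T" by (simp add: hull_minimal)
  have "(convex hull G \<inter> {x. q \<bullet> x = m}) face_of convex hull G"
    using T F(2) by (intro face_of_Int_supporting_hyperplane_ge convex_convex_hull) (auto simp: T_def less_imp_le)
  moreover have "convex hull G \<inter> {x. q \<bullet> x = m} = F" using T F by (auto simp: T_def)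
  ultimately show ?thesis by simp
qed

text \<open>Ensures that \<open>face_part\<close> sums over a finite set; over an infinite one the
  sum would be 0 by convention.\<close>

lemma finite_rvec_mem:
  assumes "bounded F"
  shows "finite {a :: nat ^ 'd. rvec a \<in> F}"
proof -
  obtain B where B: "\<And>x. x \<in> F \<Longrightarrow> norm x \<le> B" using assms bounded_iff by blast
  have "deg a \<le> CARD('d) * nat \<lceil>B\<rceil>" if "rvec a \<in> F" for a :: "nat ^ 'd"
  proof -
    have "a $ j \<le> nat \<lceil>B\<rceil>" for j
    proof -
      have "real (a $ j) \<le> B" using B[OF that] component_le_norm_cart[of "rvec a" j] by (simp add: rvec_def)
      then show ?thesis by linarith
    qed
    then have "deg a \<le> (\<Sum>j\<in>(UNIV :: 'd set). nat \<lceil>B\<rceil>)" unfolding deg_def by (intro sum_mono) auto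
    then show ?thesis by simp
  qed
  then show ?thesis by (intro finite_subset[OF _ finite_deg_le]) auto
qed

subsection \<open>Lower bound for the gradient\<close>

text \<open>Unlike \<open>partial j\<close>, the operator \<open>x $ j * partial j\<close> is
  diagonal on monomials. It creates no new exponents, so the result can be compared with the same
  monomials as \<open>f\<close>.\<close>

lemma ps_euler:
  assumes "ps r c f"
  shows "ps r (\<lambda>a. real (a $ j) * c a) (\<lambda>x. x $ j * partial j f x)"
  unfolding ps_def
proof (intro allI impI)
  fix x :: "real ^ 'a" assume x: "infnorm x < r"
  have "((\<lambda>a. x $ j * (c a * dmpow j a x)) has_sum (x $ j * partial j f x)) UNIV"
    by (rule has_sum_cmult_right[OF ps_partial_has_sum[OF assms x]])
  moreover have "x $ j * (c a * dmpow j a x) = real (a $ j) * c a * mpow x a" for a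
    using component_mult_dmpow[of x j a] by (simp add: mult_ac)
  ultimately show "((\<lambda>a. real (a $ j) * c a * mpow x a) has_sum (x $ j * partial j f x)) UNIV" by simp
qed

lemma rvec_eq_iff: "rvec a = rvec b \<longleftrightarrow> a = b"
  by (simp add: rvec_def vec_eq_iff)

lemma ps_diff_finite:
  assumes "ps r c f" "finite W"
  shows "ps r (\<lambda>a. if a \<in> W then 0 else c a) (\<lambda>x. f x - (\<Sum>a\<in>W. c a * mpow x a))"
  unfolding ps_def
proof (intro allI impI)
  fix x :: "real ^ 'a" assume x: "infnorm x < r"
  have 1: "((\<lambda>a. c a * mpow x a) has_sum f x) UNIV" using assms(1) x by (simp add: ps_def)
  have 2: "((\<lambda>a. if a \<in> W then c a * mpow x a else 0) has_sum (\<Sum>a\<in>W. c a * mpow x a)) UNIV"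
    by (rule has_sum_finite_neutralI[OF assms(2)]) auto
  have "((\<lambda>a. c a * mpow x a - (if a \<in> W then c a * mpow x a else 0)) has_sum (f x - (\<Sum>a\<in>W. c a * mpow x a))) UNIV"
    using has_sum_add[OF 1 has_sum_uminusI[OF 2]] by simp
  moreover have "c a * mpow x a - (if a \<in> W then c a * mpow x a else 0) = (if a \<in> W then 0 else c a) * mpow x a" for a
    by simp
  ultimately show "((\<lambda>a. (if a \<in> W then 0 else c a) * mpow x a) has_sum (f x - (\<Sum>a\<in>W. c a * mpow x a))) UNIV" by simp
qed

text \<open>\<open>W\<close> consists of the exponents of the monomials that dominate along \<open>E\<close>. They span a compact face,
  and the last assumption says that the gradient of the face polynomial vanishes at a point with
  coordinates \<open>y\<^sub>j exp (- p\<^sub>j)\<close>; the functional \<open>q\<close> exposing the face and the vector \<open>p\<close> both come from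
  the asymptotics of \<open>- ln E\<close>.\<close>

lemma dominant_face_contradiction:
  fixes f :: "real ^ 'd \<Rightarrow> real"
  assumes nd: "analytic_nondegenerate f"
    and V: "finite V" "V \<subseteq> psupp f" "\<And>a. a \<in> psupp f \<Longrightarrow> \<exists>v\<in>V. v \<le> a"
    and W: "W \<subseteq> V" "W \<noteq> {}"
    and E: "\<And>n j. 0 < E n $ j" "\<And>j. (\<lambda>n. E n $ j) \<longlonglongrightarrow> 0"
    and M: "\<And>n. M n > 0"
    and L: "\<And>v. v \<in> V \<Longrightarrow> (\<lambda>n. mpow (E n) v / M n) \<longlonglongrightarrow> L v" "\<And>v. v \<in> W \<Longrightarrow> L v > 0"
      "\<And>v. v \<in> V - W \<Longrightarrow> L v = 0"
    and y: "\<And>j. y $ j \<noteq> 0"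
    and 0: "\<And>j. (\<Sum>v\<in>W. real (v $ j) * pcoeff f v * mpow y v * L v) = 0"
  shows False
proof -
  obtain w where w: "w \<in> W" using W by blast
  have finW: "finite W" using W V finite_subset by blast
  define l where "l = (\<lambda>n. - (\<chi> j. ln (E n $ j)))"
  have E_exp: "mpow (E n) a = exp (- (l n \<bullet> rvec a))" for n a
    using mpow_exp[of "E n" a] E(1) by (simp add: l_def)
  \<comment> \<open>Dividing by the monomial of \<open>w\<close> removes \<open>M n\<close> and
    leaves only differences of exponents.\<close>
  have ratio: "(mpow (E n) v / M n) / (mpow (E n) w / M n) = exp (- (l n \<bullet> (rvec v - rvec w)))" for n v
    using M[of n] by (simp add: E_exp inner_diff_right exp_diff exp_minus field_simps)
  have rlim: "(\<lambda>n. exp (- (l n \<bullet> (rvec v - rvec w)))) \<longlonglongrightarrow> L v / L w" if "v \<in> V" for v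
  proof -
    have "(\<lambda>n. (mpow (E n) v / M n) / (mpow (E n) w / M n)) \<longlonglongrightarrow> L v / L w"
      using L(2)[OF w] w W that by (intro tendsto_divide L(1)) auto
    then show ?thesis by (simp only: ratio)
  qed
  define D where "D = (\<lambda>v. rvec v - rvec w) ` W"
  \<comment> \<open>The vectors \<open>axis j 1\<close> belong here because \<open>E n\<close> tends
    to 0; they make every entry of \<open>q\<close> positive, so that \<open>q\<close> grows along
    the orthants of the polyhedron.\<close>
  define A where "A = (\<lambda>v. rvec v - rvec w) ` (V - W) \<union> range (\<lambda>j. axis j (1::real))"
  have "\<exists>q p. (\<forall>u\<in>D. q \<bullet> u = 0 \<and> (\<lambda>n. l n \<bullet> u) \<longlonglongrightarrow> p \<bullet> u) \<and> (\<forall>u\<in>A. q \<bullet> u > 0)"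
  proof (rule asymptotic_functional)
    show "finite A" unfolding A_def using V(1) by auto
    fix u assume "u \<in> D"
    then obtain v where v: "v \<in> W" "u = rvec v - rvec w" by (auto simp: D_def)
    have "(\<lambda>n. ln (exp (- (l n \<bullet> u)))) \<longlonglongrightarrow> ln (L v / L w)"
      unfolding v(2) using rlim[of v] v W L(2)[OF v(1)] L(2)[OF w] by (intro tendsto_ln) auto
    from tendsto_minus[OF this] show "convergent (\<lambda>n. l n \<bullet> u)" by (auto simp: convergent_def)
  next
    fix u assume "u \<in> A"
    then consider v where "v \<in> V - W" "u = rvec v - rvec w" | j where "u = axis j 1"
      unfolding A_def by blast
    then show "filterlim (\<lambda>n. l n \<bullet> u) at_top sequentially"
    proof cases
      case 1
      have "(\<lambda>n. exp (- (l n \<bullet> u))) \<longlonglongrightarrow> 0"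
        using rlim[of v] 1 L(3)[OF 1(1)] by simp
      then have "filterlim (\<lambda>n. exp (- (l n \<bullet> u))) (at_right 0) sequentially"
        by (intro tendsto_imp_filterlim_at_right) auto
      then have "filterlim (\<lambda>n. ln (exp (- (l n \<bullet> u)))) at_bot sequentially"
        using filterlim_compose[OF ln_at_0] by blast
      then show ?thesis by (simp add: filterlim_uminus_at_top)
    next
      case 2
      have "filterlim (\<lambda>n. E n $ j) (at_right 0) sequentially"
        using E by (intro tendsto_imp_filterlim_at_right) auto
      then have "filterlim (\<lambda>n. ln (E n $ j)) at_bot sequentially"
        using filterlim_compose[OF ln_at_0] by blast
      moreover have "l n \<bullet> u = - ln (E n $ j)" for n using 2 by (simp add: l_def inner_axis)
      ultimately show ?thesis by (simp add: filterlim_uminus_at_top)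
    qed
  qed
  then obtain q p where q: "\<And>u. u \<in> D \<Longrightarrow> q \<bullet> u = 0" "\<And>u. u \<in> A \<Longrightarrow> q \<bullet> u > 0"
    and p: "\<And>u. u \<in> D \<Longrightarrow> (\<lambda>n. l n \<bullet> u) \<longlonglongrightarrow> p \<bullet> u" by blast
  \<comment> \<open>On \<open>W\<close> the limits are, up to one common factor, exponentials of a
    linear functional of the exponent. They can therefore be absorbed into the point, which is the
    choice of \<open>z\<close> below.\<close>
  have Lp: "L v = L w * exp (p \<bullet> rvec w) * exp (- (p \<bullet> rvec v))" if "v \<in> W" for v
  proof -
    have "(\<lambda>n. exp (- (l n \<bullet> (rvec v - rvec w)))) \<longlonglongrightarrow> exp (- (p \<bullet> (rvec v - rvec w)))"
      using that by (intro tendsto_exp tendsto_minus p) (auto simp: D_def)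
    then have "L v / L w = exp (- (p \<bullet> (rvec v - rvec w)))"
      using rlim[of v] that W LIMSEQ_unique by blast
    then show ?thesis using L(2)[OF w] by (simp add: inner_diff_right exp_diff exp_minus field_simps)
  qed
  define m where "m = q \<bullet> rvec w"
  define F where "F = convex hull (rvec ` W)"
  define G where "G = (\<Union>a\<in>psupp f. {rvec a + y |y :: real ^ 'd. \<forall>j. 0 \<le> y $ j})"
  have qW: "q \<bullet> rvec v = m" if "v \<in> W" for v
    using q(1)[of "rvec v - rvec w"] that by (simp add: D_def m_def inner_diff_right)
  have qpos: "q $ j > 0" for j
    using q(2)[of "axis j 1"] by (simp add: A_def inner_axis)
  have qy: "q \<bullet> x \<ge> 0" "x \<noteq> 0 \<Longrightarrow> q \<bullet> x > 0" if x: "\<And>j. 0 \<le> x $ j" for x :: "real ^ 'd"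
  proof -
    show "q \<bullet> x \<ge> 0" unfolding inner_vec_def using x qpos by (intro sum_nonneg) (auto simp: less_imp_le)
    assume "x \<noteq> 0"
    then obtain j where "x $ j \<noteq> 0" by (auto simp: vec_eq_iff)
    then have "0 < q $ j * x $ j" using x[of j] qpos[of j] by simp
    then show "q \<bullet> x > 0" unfolding inner_vec_def using x qpos
      by (intro sum_pos2[of _ j]) (auto simp: less_imp_le)
  qed
  \<comment> \<open>No other exponent of the support reaches the hyperplane through
    \<open>W\<close>, so the face polynomial consists of the monomials in \<open>W\<close>
    alone.\<close>
  have qsupp: "a \<in> W \<or> q \<bullet> rvec a > m" if a: "a \<in> psupp f" for a
  proof -
    obtain v where v: "v \<in> V" "v \<le> a" using V(3) a by blast
    have nn: "0 \<le> (rvec a - rvec v) $ j" for j using v(2) by (simp add: rvec_def less_eq_vec_def)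
    have vm: "q \<bullet> rvec v > m" if "v \<notin> W"
      using q(2)[of "rvec v - rvec w"] v(1) that by (simp add: A_def m_def inner_diff_right)
    show ?thesis
    proof (cases "v \<in> W")
      case True
      then show ?thesis
        using qy(2)[OF nn] qW[OF True] by (cases "a = v") (auto simp: inner_diff_right rvec_eq_iff)
    next
      case False
      then show ?thesis using vm qy(1)[OF nn] by (simp add: inner_diff_right)
    qed
  qed
  have NP: "newton_polyhedron f = convex hull G" by (simp add: newton_polyhedron_def G_def)
  have F: "convex F" "compact F" "F \<noteq> {}"
    unfolding F_def using W(2)
    by (simp_all add: convex_convex_hull compact_convex_hull[OF finite_imp_compact] finW)
  have Fm: "q \<bullet> x = m" if "x \<in> F" for x
  proof -
    have "F \<subseteq> {x. q \<bullet> x = m}" unfolding F_def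
      by (rule hull_minimal) (auto simp: qW convex_hyperplane)
    then show ?thesis using that by blast
  qed
  have "F face_of newton_polyhedron f"
    unfolding NP
  proof (rule convex_hull_supporting[OF _ F(1) Fm])
    show "F \<subseteq> convex hull G" unfolding F_def
    proof (rule hull_mono, safe)
      fix v assume "v \<in> W"
      then have "v \<in> psupp f" using W V by blast
      then show "rvec v \<in> G" unfolding G_def by (auto intro!: bexI[of _ v] exI[of _ 0])
    qed
    fix g assume "g \<in> G"
    then obtain a x where a: "a \<in> psupp f" "g = rvec a + x" "\<And>j. 0 \<le> x $ j" unfolding G_def by auto
    show "q \<bullet> g > m \<or> g \<in> F"
    proof (cases "a \<in> W \<and> x = 0")
      case True
      then show ?thesis using a(2) hull_inc[of "rvec a" "rvec ` W"] by (auto simp: F_def)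
    next
      case False
      then show ?thesis using a qsupp[OF a(1)] qW qy[OF a(3)]
        by (auto simp: inner_add_right)
    qed
  qed
  then have nz: "infnorm (\<chi> j. z $ j * partial j (face_part f F) z) \<noteq> 0"
    if "(\<Prod>j\<in>UNIV. z $ j) \<noteq> 0" for z
    using nd F that unfolding analytic_nondegenerate_def by blast
  have fp: "face_part f F = (\<lambda>x. \<Sum>v\<in>W. pcoeff f v * mpow x v)"
  proof
    fix x
    show "face_part f F x = (\<Sum>v\<in>W. pcoeff f v * mpow x v)"
      unfolding face_part_def
    proof (rule sum.mono_neutral_right)
      show "finite {a. rvec a \<in> F}" using finite_rvec_mem compact_imp_bounded F by blast
      show "W \<subseteq> {a. rvec a \<in> F}" by (auto simp: F_def hull_inc)
      show "\<forall>i\<in>{a. rvec a \<in> F} - W. pcoeff f i * mpow x i = 0"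
        using qsupp Fm by (force simp: psupp_def)
    qed
  qed
  define z where "z = (\<chi> j. y $ j * exp (- (p $ j)))"
  have mz: "mpow z v = mpow y v * exp (- (p \<bullet> rvec v))" for v
  proof -
    have "mpow (\<chi> j. exp (- (p $ j))) v = exp (- (p \<bullet> rvec v))"
      by (subst mpow_exp) (auto simp: inner_vec_def sum_negf)
    then show ?thesis unfolding z_def
      using mpow_mult[of y "\<chi> j. exp (- (p $ j))" v] by simp
  qed
  have "z $ j * partial j (face_part f F) z = 0" for j
  proof -
    have "((\<lambda>x. \<Sum>v\<in>W. pcoeff f v * mpow x v) has_derivative
        (\<lambda>h. \<Sum>v\<in>W. pcoeff f v * (\<Sum>i\<in>UNIV. h $ i * dmpow i v z))) (at z)"
      by (intro has_derivative_sum has_derivative_mult_right mpow_has_derivative)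
    from partial_eq[OF this, of j]
    have "partial j (face_part f F) z = (\<Sum>v\<in>W. pcoeff f v * dmpow j v z)"
      by (simp add: fp axis_def if_distrib[where f="\<lambda>a. a * _"] sum.If_cases cong: if_cong)
    then have "z $ j * partial j (face_part f F) z = (\<Sum>v\<in>W. pcoeff f v * (z $ j * dmpow j v z))"
      by (simp add: sum_distrib_left mult_ac)
    also have "\<dots> = (\<Sum>v\<in>W. real (v $ j) * pcoeff f v * mpow y v * (exp (- (p \<bullet> rvec v))))"
      by (simp add: component_mult_dmpow mz mult_ac)
    finally have "L w * exp (p \<bullet> rvec w) * (z $ j * partial j (face_part f F) z)
       = (\<Sum>v\<in>W. real (v $ j) * pcoeff f v * mpow y v * (L w * exp (p \<bullet> rvec w) * exp (- (p \<bullet> rvec v))))"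
      by (simp add: sum_distrib_left mult_ac)
    also have "\<dots> = 0" using 0[of j] Lp by (simp cong: sum.cong)
    finally show ?thesis using L(2)[OF w] by simp
  qed
  then have "(\<chi> j. z $ j * partial j (face_part f F) z) = 0" by (simp add: vec_eq_iff)
  moreover have "(\<Prod>j\<in>UNIV. z $ j) \<noteq> 0" using y by (simp add: z_def)
  ultimately show False using nz by (metis infnorm_0)
qed

lemma gradient_lower_bound:
  fixes f :: "real ^ 'd \<Rightarrow> real"
  assumes nd: "analytic_nondegenerate f"
    and V: "finite V" "V \<subseteq> psupp f" "\<And>a. a \<in> psupp f \<Longrightarrow> \<exists>v\<in>V. v \<le> a"
    and ne: "psupp f \<noteq> {}"
  obtains s c where "0 < s" "0 < c"
    "\<And>e y. (\<forall>j. 0 < e $ j \<and> e $ j < s) \<Longrightarrow> (\<forall>j. 1/2 \<le> y $ j \<and> y $ j \<le> 5) \<Longrightarrow>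
      c * (\<Sum>v\<in>V. mpow e v) \<le> (\<Sum>j\<in>UNIV. \<bar>(e * y) $ j * partial j f (e * y)\<bar>)"
proof (rule ccontr)
  assume neg: "\<not> thesis"
  define M where "M = (\<lambda>e :: real ^ 'd. \<Sum>v\<in>V. mpow e v)"
  define G where "G = (\<lambda>j x. x $ j * partial j f x)"
  obtain r where r: "r > 0" "ps r (pcoeff f) f"
    using nd unfolding analytic_nondegenerate_def analytic_near_0_ps by blast
  have "V \<noteq> {}" using ne V(3) by blast
  then have Mpos: "M e > 0" if "\<And>j. 0 < e $ j" for e
    unfolding M_def using V(1) that by (intro sum_pos mpow_pos) auto
  \<comment> \<open>Failure of the claim with both constants equal to
    \<open>1 / real (Suc n)\<close>; the violating pairs form the sequence to which compactness is
    applied.\<close>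
  define P where "P = (\<lambda>n e y. (\<forall>j. 0 < e $ j \<and> e $ j < 1 / real (Suc n)) \<and>
      (\<forall>j. 1/2 \<le> y $ j \<and> y $ j \<le> 5) \<and> (\<Sum>j\<in>UNIV. \<bar>G j (e * y)\<bar>) < 1 / real (Suc n) * M e)"
  have "\<exists>e y. P n e y" for n
  proof (rule ccontr)
    assume no: "\<nexists>e y. P n e y"
    have thesis
    proof (rule that)
      fix e y :: "real ^ 'd"
      assume "\<forall>j. 0 < e $ j \<and> e $ j < 1 / real (Suc n)" "\<forall>j. 1/2 \<le> y $ j \<and> y $ j \<le> 5"
      then have "\<not> (\<Sum>j\<in>UNIV. \<bar>G j (e * y)\<bar>) < 1 / real (Suc n) * M e"
        using no unfolding P_def by blast
      then show "1 / real (Suc n) * (\<Sum>v\<in>V. mpow e v) \<le> (\<Sum>j\<in>UNIV. \<bar>(e * y) $ j * partial j f (e * y)\<bar>)"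
        unfolding G_def M_def by linarith
    qed simp_all
    with neg show False ..
  qed
  then obtain E0 Y0 where "\<And>n. P n (E0 n) (Y0 n)" by metis
  then have EY0: "\<And>n j. 0 < E0 n $ j \<and> E0 n $ j < 1 / real (Suc n)"
    "\<And>n j. 1/2 \<le> Y0 n $ j \<and> Y0 n $ j \<le> 5"
    "\<And>n. (\<Sum>j\<in>UNIV. \<bar>G j (E0 n * Y0 n)\<bar>) < 1 / real (Suc n) * M (E0 n)" unfolding P_def by blast+
  have "bounded (range (\<lambda>n. Y0 n $ j))" for j
  proof (rule boundedI[of _ 5])
    show "norm x \<le> 5" if x: "x \<in> range (\<lambda>n. Y0 n $ j)" for x
    proof -
      obtain n where "x = Y0 n $ j" using x by blast
      then show ?thesis using EY0(2)[of n j] by simp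
    qed
  qed
  then obtain r1 where r1: "strict_mono r1" "\<And>j. convergent (\<lambda>n. Y0 (r1 n) $ j)"
    using bounded_family_subseq[of "UNIV :: 'd set" "\<lambda>j n. Y0 n $ j"] by auto
  have ratio_le: "mpow e v / M e \<in> {0..1}" if "\<And>j. 0 < e $ j" "v \<in> V" for e v
  proof -
    have "mpow e v \<le> M e" unfolding M_def using V(1) that
      by (intro member_le_sum) (auto intro: less_imp_le mpow_nonneg)
    then show ?thesis using Mpos[OF that(1)] mpow_pos[OF that(1), of v] by simp
  qed
  have "bounded (range (\<lambda>n. mpow (E0 (r1 n)) v / M (E0 (r1 n))))" if "v \<in> V" for v
    using ratio_le[of "E0 (r1 _)" v] EY0(1) that
    by (intro bounded_subset[OF bounded_closed_interval[of 0 1]]) auto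
  then obtain r2 where r2: "strict_mono r2"
    "\<And>v. v \<in> V \<Longrightarrow> convergent (\<lambda>n. mpow (E0 (r1 (r2 n))) v / M (E0 (r1 (r2 n))))"
    using bounded_family_subseq[of V "\<lambda>v n. mpow (E0 (r1 n)) v / M (E0 (r1 n))"] V(1) by auto
  define k where "k = (\<lambda>n. r1 (r2 n))"
  have k: "strict_mono k" using r1(1) r2(1) by (simp add: k_def strict_mono_def)
  define E where "E = (\<lambda>n. E0 (k n))"
  define Y where "Y = (\<lambda>n. Y0 (k n))"
  define L where "L = (\<lambda>v. lim (\<lambda>n. mpow (E n) v / M (E n)))"
  have inv0: "(\<lambda>n. 1 / real (Suc (k n))) \<longlonglongrightarrow> 0"
    using LIMSEQ_subseq_LIMSEQ[OF lim_1_over_n[THEN LIMSEQ_Suc] k] by (simp add: o_def)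
  have Epos: "0 < E n $ j" for n j using EY0(1) by (simp add: E_def)
  have E0: "(\<lambda>n. E n $ j) \<longlonglongrightarrow> 0" for j
    using EY0(1) by (intro tendsto_sandwich[OF _ _ tendsto_const inv0]) (auto simp: E_def less_imp_le)
  have Llim: "(\<lambda>n. mpow (E n) v / M (E n)) \<longlonglongrightarrow> L v" if "v \<in> V" for v
    using r2(2)[OF that] unfolding L_def E_def k_def by (simp add: convergent_LIMSEQ_iff)
  have L0: "L v \<ge> 0" if "v \<in> V" for v
    by (rule LIMSEQ_le_const[OF Llim[OF that]]) (use ratio_le[OF Epos that] in auto)
  define y where "y = (\<chi> j. lim (\<lambda>n. Y n $ j))"
  have ylim: "(\<lambda>n. Y n $ j) \<longlonglongrightarrow> y $ j" for j
    using convergent_subseq_convergent[OF r1(2)[of j] r2(1)]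
    by (simp add: y_def Y_def k_def o_def convergent_LIMSEQ_iff)
  \<comment> \<open>The lower bound on \<open>y\<close> survives in the limit, so the limit point
    has no zero coordinate, as nondegeneracy requires.\<close>
  have y12: "y $ j \<ge> 1/2" for j
    by (rule LIMSEQ_le_const[OF ylim]) (use EY0(2) in \<open>auto simp: Y_def\<close>)
  define W where "W = {v \<in> V. L v > 0}"
  \<comment> \<open>The ratios add up to 1 for every \<open>n\<close>, hence so do their limits: at
    least one monomial dominates.\<close>
  have "(\<lambda>n. \<Sum>v\<in>V. mpow (E n) v / M (E n)) \<longlonglongrightarrow> (\<Sum>v\<in>V. L v)"
    by (intro tendsto_sum Llim)
  moreover have "(\<Sum>v\<in>V. mpow (E n) v / M (E n)) = 1" for n
    using Mpos[OF Epos, of n] by (simp add: sum_divide_distrib[symmetric] M_def)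
  ultimately have "(\<Sum>v\<in>V. L v) = 1" by (simp add: LIMSEQ_const_iff)
  then have "W \<noteq> {}" using L0 sum_nonpos[of V L] unfolding W_def by (force simp: not_less)
  have finW: "finite W" "W \<subseteq> V" using V(1) by (auto simp: W_def)
  have LW: "L v = 0" if "v \<in> V - W" for v using L0[of v] that by (auto simp: W_def)
  \<comment> \<open>An exponent outside \<open>V\<close> exceeds some \<open>v\<close> in
    \<open>V\<close> in a coordinate \<open>j\<close>, and so gains a factor \<open>E n $ j\<close>
    over a monomial of size at most \<open>M (E n)\<close>.\<close>
  have small: "(\<lambda>n. mpow (E n) a / M (E n)) \<longlonglongrightarrow> 0" if a: "a \<in> psupp f - W" for a
  proof (cases "a \<in> V")
    case True
    then show ?thesis using Llim LW a by (metis DiffD2 DiffI)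
  next
    case False
    obtain v where v: "v \<in> V" "v \<le> a" using V(3) a by blast
    then have "v \<noteq> a" using False by blast
    then obtain j where j: "v $ j \<noteq> a $ j" by (auto simp: vec_eq_iff)
    then have "v $ j < a $ j" using v(2) by (simp add: less_eq_vec_def le_neq_implies_less)
    then have "a = v + (axis j 1 + (a - v - axis j 1))"
      using v(2) by (auto simp: vec_eq_iff less_eq_vec_def axis_def)
    then have aa: "mpow e a = mpow e v * (e $ j * mpow e (a - v - axis j 1))" for e
      by (metis mpow_add mpow_axis)
    have "mpow (E n) a / M (E n) \<le> E n $ j" for n
    proof -
      have "E n $ i \<le> 1" for i using EY0(1)[of "k n" i] unfolding E_def
        by (smt (verit) divide_le_eq_1 of_nat_0_less_iff of_nat_Suc of_nat_0_le_iff zero_less_Suc)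
      then have "mpow (E n) (a - v - axis j 1) \<le> 1"
        using Epos[of n] by (intro mpow_le_1) (auto simp: less_imp_le)
      then have "E n $ j * mpow (E n) (a - v - axis j 1) \<le> E n $ j"
        using Epos[of n j] by simp
      then have "(mpow (E n) v / M (E n)) * (E n $ j * mpow (E n) (a - v - axis j 1)) \<le> 1 * E n $ j"
        using ratio_le[OF Epos v(1), of n] Epos[of n] mpow_nonneg[of "E n"]
        by (intro mult_mono) (auto simp: less_imp_le)
      then show ?thesis by (simp add: aa)
    qed
    moreover have "0 \<le> mpow (E n) a / M (E n)" for n
      using Mpos[OF Epos, of n] mpow_pos[OF Epos, of n a] by simp
    ultimately show ?thesis by (intro tendsto_sandwich[OF _ _ tendsto_const E0[of j]]) auto
  qed
  \<comment> \<open>Dickson's lemma again, now for the exponents that do not dominate. By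
    \<open>ps_bound\<close> the infinite tail is then controlled by finitely many monomials, each
    negligible by \<open>small\<close>; termwise convergence alone would not suffice.\<close>
  obtain V' where V': "finite V'" "V' \<subseteq> psupp f - W" "\<And>a. a \<in> psupp f - W \<Longrightarrow> \<exists>v\<in>V'. v \<le> a"
    using dickson[of "psupp f - W"] by blast
  define s where "s = min 1 (r / 6)"
  have s: "0 < s" "s \<le> 1" "5 * s < r" using r(1) by (auto simp: s_def)
  \<comment> \<open>Divided by \<open>M (E n)\<close>, both \<open>G j\<close> and its tail
    \<open>g\<close> tend to 0, hence so does their difference, the part carried by
    \<open>W\<close>.\<close>
  have lim0: "(\<lambda>n. \<Sum>v\<in>W. real (v $ j) * pcoeff f v * mpow (Y n) v * (mpow (E n) v / M (E n))) \<longlonglongrightarrow> 0" for j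
  proof -
    define g where "g = (\<lambda>x. G j x - (\<Sum>v\<in>W. real (v $ j) * pcoeff f v * mpow x v))"
    define d where "d = (\<lambda>a. if a \<in> W then 0 else real (a $ j) * pcoeff f a)"
    have "ps r d g" unfolding g_def G_def d_def by (rule ps_diff_finite[OF ps_euler[OF r(2)] finW(1)])
    moreover have "\<exists>v\<in>V'. v \<le> a + 0" if "d a \<noteq> 0" for a
      using V'(3)[of a] that by (auto simp: d_def psupp_def split: if_splits)
    ultimately obtain B where B: "\<And>e y. (\<forall>j. 0 < e $ j \<and> e $ j < s) \<Longrightarrow> (\<forall>j. \<bar>y $ j\<bar> \<le> 5) \<Longrightarrow>
       \<bar>mpow e 0 * g (e * y)\<bar> \<le> B * (\<Sum>v\<in>V'. mpow e v)"
      using ps_bound[of r d g s V' 0] s V'(1) by blast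
    have "\<forall>\<^sub>F n in sequentially. \<forall>j. E n $ j < s"
      by (intro eventually_all_finite order_tendstoD(2)[OF E0 s(1)])
    then have ev: "\<forall>\<^sub>F n in sequentially. norm (g (E n * Y n) / M (E n)) \<le> B * (\<Sum>v\<in>V'. mpow (E n) v / M (E n))"
    proof (rule eventually_mono)
      fix n assume n: "\<forall>j. E n $ j < s"
      have "\<forall>j. \<bar>Y n $ j\<bar> \<le> 5" using EY0(2)[of "k n"] by (smt (verit) Y_def field_sum_of_halves)
      from B[OF _ this, of "E n"] have "\<bar>g (E n * Y n)\<bar> \<le> B * (\<Sum>v\<in>V'. mpow (E n) v)"
        using n Epos by (simp add: mpow_zero)
      then show "norm (g (E n * Y n) / M (E n)) \<le> B * (\<Sum>v\<in>V'. mpow (E n) v / M (E n))"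
        using Mpos[OF Epos, of n] by (simp add: sum_divide_distrib[symmetric] divide_right_mono)
    qed
    have "(\<lambda>n. B * (\<Sum>v\<in>V'. mpow (E n) v / M (E n))) \<longlonglongrightarrow> B * (\<Sum>v\<in>V'. 0)"
      using V'(2) by (intro tendsto_mult tendsto_const tendsto_sum small) auto
    then have "(\<lambda>n. B * (\<Sum>v\<in>V'. mpow (E n) v / M (E n))) \<longlonglongrightarrow> 0" by simp
    with ev have g0: "(\<lambda>n. g (E n * Y n) / M (E n)) \<longlonglongrightarrow> 0" by (rule Lim_null_comparison)
    have G0: "(\<lambda>n. G j (E n * Y n) / M (E n)) \<longlonglongrightarrow> 0"
    proof (rule Lim_null_comparison[OF always_eventually inv0], rule allI)
      fix n
      have "\<bar>G j (E n * Y n)\<bar> \<le> (\<Sum>j\<in>UNIV. \<bar>G j (E n * Y n)\<bar>)" by (rule member_le_sum) auto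
      also have "\<dots> \<le> 1 / real (Suc (k n)) * M (E n)" using EY0(3)[of "k n"] by (simp add: E_def Y_def)
      finally show "norm (G j (E n * Y n) / M (E n)) \<le> 1 / real (Suc (k n))"
        using Mpos[OF Epos, of n] by (simp add: field_simps)
    qed
    have "(\<lambda>n. G j (E n * Y n) / M (E n) - g (E n * Y n) / M (E n)) \<longlonglongrightarrow> 0 - 0"
      by (rule tendsto_diff[OF G0 g0])
    moreover have "G j (E n * Y n) / M (E n) - g (E n * Y n) / M (E n)
      = (\<Sum>v\<in>W. real (v $ j) * pcoeff f v * mpow (Y n) v * (mpow (E n) v / M (E n)))" for n
    proof -
      have "mpow (E n * Y n) v = mpow (Y n) v * mpow (E n) v" for v
        using mpow_mult[of "E n" "Y n" v] by (simp add: times_vec_def mult.commute)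
      then show ?thesis by (simp add: g_def diff_divide_distrib sum_divide_distrib mult.assoc)
    qed
    ultimately show ?thesis by simp
  qed
  have zero: "(\<Sum>v\<in>W. real (v $ j) * pcoeff f v * mpow y v * L v) = 0" for j
  proof (rule LIMSEQ_unique[OF _ lim0])
    have "(\<lambda>n. mpow (Y n) v) \<longlonglongrightarrow> mpow y v" for v
      unfolding mpow_def by (intro tendsto_prod tendsto_power ylim)
    then show "(\<lambda>n. \<Sum>v\<in>W. real (v $ j) * pcoeff f v * mpow (Y n) v * (mpow (E n) v / M (E n)))
      \<longlonglongrightarrow> (\<Sum>v\<in>W. real (v $ j) * pcoeff f v * mpow y v * L v)"
      using finW(2) by (intro tendsto_sum tendsto_mult tendsto_const Llim) auto
  qed
  show False
  proof (rule dominant_face_contradiction[OF nd V finW(2) \<open>W \<noteq> {}\<close> Epos E0 Mpos[OF Epos] Llim _ LW _ zero])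
    show "y $ j \<noteq> 0" for j using y12[of j] by auto
  qed (auto simp: W_def)
qed

subsection \<open>Uniformly bounded families\<close>

text \<open>\<open>Ck_on\<close> for a family, with bounds on all derivatives that do not depend on
  the index. At order 0 continuity has to be demanded; at higher orders it follows from
  differentiability.\<close>

primrec unif_Ck :: "nat \<Rightarrow> 'i set \<Rightarrow> (real ^ 'd) set \<Rightarrow> ('i \<Rightarrow> real ^ 'd \<Rightarrow> real) \<Rightarrow> bool" where
  "unif_Ck 0 I U F \<longleftrightarrow> (\<forall>i\<in>I. continuous_on U (F i)) \<and> (\<exists>B. \<forall>i\<in>I. \<forall>x\<in>U. \<bar>F i x\<bar> \<le> B)"
| "unif_Ck (Suc n) I U F \<longleftrightarrow> (\<exists>B. \<forall>i\<in>I. \<forall>x\<in>U. \<bar>F i x\<bar> \<le> B) \<and>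
     (\<forall>i\<in>I. \<forall>x\<in>U. F i differentiable at x) \<and> (\<forall>j. unif_Ck n I U (\<lambda>i. partial j (F i)))"

lemma unif_Ck_bounded: "unif_Ck n I U F \<Longrightarrow> \<exists>B. \<forall>i\<in>I. \<forall>x\<in>U. \<bar>F i x\<bar> \<le> B"
  by (cases n) auto

lemma unif_Ck_continuous: "unif_Ck n I U F \<Longrightarrow> i \<in> I \<Longrightarrow> continuous_on U (F i)"
  by (cases n) (auto intro!: continuous_at_imp_continuous_on differentiable_imp_continuous_within)

lemma unif_Ck_0: "unif_Ck n I U F \<Longrightarrow> unif_Ck 0 I U F"
  using unif_Ck_bounded unif_Ck_continuous by auto

lemma unif_Ck_Suc_imp: "unif_Ck (Suc n) I U F \<Longrightarrow> unif_Ck n I U F"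
proof (induction n arbitrary: F)
  case 0
  then show ?case by (rule unif_Ck_0)
next
  case (Suc n)
  then show ?case by (metis unif_Ck.simps(2))
qed

lemma unif_Ck_cong:
  assumes U: "open U" and eq: "\<And>i x. i \<in> I \<Longrightarrow> x \<in> U \<Longrightarrow> F i x = G i x" and F: "unif_Ck n I U F"
  shows "unif_Ck n I U G"
  using eq F
proof (induction n arbitrary: F G)
  case 0
  then show ?case by (auto cong: continuous_on_cong)
next
  case (Suc n)
  have "\<exists>B. \<forall>i\<in>I. \<forall>x\<in>U. \<bar>G i x\<bar> \<le> B"
    using unif_Ck_bounded[OF Suc.prems(2)] Suc.prems(1) by auto
  moreover have "\<forall>i\<in>I. \<forall>x\<in>U. G i differentiable at x"
    using Suc.prems differentiable_cong_open[OF U] by (metis unif_Ck.simps(2))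
  moreover have "unif_Ck n I U (\<lambda>i. partial j (G i))" for j
  proof (rule Suc.IH)
    show "partial j (F i) x = partial j (G i) x" if "i \<in> I" "x \<in> U" for i x
      by (rule partial_cong[OF U that(2) Suc.prems(1)[OF that(1)]])
    show "unif_Ck n I U (\<lambda>i. partial j (F i))" using Suc.prems(2) by simp
  qed
  ultimately show ?case by simp
qed

lemma unif_Ck_const:
  fixes U :: "(real ^ 'd) set"
  assumes U: "open U" and c: "\<And>i. i \<in> I \<Longrightarrow> \<bar>c i\<bar> \<le> B"
  shows "unif_Ck n I U (\<lambda>i x. c i)"
  using c
proof (induction n arbitrary: c B)
  case 0
  then show ?case by auto
next
  case (Suc n)
  have "unif_Ck n I U (\<lambda>i. partial j (\<lambda>x :: real ^ 'd. c i))" for j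
  proof -
    have "partial j (\<lambda>x :: real ^ 'd. c i) = (\<lambda>x. 0)" for i by (rule ext) (rule partial_const)
    then show ?thesis using Suc.IH[of "\<lambda>_. 0" 0] by simp
  qed
  then show ?case using Suc.prems by auto
qed

lemma unif_Ck_add:
  assumes U: "open U" and "unif_Ck n I U F" "unif_Ck n I U G"
  shows "unif_Ck n I U (\<lambda>i x. F i x + G i x)"
  using assms(2,3)
proof (induction n arbitrary: F G)
  case 0
  then obtain B C where "\<forall>i\<in>I. \<forall>x\<in>U. \<bar>F i x\<bar> \<le> B" "\<forall>i\<in>I. \<forall>x\<in>U. \<bar>G i x\<bar> \<le> C" by auto
  then have "\<forall>i\<in>I. \<forall>x\<in>U. \<bar>F i x + G i x\<bar> \<le> B + C"
    by (meson abs_triangle_ineq add_mono order_trans)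
  then show ?case using 0 by (auto intro: continuous_on_add)
next
  case (Suc n)
  obtain B C where "\<forall>i\<in>I. \<forall>x\<in>U. \<bar>F i x\<bar> \<le> B" "\<forall>i\<in>I. \<forall>x\<in>U. \<bar>G i x\<bar> \<le> C"
    using Suc.prems unif_Ck_bounded by blast
  then have 1: "\<forall>i\<in>I. \<forall>x\<in>U. \<bar>F i x + G i x\<bar> \<le> B + C"
    by (meson abs_triangle_ineq add_mono order_trans)
  have 2: "\<forall>i\<in>I. \<forall>x\<in>U. (\<lambda>x. F i x + G i x) differentiable at x"
    using Suc.prems by (auto intro: differentiable_add)
  have "unif_Ck n I U (\<lambda>i. partial j (\<lambda>x. F i x + G i x))" for j
  proof (rule unif_Ck_cong[OF U])
    show "unif_Ck n I U (\<lambda>i x. partial j (F i) x + partial j (G i) x)"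
      using Suc.prems by (intro Suc.IH) auto
    show "partial j (F i) x + partial j (G i) x = partial j (\<lambda>x. F i x + G i x) x" if "i \<in> I" "x \<in> U" for i x
      using Suc.prems that by (auto simp: partial_add)
  qed
  with 1 2 show ?case by auto
qed

lemma abs_mult_le: "\<bar>a\<bar> \<le> B \<Longrightarrow> \<bar>b\<bar> \<le> C \<Longrightarrow> \<bar>a * b\<bar> \<le> B * (C :: real)"
  unfolding abs_mult by (rule mult_mono) auto

lemma unif_Ck_mult:
  assumes U: "open U" and "unif_Ck n I U F" "unif_Ck n I U G"
  shows "unif_Ck n I U (\<lambda>i x. F i x * G i x)"
  using assms(2,3)
proof (induction n arbitrary: F G)
  case 0
  then obtain B C where "\<forall>i\<in>I. \<forall>x\<in>U. \<bar>F i x\<bar> \<le> B" "\<forall>i\<in>I. \<forall>x\<in>U. \<bar>G i x\<bar> \<le> C" by auto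
  then have "\<forall>i\<in>I. \<forall>x\<in>U. \<bar>F i x * G i x\<bar> \<le> B * C"
    by (blast intro: abs_mult_le)
  then show ?case using 0 by (auto intro: continuous_on_mult)
next
  case (Suc n)
  obtain B C where "\<forall>i\<in>I. \<forall>x\<in>U. \<bar>F i x\<bar> \<le> B" "\<forall>i\<in>I. \<forall>x\<in>U. \<bar>G i x\<bar> \<le> C"
    using Suc.prems unif_Ck_bounded by blast
  then have 1: "\<forall>i\<in>I. \<forall>x\<in>U. \<bar>F i x * G i x\<bar> \<le> B * C"
    by (blast intro: abs_mult_le)
  have 2: "\<forall>i\<in>I. \<forall>x\<in>U. (\<lambda>x. F i x * G i x) differentiable at x"
    using Suc.prems by (auto intro: differentiable_mult)
  have "unif_Ck n I U (\<lambda>i. partial j (\<lambda>x. F i x * G i x))" for j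
  proof (rule unif_Ck_cong[OF U])
    have "unif_Ck n I U F" "unif_Ck n I U G" using Suc.prems unif_Ck_Suc_imp by blast+
    then show "unif_Ck n I U (\<lambda>i x. partial j (F i) x * G i x + F i x * partial j (G i) x)"
      using Suc.prems by (intro unif_Ck_add[OF U] Suc.IH) auto
    show "partial j (F i) x * G i x + F i x * partial j (G i) x = partial j (\<lambda>x. F i x * G i x) x"
      if "i \<in> I" "x \<in> U" for i x
      using Suc.prems that by (auto simp: partial_mult)
  qed
  with 1 2 show ?case by auto
qed

lemma unif_Ck_sum:
  assumes U: "open U" and "finite A" "\<And>a. a \<in> A \<Longrightarrow> unif_Ck n I U (F a)"
  shows "unif_Ck n I U (\<lambda>i x. \<Sum>a\<in>A. F a i x)"
  using assms(2,3)
proof (induction A)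
  case empty
  then show ?case using unif_Ck_const[OF U, of I "\<lambda>_. 0" 0] by simp
next
  case (insert a A)
  then show ?case by (simp add: unif_Ck_add[OF U])
qed

text \<open>The derivative of \<open>inverse F\<close> is a product of \<open>partial j F\<close>
  and two copies of \<open>inverse F\<close>, so order \<open>n\<close> of the inverse yields order
  \<open>n + 1\<close>.\<close>

lemma unif_Ck_inverse:
  assumes U: "open U" and c: "c > 0" "\<And>i x. i \<in> I \<Longrightarrow> x \<in> U \<Longrightarrow> c \<le> F i x" and "unif_Ck n I U F"
  shows "unif_Ck n I U (\<lambda>i x. inverse (F i x))"
  using assms(4)
proof (induction n)
  have nz: "F i x \<noteq> 0" if "i \<in> I" "x \<in> U" for i x using c(1) c(2)[OF that] by simp
  have bd: "\<forall>i\<in>I. \<forall>x\<in>U. \<bar>inverse (F i x)\<bar> \<le> inverse c"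
  proof safe
    fix i x assume "i \<in> I" "x \<in> U"
    then have "c \<le> F i x" by (rule c(2))
    then show "\<bar>inverse (F i x)\<bar> \<le> inverse c" using c(1) by (simp add: le_imp_inverse_le)
  qed
  {
    case 0
    then show ?case using nz bd by (auto intro!: continuous_on_inverse)
  next
    case (Suc n)
    have 2: "\<forall>i\<in>I. \<forall>x\<in>U. (\<lambda>x. inverse (F i x)) differentiable at x"
      using Suc.prems nz by (auto intro!: differentiable_inverse)
    have "unif_Ck n I U (\<lambda>i. partial j (\<lambda>x. inverse (F i x)))" for j
    proof (rule unif_Ck_cong[OF U])
      have "unif_Ck n I U (\<lambda>i x. inverse (F i x))" using Suc unif_Ck_Suc_imp by blast
      then show "unif_Ck n I U (\<lambda>i x. - 1 * (partial j (F i) x * (inverse (F i x) * inverse (F i x))))"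
        using Suc.prems by (intro unif_Ck_mult[OF U] unif_Ck_const[OF U, of _ _ 1]) auto
      show "- 1 * (partial j (F i) x * (inverse (F i x) * inverse (F i x))) = partial j (\<lambda>x. inverse (F i x)) x"
        if "i \<in> I" "x \<in> U" for i x
        using Suc.prems that nz[OF that] by (auto simp: partial_inverse)
    qed
    with bd 2 show ?case by auto
  }
qed

lemma partial_scaled:
  fixes f :: "real ^ 'd \<Rightarrow> real"
  assumes "f differentiable at (e * y)"
  shows "(\<lambda>y. w * f (e * y)) differentiable at y"
    "partial j (\<lambda>y. w * f (e * y)) y = w * e $ j * partial j f (e * y)"
proof -
  have "linear (\<lambda>y :: real ^ 'd. e * y)"
    by (rule linearI) (auto simp: vec_eq_iff algebra_simps)
  then have "bounded_linear (\<lambda>y :: real ^ 'd. e * y)" by (simp add: linear_conv_bounded_linear)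
  then have "((\<lambda>y. e * y) has_derivative (\<lambda>y. e * y)) (at y)" by (rule bounded_linear_imp_has_derivative)
  from has_derivative_mult_right[OF has_derivative_compose[OF this has_derivative_partial[OF assms]]]
  have D: "((\<lambda>y. w * f (e * y)) has_derivative (\<lambda>h. w * (\<Sum>j\<in>UNIV. (e * h) $ j * partial j f (e * y)))) (at y)" .
  then show "(\<lambda>y. w * f (e * y)) differentiable at y" unfolding differentiable_def by blast
  show "partial j (\<lambda>y. w * f (e * y)) y = w * e $ j * partial j f (e * y)"
    unfolding partial_eq[OF D]
    by (simp add: axis_def if_distrib[where f="\<lambda>a. a * _"] if_distrib[where f="\<lambda>a. _ * a"] sum.If_cases cong: if_cong)
qed

text \<open>Each derivative in direction \<open>j\<close> produces a factor \<open>e $ j\<close>.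
  The weight \<open>w\<close> depends on \<open>e\<close> so that the induction can absorb it; the
  factors accumulated along \<open>js\<close> form \<open>mpow e (counts js)\<close>.\<close>

lemma unif_Ck_scaled:
  fixes f :: "real ^ 'd \<Rightarrow> real" and w :: "real ^ 'd \<Rightarrow> real"
  assumes U: "open U" and UV: "\<And>e y. e \<in> I \<Longrightarrow> y \<in> U \<Longrightarrow> e * y \<in> V"
    and "Ck_on n V f"
    and "\<And>js. length js \<le> n \<Longrightarrow>
      \<exists>B. \<forall>e\<in>I. \<forall>y\<in>U. \<bar>w e * (mpow e (counts js) * foldr partial js f (e * y))\<bar> \<le> B"
  shows "unif_Ck n I U (\<lambda>e y. w e * f (e * y))"
  using assms(3,4)
proof (induction n arbitrary: f w)
  case 0
  have "continuous_on U (\<lambda>y. w e * f (e * y))" if "e \<in> I" for e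
  proof (intro continuous_on_mult continuous_on_const)
    show "continuous_on U (\<lambda>y. f (e * y))"
      using 0(1) UV[OF that]
      by (intro continuous_on_compose2[of V f U "\<lambda>y. e * y"]) (auto simp: times_vec_def intro!: continuous_intros)
  qed
  moreover have "\<exists>B. \<forall>e\<in>I. \<forall>y\<in>U. \<bar>w e * f (e * y)\<bar> \<le> B"
    using 0(2)[of "[]"] by (simp add: counts_Nil mpow_zero)
  ultimately show ?case by simp
next
  case (Suc n)
  have bd: "\<exists>B. \<forall>e\<in>I. \<forall>y\<in>U. \<bar>w e * f (e * y)\<bar> \<le> B"
    using Suc.prems(2)[of "[]"] by (simp add: counts_Nil mpow_zero)
  have diff: "f differentiable at (e * y)" if "e \<in> I" "y \<in> U" for e y
    using Suc.prems(1) UV[OF that] by simp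
  have "unif_Ck n I U (\<lambda>e. partial j (\<lambda>y. w e * f (e * y)))" for j
  proof (rule unif_Ck_cong[OF U])
    show "w e * e $ j * partial j f (e * y) = partial j (\<lambda>y. w e * f (e * y)) y" if "e \<in> I" "y \<in> U" for e y
      using partial_scaled(2)[OF diff[OF that]] by simp
    show "unif_Ck n I U (\<lambda>e y. w e * e $ j * partial j f (e * y))"
    proof (rule Suc.IH)
      show "Ck_on n V (partial j f)" using Suc.prems(1) by simp
      fix js :: "'d list" assume "length js \<le> n"
      \<comment> \<open>\<open>foldr\<close> applies the last list entry first, so the derivative
        already taken is appended at the end.\<close>
      then have len: "length (js @ [j]) \<le> Suc n" by simp
      have cnt: "counts (js @ [j]) = counts js + axis j 1"
        by (auto simp: counts_def vec_eq_iff axis_def)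
      show "\<exists>B. \<forall>e\<in>I. \<forall>y\<in>U. \<bar>w e * e $ j * (mpow e (counts js) * foldr partial js (partial j f) (e * y))\<bar> \<le> B"
        using Suc.prems(2)[OF len] unfolding cnt mpow_add mpow_axis by (simp add: mult_ac)
    qed
  qed
  then show ?case using bd partial_scaled(1)[OF diff] by simp
qed

subsection \<open>Integration by parts\<close>

lemma partial_eq_0_outside:
  assumes "closed Q" "\<And>x. x \<notin> Q \<Longrightarrow> h x = 0" "x \<notin> Q"
  shows "partial j h x = 0"
  using partial_cong[of "- Q" x h "\<lambda>_. 0" j] assms by (auto simp: partial_const)

lemma integrable_continuous_supported:
  fixes h :: "'a :: euclidean_space \<Rightarrow> real"
  assumes "compact Q" "continuous_on UNIV h" "\<And>x. x \<notin> Q \<Longrightarrow> h x = 0"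
  shows "integrable lborel h"
proof -
  have "integrable lborel (\<lambda>x. indicator Q x *\<^sub>R h x)"
    using assms by (intro borel_integrable_compact) (auto intro: continuous_on_subset)
  moreover have "(\<lambda>x. indicator Q x *\<^sub>R h x) = h" using assms(3) by (auto simp: indicator_def fun_eq_iff)
  ultimately show ?thesis by simp
qed

text \<open>The difference quotients of \<open>h\<close> have integral 0 by translation invariance,
  and dominated convergence passes to \<open>partial j h\<close>; neither Fubini nor boundary terms
  appear.\<close>

lemma integral_partial_eq_0:
  fixes h :: "real ^ 'd \<Rightarrow> real"
  assumes Q: "compact Q" "\<And>x. x \<notin> Q \<Longrightarrow> h x = 0"
    and h: "\<And>x. h differentiable at x" "continuous_on UNIV (partial j h)"
  shows "integral\<^sup>L lborel (partial j h) = 0"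
proof -
  define v where "v = axis j (1 :: real)"
  define t where "t = (\<lambda>n. 1 / real (Suc n))"
  define D where "D = (\<lambda>n x. (h (x + t n *\<^sub>R v) - h x) / t n)"
  have t: "0 < t n" "t n \<le> 1" for n by (auto simp: t_def)
  have cont: "continuous_on UNIV h"
    using h(1) by (auto intro!: continuous_at_imp_continuous_on differentiable_imp_continuous_within)
  have int: "integrable lborel h" by (rule integrable_continuous_supported[OF Q(1) cont Q(2)])
  have [measurable]: "h \<in> borel_measurable borel" using cont by (rule borel_measurable_continuous_onI)
  have [measurable]: "partial j h \<in> borel_measurable borel" using h(2) by (rule borel_measurable_continuous_onI)
  have shift_eq: "distr lborel borel ((+) c) = lborel" for c :: "real ^ 'd"
    using lborel_distr_plus .
  have ints: "integrable lborel (\<lambda>x. h (x + c))" "(LINT x|lborel. h (x + c)) = integral\<^sup>L lborel h" for c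
  proof -
    have "integrable (distr lborel borel ((+) c)) h" using int by (simp add: shift_eq)
    then show "integrable lborel (\<lambda>x. h (x + c))" by (subst (asm) integrable_distr_eq) (auto simp: add.commute)
    have "integral\<^sup>L (distr lborel borel ((+) c)) h = (LINT x|lborel. h (c + x))"
      by (rule integral_distr) auto
    then show "(LINT x|lborel. h (x + c)) = integral\<^sup>L lborel h" by (simp add: shift_eq add.commute)
  qed
  have D0: "integral\<^sup>L lborel (D n) = 0" for n
    unfolding D_def using ints[of "t n *\<^sub>R v"] int by simp
  have p0: "partial j h x = 0" if "x \<notin> Q" for x
    using partial_eq_0_outside[OF compact_imp_closed[OF Q(1)] Q(2) that] .
  obtain B where B: "\<And>x. x \<in> Q \<Longrightarrow> \<bar>partial j h x\<bar> \<le> B"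
  proof -
    have "compact (partial j h ` Q)" using h(2) Q(1) by (intro compact_continuous_image) (auto intro: continuous_on_subset)
    then have "bounded (partial j h ` Q)" by (rule compact_imp_bounded)
    then show ?thesis using that unfolding bounded_iff by auto
  qed
  obtain R where R: "R > 0" "Q \<subseteq> cball 0 R"
    using bounded_subset_ballD[OF compact_imp_bounded[OF Q(1)], of 0] ball_subset_cball by blast
  define K where "K = max B 0"
  have pK: "\<bar>partial j h x\<bar> \<le> K" for x using B[of x] p0[of x] by (cases "x \<in> Q") (auto simp: K_def)
  have mvt: "\<bar>D n x\<bar> \<le> K" for n x
  proof -
    have "((\<lambda>s. h (x + s *\<^sub>R v)) has_real_derivative partial j h (x + s *\<^sub>R v)) (at s)" for s
      unfolding v_def by (rule has_real_derivative_axis[OF h(1)])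
    then obtain s where "h (x + t n *\<^sub>R v) - h (x + 0 *\<^sub>R v) = (t n - 0) * partial j h (x + s *\<^sub>R v)"
      using MVT2[of 0 "t n" "\<lambda>s. h (x + s *\<^sub>R v)" "\<lambda>s. partial j h (x + s *\<^sub>R v)"] t[of n] by blast
    then have "D n x = partial j h (x + s *\<^sub>R v)" using t[of n] by (simp add: D_def)
    then show ?thesis using pK by simp
  qed
  \<comment> \<open>The increments have length at most 1, so one ball of radius \<open>R + 1\<close>
    supports all quotients.\<close>
  have Dsupp: "D n x = 0" if "x \<notin> cball 0 (R + 1)" for n x
  proof -
    have "norm (t n *\<^sub>R v) \<le> 1" using t[of n] by (simp add: v_def norm_axis_1)
    then have "norm x \<le> norm (x + t n *\<^sub>R v) + 1"
      using norm_triangle_ineq4[of "x + t n *\<^sub>R v" "t n *\<^sub>R v"] by simp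
    then have "x + t n *\<^sub>R v \<notin> Q" "x \<notin> Q" using that R by auto
    then show ?thesis using Q(2) by (simp add: D_def)
  qed
  have "(\<lambda>n. integral\<^sup>L lborel (D n)) \<longlonglongrightarrow> integral\<^sup>L lborel (partial j h)"
  proof (rule integral_dominated_convergence)
    show "partial j h \<in> borel_measurable lborel" by simp
    show "D n \<in> borel_measurable lborel" for n unfolding D_def by measurable
    show "integrable lborel (\<lambda>x :: real ^ 'd. K * indicator (cball 0 (R + 1)) x)"
      by (intro integrable_mult_right integrable_real_indicator) (use emeasure_lborel_cball_finite[of "0 :: real ^ 'd" "R + 1"] in auto)
    show "AE x in lborel. norm (D n x) \<le> K * indicator (cball 0 (R + 1)) x" for n
      using mvt Dsupp by (intro AE_I2) (auto simp: indicator_def)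
    show "AE x in lborel. (\<lambda>n. D n x) \<longlonglongrightarrow> partial j h x"
    proof (intro AE_I2)
      fix x
      have "((\<lambda>s. h (x + s *\<^sub>R v)) has_real_derivative partial j h (x + 0 *\<^sub>R v)) (at 0)"
        unfolding v_def by (rule has_real_derivative_axis[OF h(1)])
      then have "((\<lambda>s. (h (x + s *\<^sub>R v) - h x) / s) \<longlongrightarrow> partial j h x) (at 0)"
        by (simp add: has_field_derivative_iff)
      moreover have "filterlim t (at 0) sequentially"
        unfolding filterlim_at using t(1) lim_1_over_n[THEN LIMSEQ_Suc]
        by (auto simp: t_def less_imp_neq[symmetric])
      ultimately show "(\<lambda>n. D n x) \<longlonglongrightarrow> partial j h x"
        unfolding D_def using filterlim_compose by blast
    qed
  qed
  then show ?thesis by (simp add: D0 LIMSEQ_const_iff)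
qed

text \<open>The rescaled phase is controlled on \<open>U\<close> only, while the integrals run over
  the whole space. Gluing along the open sets \<open>U\<close> and \<open>- Q\<close> makes the
  integrands globally continuous.\<close>

lemma continuous_on_extend_zero:
  fixes u :: "'a :: t2_space \<Rightarrow> 'b :: {topological_space, zero}"
  assumes U: "open U" and Q: "compact Q" "Q \<subseteq> U"
    and u: "continuous_on U u" "\<And>x. x \<in> U - Q \<Longrightarrow> u x = 0"
  shows "continuous_on UNIV (\<lambda>x. if x \<in> U then u x else 0)"
proof -
  have "continuous_on (U \<union> - Q) (\<lambda>x. if x \<in> U then u x else 0)"
  proof (rule continuous_on_open_Un)
    show "open (- Q)" using Q(1) by (simp add: compact_imp_closed open_Compl)
    show "continuous_on U (\<lambda>x. if x \<in> U then u x else 0)" using u(1) by (simp cong: continuous_on_cong)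
    have "continuous_on (- Q) (\<lambda>x. 0)" by simp
    then show "continuous_on (- Q) (\<lambda>x. if x \<in> U then u x else 0)"
      by (rule continuous_on_cong[THEN iffD1, rotated -1]) (use u(2) in auto)
  qed fact
  moreover have "U \<union> - Q = UNIV" using Q(2) by blast
  ultimately show ?thesis by simp
qed

lemma integrable_extend_zero:
  fixes u :: "'a :: euclidean_space \<Rightarrow> real"
  assumes U: "open U" and Q: "compact Q" "Q \<subseteq> U"
    and u: "continuous_on U u" "\<And>x. x \<in> U - Q \<Longrightarrow> u x = 0"
  shows "integrable lborel (\<lambda>x. if x \<in> U then u x else 0)"
  by (rule integrable_continuous_supported[OF Q(1) continuous_on_extend_zero[OF U Q u]]) (use Q u in auto)

lemma integral_extend_zero_bound:
  fixes u :: "'a :: euclidean_space \<Rightarrow> real"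
  assumes U: "open U" and Q: "compact Q" "Q \<subseteq> U"
    and u: "continuous_on U u" "\<And>x. x \<in> U - Q \<Longrightarrow> u x = 0" "\<And>x. x \<in> U \<Longrightarrow> \<bar>u x\<bar> \<le> B"
  shows "\<bar>(LINT x|lborel. (if x \<in> U then u x else 0))\<bar> \<le> B * measure lborel Q"
proof -
  have fin: "emeasure lborel Q < \<infinity>" using Q(1) compact_imp_bounded emeasure_bounded_finite by blast
  have "norm (LINT x|lborel. (if x \<in> U then u x else 0)) \<le> (LINT x|lborel. B * indicator Q x)"
  proof (rule order_trans[OF integral_norm_bound], rule integral_mono)
    show "integrable lborel (\<lambda>x. norm (if x \<in> U then u x else 0))"
      by (rule integrable_norm[OF integrable_extend_zero[OF U Q u(1,2)]])
    show "integrable lborel (\<lambda>x. B * indicator Q x)"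
      using fin Q(1) by (intro integrable_mult_right integrable_real_indicator) (auto simp: compact_imp_closed)
    show "norm (if x \<in> U then u x else 0) \<le> B * indicator Q x" for x
      using u(2,3)[of x] Q(2) by (auto simp: indicator_def)
  qed
  also have "\<dots> = B * measure lborel Q" by (simp add: measure_def)
  finally show ?thesis by simp
qed

text \<open>The field with components \<open>sin (\<mu> * \<Phi> x + \<theta>) * g j x\<close>,
  extended by 0, has compact support, so its divergence integrates to 0; the two sides are the two
  halves of the product rule.\<close>

lemma integration_by_parts:
  fixes \<Phi> :: "real ^ 'd \<Rightarrow> real" and g :: "'d \<Rightarrow> real ^ 'd \<Rightarrow> real"
  assumes U: "open U" and Q: "compact Q" "Q \<subseteq> U"
    and \<Phi>: "\<And>x. x \<in> U \<Longrightarrow> \<Phi> differentiable at x" "\<And>j. continuous_on U (partial j \<Phi>)"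
    and g: "\<And>j x. x \<in> U \<Longrightarrow> g j differentiable at x" "\<And>j. continuous_on U (partial j (g j))"
      "\<And>j x. x \<in> U - Q \<Longrightarrow> g j x = 0"
  shows "\<mu> * (LINT x|lborel. (if x \<in> U then cos (\<mu> * \<Phi> x + \<theta>) * (\<Sum>j\<in>UNIV. partial j \<Phi> x * g j x) else 0)) =
    - (LINT x|lborel. (if x \<in> U then sin (\<mu> * \<Phi> x + \<theta>) * (\<Sum>j\<in>UNIV. partial j (g j) x) else 0))"
    (is "\<mu> * integral\<^sup>L lborel ?A = - integral\<^sup>L lborel ?B")
proof -
  have cont: "continuous_on U \<Phi>" "continuous_on U (g j)" for j
    using \<Phi>(1) g(1) by (auto intro!: continuous_at_imp_continuous_on differentiable_imp_continuous_within)
  have opn: "open (U - Q)" using U Q(1) by (simp add: open_Diff compact_imp_closed)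
  have pg0: "partial j (g j) x = 0" if "x \<in> U - Q" for j x
    using partial_cong[OF opn that g(3), where j = j] by (simp add: partial_const)
  define h where "h = (\<lambda>j x. if x \<in> U then sin (\<mu> * \<Phi> x + \<theta>) * g j x else 0)"
  define h' where "h' = (\<lambda>j x. \<mu> * cos (\<mu> * \<Phi> x + \<theta>) * partial j \<Phi> x * g j x + sin (\<mu> * \<Phi> x + \<theta>) * partial j (g j) x)"
  have hder: "h j differentiable at x \<and> partial j (h j) x = (if x \<in> U then h' j x else 0)" for j x
  proof (cases "x \<in> U")
    case True
    have "((\<lambda>x. sin (\<mu> * \<Phi> x + \<theta>)) has_derivative
       (\<lambda>v. (\<mu> * frechet_derivative \<Phi> (at x) v) * cos (\<mu> * \<Phi> x + \<theta>))) (at x)"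
      by (auto intro!: derivative_eq_intros has_derivative_frechet \<Phi>(1) True)
    from has_derivative_mult[OF this has_derivative_frechet[OF g(1)[OF True, of j]]]
    have "(h j has_derivative (\<lambda>v. sin (\<mu> * \<Phi> x + \<theta>) * frechet_derivative (g j) (at x) v +
       (\<mu> * frechet_derivative \<Phi> (at x) v) * cos (\<mu> * \<Phi> x + \<theta>) * g j x)) (at x)"
      by (rule has_derivative_transform_within_open[OF _ U True]) (simp add: h_def)
    from partial_eq[OF this, of j] this show ?thesis
      using True by (auto simp: h'_def partial_def differentiable_def)
  next
    case False
    have o: "open (- Q)" "x \<in> - Q" using False Q by (auto simp: compact_imp_closed open_Compl)
    have 0: "0 = h j y" if "y \<in> - Q" for y using g(3)[of y j] that by (auto simp: h_def)
    have "h j differentiable at x" by (rule differentiable_cong_open[OF o 0]) auto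
    moreover have "partial j (h j) x = 0"
      using partial_cong[OF o 0, where j = j] by (simp add: partial_const)
    ultimately show ?thesis using False by simp
  qed
  have ph: "partial j (h j) = (\<lambda>x. if x \<in> U then h' j x else 0)" for j using hder by blast
  have h'c: "continuous_on U (h' j)" for j
    unfolding h'_def using cont \<Phi>(2)[of j] g(2)[of j] by (intro continuous_intros) auto
  have h'0: "h' j x = 0" if "x \<in> U - Q" for j x using g(3)[OF that] pg0[OF that] by (simp add: h'_def)
  have "(LINT x|lborel. (if x \<in> U then h' j x else 0)) = 0" for j
  proof -
    have "integral\<^sup>L lborel (partial j (h j)) = 0"
    proof (rule integral_partial_eq_0[OF Q(1)])
      show "continuous_on UNIV (partial j (h j))"
        unfolding ph by (rule continuous_on_extend_zero[OF U Q h'c h'0])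
    qed (use hder g(3) in \<open>auto simp: h_def\<close>)
    then show ?thesis by (simp only: ph)
  qed
  then have "0 = (\<Sum>j\<in>UNIV. LINT x|lborel. (if x \<in> U then h' j x else 0))" by simp
  also have "\<dots> = (LINT x|lborel. (\<Sum>j\<in>UNIV. if x \<in> U then h' j x else 0))"
    by (rule Bochner_Integration.integral_sum[symmetric]) (rule integrable_extend_zero[OF U Q h'c h'0])
  also have "\<dots> = (LINT x|lborel. (\<mu> * ?A x + ?B x))"
    by (rule Bochner_Integration.integral_cong)
       (auto simp: h'_def sum.distrib sum_distrib_left sum_distrib_right algebra_simps)
  also have "\<dots> = (LINT x|lborel. \<mu> * ?A x) + integral\<^sup>L lborel ?B"
  proof (rule Bochner_Integration.integral_add)
    have "continuous_on U (\<lambda>x. cos (\<mu> * \<Phi> x + \<theta>) * (\<Sum>j\<in>UNIV. partial j \<Phi> x * g j x))"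
      using cont \<Phi>(2) by (intro continuous_intros) auto
    then have "integrable lborel ?A"
      by (rule integrable_extend_zero[OF U Q]) (simp add: g(3))
    then show "integrable lborel (\<lambda>x. \<mu> * ?A x)" by simp
    have "continuous_on U (\<lambda>x. sin (\<mu> * \<Phi> x + \<theta>) * (\<Sum>j\<in>UNIV. partial j (g j) x))"
      using cont g(2) by (intro continuous_intros) auto
    then show "integrable lborel ?B"
      by (rule integrable_extend_zero[OF U Q]) (simp add: pg0)
  qed
  finally show ?thesis by simp
qed

text \<open>One step replaces \<open>\<psi>\<close> by \<open>\<Sum>\<^sub>j \<partial>\<^sub>j (\<partial>\<^sub>j\<Phi> \<psi> / |\<nabla>\<Phi>|\<^sup>2)\<close>, losing one derivative and gaining a
  factor \<open>1 / \<mu>\<close>; the sine it produces is absorbed into the phase shift \<open>\<theta>\<close>.\<close>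

lemma nonstationary_phase:
  fixes \<Phi> \<psi> :: "'i \<Rightarrow> real ^ 'd \<Rightarrow> real"
  assumes U: "open U" and Q: "compact Q" "Q \<subseteq> U"
    and c: "c > 0" "\<And>i x. i \<in> I \<Longrightarrow> x \<in> U \<Longrightarrow> c \<le> (\<Sum>j\<in>UNIV. partial j (\<Phi> i) x * partial j (\<Phi> i) x)"
    and "unif_Ck (Suc N) I U \<Phi>" "unif_Ck N I U \<psi>"
    and "\<And>i x. i \<in> I \<Longrightarrow> x \<in> U - Q \<Longrightarrow> \<psi> i x = 0"
  shows "\<exists>K. \<forall>i\<in>I. \<forall>\<mu>>0. \<forall>\<theta>.
    \<bar>(LINT x|lborel. (if x \<in> U then cos (\<mu> * \<Phi> i x + \<theta>) * \<psi> i x else 0))\<bar> \<le> K / \<mu> ^ N"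
  using assms(6-)
proof (induction N arbitrary: \<psi>)
  case 0
  obtain B where B: "\<forall>i\<in>I. \<forall>x\<in>U. \<bar>\<psi> i x\<bar> \<le> B" using 0(2) by auto
  have "\<bar>(LINT x|lborel. (if x \<in> U then cos (\<mu> * \<Phi> i x + \<theta>) * \<psi> i x else 0))\<bar> \<le> B * measure lborel Q"
    if i: "i \<in> I" for i \<mu> \<theta>
  proof (rule integral_extend_zero_bound[OF U Q])
    show "continuous_on U (\<lambda>x. cos (\<mu> * \<Phi> i x + \<theta>) * \<psi> i x)"
      using unif_Ck_continuous[OF 0(1) i] unif_Ck_continuous[OF 0(2) i] by (intro continuous_intros)
    show "cos (\<mu> * \<Phi> i x + \<theta>) * \<psi> i x = 0" if "x \<in> U - Q" for x using 0(3)[OF i that] by simp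
    show "\<bar>cos (\<mu> * \<Phi> i x + \<theta>) * \<psi> i x\<bar> \<le> B" if "x \<in> U" for x
      using abs_mult_le[of "cos (\<mu> * \<Phi> i x + \<theta>)" 1 "\<psi> i x" B] B i that by simp
  qed
  then show ?case by auto
next
  case (Suc N)
  define G where "G = (\<lambda>i x. \<Sum>j\<in>UNIV. partial j (\<Phi> i) x * partial j (\<Phi> i) x)"
  define g where "g = (\<lambda>j i x. partial j (\<Phi> i) x * inverse (G i x) * \<psi> i x)"
  define \<psi>' where "\<psi>' = (\<lambda>i x. \<Sum>j\<in>UNIV. partial j (g j i) x)"
  \<comment> \<open>\<open>\<Phi>\<close> is controlled to one order more than
    \<open>\<psi>\<close>, so its gradient has the order of \<open>\<psi>\<close>, and so do the
    fields \<open>g j\<close>.\<close>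
  have dP: "unif_Ck (Suc N) I U (\<lambda>i. partial j (\<Phi> i))" for j using Suc.prems(1) by simp
  have "unif_Ck (Suc N) I U G"
    unfolding G_def by (intro unif_Ck_sum[OF U] unif_Ck_mult[OF U] dP) auto
  then have "unif_Ck (Suc N) I U (\<lambda>i x. inverse (G i x))"
    using c by (intro unif_Ck_inverse[OF U, of c]) (auto simp: G_def)
  then have g: "unif_Ck (Suc N) I U (g j)" for j
    unfolding g_def by (intro unif_Ck_mult[OF U] dP Suc.prems(2))
  then have \<psi>': "unif_Ck N I U \<psi>'"
    unfolding \<psi>'_def by (intro unif_Ck_sum[OF U]) auto
  have g0: "g j i x = 0" if "i \<in> I" "x \<in> U - Q" for i j x
    using Suc.prems(3)[OF that] by (simp add: g_def)
  have opn: "open (U - Q)" using U Q(1) by (simp add: open_Diff compact_imp_closed)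
  have "\<psi>' i x = 0" if "i \<in> I" "x \<in> U - Q" for i x
    using partial_cong[OF opn that(2) g0[OF that(1)]] by (simp add: \<psi>'_def partial_const)
  then obtain K where K: "\<And>i \<mu> \<theta>. i \<in> I \<Longrightarrow> \<mu> > 0 \<Longrightarrow>
      \<bar>(LINT x|lborel. (if x \<in> U then cos (\<mu> * \<Phi> i x + \<theta>) * \<psi>' i x else 0))\<bar> \<le> K / \<mu> ^ N"
    using Suc.IH[OF unif_Ck_Suc_imp[OF Suc.prems(1)] \<psi>'] by blast
  have "\<bar>(LINT x|lborel. (if x \<in> U then cos (\<mu> * \<Phi> i x + \<theta>) * \<psi> i x else 0))\<bar> \<le> K / \<mu> ^ Suc N"
    if i: "i \<in> I" and \<mu>: "\<mu> > 0" for i \<mu> \<theta>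
  proof -
    have sumg: "(\<Sum>j\<in>UNIV. partial j (\<Phi> i) x * g j i x) = \<psi> i x" if "x \<in> U" for x
    proof -
      have "(\<Sum>j\<in>UNIV. partial j (\<Phi> i) x * g j i x) = G i x * (inverse (G i x) * \<psi> i x)"
        unfolding g_def by (subst (2) G_def) (simp add: sum_distrib_left sum_distrib_right mult_ac)
      moreover have "G i x \<noteq> 0" using c(1) c(2)[OF i that] by (simp add: G_def)
      ultimately show ?thesis by simp
    qed
    have "\<mu> * (LINT x|lborel. (if x \<in> U then cos (\<mu> * \<Phi> i x + \<theta>) * (\<Sum>j\<in>UNIV. partial j (\<Phi> i) x * g j i x) else 0)) =
      - (LINT x|lborel. (if x \<in> U then sin (\<mu> * \<Phi> i x + \<theta>) * (\<Sum>j\<in>UNIV. partial j (g j i) x) else 0))"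
    proof (rule integration_by_parts[OF U Q])
      show "\<Phi> i differentiable at x" if "x \<in> U" for x using Suc.prems(1) i that by simp
      show "continuous_on U (partial j (\<Phi> i))" for j by (rule unif_Ck_continuous[OF dP i])
      show "g j i differentiable at x" if "x \<in> U" for j x using g[of j] i that by simp
      show "continuous_on U (partial j (g j i))" for j
        using g[of j] i unif_Ck_continuous[of N I U "\<lambda>i. partial j (g j i)" i] by simp
    qed (use g0 i in auto)
    also have "(\<lambda>x. if x \<in> U then cos (\<mu> * \<Phi> i x + \<theta>) * (\<Sum>j\<in>UNIV. partial j (\<Phi> i) x * g j i x) else 0)
      = (\<lambda>x. if x \<in> U then cos (\<mu> * \<Phi> i x + \<theta>) * \<psi> i x else 0)"
      using sumg by auto
    also have "(\<lambda>x. if x \<in> U then sin (\<mu> * \<Phi> i x + \<theta>) * (\<Sum>j\<in>UNIV. partial j (g j i) x) else 0)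
      = (\<lambda>x. if x \<in> U then cos (\<mu> * \<Phi> i x + (\<theta> - pi / 2)) * \<psi>' i x else 0)"
    proof -
      have "a + (\<theta> - pi / 2) = (a + \<theta>) - pi / 2" for a by simp
      then have "cos (a + (\<theta> - pi / 2)) = sin (a + \<theta>)" for a
        using cos_diff[of "a + \<theta>" "pi / 2"] by (simp only: cos_pi_half sin_pi_half mult_zero_right mult_1_right add_0)
      then show ?thesis by (simp only: \<psi>'_def)
    qed
    finally have eq: "\<mu> * (LINT x|lborel. (if x \<in> U then cos (\<mu> * \<Phi> i x + \<theta>) * \<psi> i x else 0))
      = - (LINT x|lborel. (if x \<in> U then cos (\<mu> * \<Phi> i x + (\<theta> - pi / 2)) * \<psi>' i x else 0))" .
    have "\<bar>\<mu> * (LINT x|lborel. (if x \<in> U then cos (\<mu> * \<Phi> i x + \<theta>) * \<psi> i x else 0))\<bar> \<le> K / \<mu> ^ N"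
      unfolding eq abs_minus_cancel by (rule K[OF i \<mu>])
    then show ?thesis using \<mu> by (simp only: abs_mult abs_of_pos) (simp add: field_simps)
  qed
  then show ?case by blast
qed

subsection \<open>Taylor polynomials\<close>

lemma Ck_on_diff:
  assumes U: "open U" and "Ck_on n U f" "Ck_on n U g"
  shows "Ck_on n U (\<lambda>x. f x - g x)"
  using assms(2,3)
proof (induction n arbitrary: f g)
  case 0
  then show ?case by (auto intro: continuous_on_diff)
next
  case (Suc n)
  have "Ck_on n U (partial j (\<lambda>x. f x - g x))" for j
  proof (rule Ck_on_cong[OF U])
    show "Ck_on n U (\<lambda>x. partial j f x - partial j g x)" using Suc.prems by (intro Suc.IH) auto
    show "partial j f x - partial j g x = partial j (\<lambda>x. f x - g x) x" if "x \<in> U" for x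
      using Suc.prems that by (simp add: partial_diff)
  qed
  then show ?case using Suc.prems by (auto intro: differentiable_diff)
qed

lemma foldr_partial_diff:
  assumes U: "open U" and "Ck_on (length js) U f" "Ck_on (length js) U g" "x \<in> U"
  shows "foldr partial js (\<lambda>x. f x - g x) x = foldr partial js f x - foldr partial js g x"
  using assms(2-)
proof (induction js arbitrary: x)
  case Nil
  then show ?case by simp
next
  case (Cons j js)
  have C: "Ck_on (length js) U f" "Ck_on (length js) U g"
    using Cons.prems(1,2) Ck_on_Suc_imp by auto
  have "Ck_on 1 U (foldr partial js f)" "Ck_on 1 U (foldr partial js g)"
    using Cons.prems(1,2) by (auto intro!: Ck_on_foldr[where n="Suc (length js)"] simp del: Ck_on.simps)
  then have d: "foldr partial js f differentiable at x" "foldr partial js g differentiable at x"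
    using Cons.prems(3) by auto
  have "partial j (foldr partial js (\<lambda>x. f x - g x)) x = partial j (\<lambda>x. foldr partial js f x - foldr partial js g x) x"
    by (rule partial_cong[OF U Cons.prems(3) Cons.IH[OF C]])
  also have "\<dots> = partial j (foldr partial js f) x - partial j (foldr partial js g) x"
    using d by (rule partial_diff)
  finally show ?case by simp
qed

text \<open>Taylor's theorem in Peano's form: induction by the mean value theorem along rays from 0,
  with continuity alone as the base case. A Lagrange remainder would require one derivative more;
  instead \<delta> is arbitrarily small.\<close>

lemma vanishing_derivatives_bound:
  fixes R :: "real ^ 'd \<Rightarrow> real"
  assumes U: "open U" "0 \<in> U" and "Ck_on m U R"
    and "\<And>js. length js \<le> m \<Longrightarrow> foldr partial js R 0 = 0" and "\<delta> > 0"
  shows "\<exists>s>0. \<forall>x. infnorm x < s \<longrightarrow> \<bar>R x\<bar> \<le> \<delta> * infnorm x ^ m"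
  using assms(3-)
proof (induction m arbitrary: R \<delta>)
  case 0
  have "isCont R 0" using 0(1) U continuous_on_eq_continuous_at by auto
  then obtain d where d: "d > 0" "\<And>x. norm x < d \<Longrightarrow> \<bar>R x - R 0\<bar> < \<delta>"
    using 0(3) unfolding continuous_at LIM_def dist_norm by (metis diff_zero abs_0 diff_self real_norm_def)
  have "\<bar>R x\<bar> \<le> \<delta>" if "infnorm x < d / sqrt DIM(real ^ 'd)" for x
  proof -
    have "norm x \<le> sqrt DIM(real ^ 'd) * infnorm x" by (rule norm_le_infnorm)
    also have "\<dots> < d" using that by (simp add: field_simps)
    finally show ?thesis using d(2)[of x] 0(2)[of "[]"] by simp
  qed
  then show ?case using d(1) by (intro exI[of _ "d / sqrt DIM(real ^ 'd)"]) auto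
next
  case (Suc m)
  \<comment> \<open>The derivative along the ray is a sum of one term per coordinate.\<close>
  define \<delta>' where "\<delta>' = \<delta> / CARD('d)"
  have \<delta>': "\<delta>' > 0" using Suc.prems(3) by (simp add: \<delta>'_def)
  have "\<exists>s>0. \<forall>x. infnorm x < s \<longrightarrow> \<bar>partial j R x\<bar> \<le> \<delta>' * infnorm x ^ m" for j
  proof (rule Suc.IH[OF _ _ \<delta>'])
    show "Ck_on m U (partial j R)" using Suc.prems(1) by simp
    show "foldr partial js (partial j R) 0 = 0" if "length js \<le> m" for js
      using Suc.prems(2)[of "js @ [j]"] that by simp
  qed
  then obtain s where s: "\<And>j. s j > 0" "\<And>j x. infnorm x < s j \<Longrightarrow> \<bar>partial j R x\<bar> \<le> \<delta>' * infnorm x ^ m"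
    by metis
  obtain d where d: "d > 0" "ball 0 d \<subseteq> U" using U open_contains_ball by blast
  define t where "t = Min (insert (d / sqrt DIM(real ^ 'd)) (range s))"
  have t: "t > 0" "\<And>j. t \<le> s j" "t \<le> d / sqrt DIM(real ^ 'd)"
  proof -
    show "t > 0" using s(1) d(1) by (auto simp: t_def)
    show "t \<le> s j" for j unfolding t_def by (intro Min_le) auto
    show "t \<le> d / sqrt DIM(real ^ 'd)" unfolding t_def by (intro Min_le) auto
  qed
  have "\<bar>R x\<bar> \<le> \<delta> * infnorm x ^ Suc m" if x: "infnorm x < t" for x
  proof -
    have xU: "r *\<^sub>R x \<in> U" "infnorm (r *\<^sub>R x) \<le> infnorm x" if "0 \<le> r" "r \<le> 1" for r
    proof -
      show le: "infnorm (r *\<^sub>R x) \<le> infnorm x"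
        using that infnorm_pos_le[of x] by (simp add: infnorm_mul mult_left_le_one_le)
      have "norm (r *\<^sub>R x) \<le> sqrt DIM(real ^ 'd) * infnorm (r *\<^sub>R x)" by (rule norm_le_infnorm)
      also have "\<dots> \<le> sqrt DIM(real ^ 'd) * infnorm x" using le by (intro mult_left_mono) auto
      also have "\<dots> < sqrt DIM(real ^ 'd) * (d / sqrt DIM(real ^ 'd))"
        using x t(3) by (intro mult_strict_left_mono) auto
      also have "\<dots> = d" by simp
      finally show "r *\<^sub>R x \<in> U" using d(2) by auto
    qed
    have "((\<lambda>r. R (0 + r *\<^sub>R x)) has_real_derivative (\<Sum>j\<in>UNIV. x $ j * partial j R (0 + r *\<^sub>R x))) (at r)"
      if "0 \<le> r" "r \<le> 1" for r
      using Suc.prems(1) xU(1)[OF that] by (intro has_real_derivative_line) auto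
    then obtain r where r: "0 < r" "r < 1"
      "R (0 + 1 *\<^sub>R x) - R (0 + 0 *\<^sub>R x) = (1 - 0) * (\<Sum>j\<in>UNIV. x $ j * partial j R (0 + r *\<^sub>R x))"
      using MVT2[of 0 1 "\<lambda>r. R (0 + r *\<^sub>R x)" "\<lambda>r. \<Sum>j\<in>UNIV. x $ j * partial j R (0 + r *\<^sub>R x)"] by auto
    then have "\<bar>R x\<bar> = \<bar>\<Sum>j\<in>UNIV. x $ j * partial j R (r *\<^sub>R x)\<bar>"
      using Suc.prems(2)[of "[]"] by simp
    also have "\<dots> \<le> (\<Sum>j\<in>(UNIV :: 'd set). infnorm x * (\<delta>' * infnorm x ^ m))"
    proof (rule order_trans[OF sum_abs sum_mono])
      fix j
      have le: "infnorm (r *\<^sub>R x) \<le> infnorm x" using xU(2)[of r] r by simp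
      have "\<bar>partial j R (r *\<^sub>R x)\<bar> \<le> \<delta>' * infnorm (r *\<^sub>R x) ^ m"
        using le x t(2)[of j] by (intro s(2)) linarith
      also have "\<dots> \<le> \<delta>' * infnorm x ^ m"
        using le \<delta>' by (intro mult_left_mono power_mono) (auto simp: infnorm_pos_le)
      finally show "\<bar>x $ j * partial j R (r *\<^sub>R x)\<bar> \<le> infnorm x * (\<delta>' * infnorm x ^ m)"
        by (intro abs_mult_le component_le_infnorm_cart)
    qed
    also have "\<dots> = \<delta> * infnorm x ^ Suc m" by (simp add: \<delta>'_def)
    finally show ?thesis .
  qed
  then show ?case using t(1) by blast
qed

text \<open>One radius serves all derivatives, because there are finitely many lists of directions
  of length at most \<open>k\<close>.\<close>

lemma taylor_remainder_bound:
  fixes R :: "real ^ 'd \<Rightarrow> real"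
  assumes U: "open U" "0 \<in> U" and R: "Ck_on k U R"
    "\<And>js. length js \<le> k \<Longrightarrow> foldr partial js R 0 = 0" and "\<delta> > 0"
  obtains s where "s > 0" "\<And>js x. length js \<le> k \<Longrightarrow> infnorm x < s \<Longrightarrow>
    \<bar>foldr partial js R x\<bar> \<le> \<delta> * infnorm x ^ (k - length js)"
proof -
  have "\<exists>s>0. \<forall>x. infnorm x < s \<longrightarrow> \<bar>foldr partial js R x\<bar> \<le> \<delta> * infnorm x ^ (k - length js)"
    if js: "length js \<le> k" for js
  proof (rule vanishing_derivatives_bound[OF U _ _ \<open>\<delta> > 0\<close>])
    show "Ck_on (k - length js) U (foldr partial js R)" using R(1) js by (auto intro: Ck_on_foldr)
    show "foldr partial is (foldr partial js R) 0 = 0" if "length is \<le> k - length js" for "is"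
      using R(2)[of "is @ js"] that js by simp
  qed
  then obtain s where s: "\<And>js. length js \<le> k \<Longrightarrow> s js > 0" "\<And>js x. length js \<le> k \<Longrightarrow> infnorm x < s js \<Longrightarrow>
    \<bar>foldr partial js R x\<bar> \<le> \<delta> * infnorm x ^ (k - length js)" by metis
  define L where "L = {js :: 'd list. length js \<le> k}"
  have L: "finite L" "[] \<in> L" unfolding L_def using finite_lists_length_le[of "UNIV :: 'd set" k] by auto
  define t where "t = Min (s ` L)"
  have "t > 0"
  proof -
    have "s ` L \<noteq> {}" using L(2) by blast
    then have "t \<in> s ` L" unfolding t_def using L(1) by (intro Min_in) auto
    then show ?thesis using s(1) by (auto simp: L_def)
  qed
  moreover have "\<And>js. js \<in> L \<Longrightarrow> t \<le> s js" unfolding t_def using L by (intro Min_le) auto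
  ultimately
  show ?thesis using that[of t] s(2) unfolding L_def by (metis mem_Collect_eq order_less_le_trans)
qed

definition taylor_coeff :: "nat \<Rightarrow> (real ^ 'd \<Rightarrow> real) \<Rightarrow> nat ^ 'd \<Rightarrow> real" where
  "taylor_coeff k f a = (if deg a \<le> k then mderiv a f 0 / (\<Prod>j\<in>UNIV. fact (a $ j)) else 0)"

lemma ps_taylor_poly: "ps r (taylor_coeff k f) (taylor_poly k f)"
  unfolding ps_def
proof (intro allI impI, rule has_sum_finite_neutralI)
  fix x :: "real ^ 'a"
  show "finite {a :: nat ^ 'a. deg a \<le> k}" by (rule finite_deg_le)
  show "taylor_poly k f x = (\<Sum>a\<in>{a. deg a \<le> k}. taylor_coeff k f a * mpow x a)"
    unfolding taylor_poly_def deg_def[symmetric] by (intro sum.cong) (auto simp: taylor_coeff_def)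
qed (auto simp: taylor_coeff_def)

lemma foldr_partial_taylor_poly:
  assumes U: "open U" "0 \<in> U" and f: "Ck_on k U f" and js: "length js \<le> k"
  shows "foldr partial js (taylor_poly k f) 0 = foldr partial js f 0"
proof -
  \<comment> \<open>The list that the choice in \<open>mderiv\<close> produces for
    \<open>counts js\<close>; it is a permutation of \<open>js\<close>.\<close>
  define ks where "ks = (SOME ks. \<forall>j. count_list ks j = counts js $ j)"
  have "\<forall>j. count_list js j = counts js $ j" by (simp add: counts_def)
  then have "\<forall>j. count_list ks j = counts js $ j" unfolding ks_def by (rule someI)
  then have "mset js = mset ks" by (intro multiset_eqI) (simp add: counts_def count_mset)
  then have "mderiv (counts js) f 0 = foldr partial js f 0"
    unfolding mderiv_def ks_def[symmetric]
    using foldr_partial_perm[OF U(1) _ Ck_on_mono[OF f js] U(2)] by simp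
  moreover have "foldr partial js (taylor_poly k f) 0 = (\<Prod>j\<in>UNIV. fact (counts js $ j)) * taylor_coeff k f (counts js)"
    by (rule ps_derivatives_at_0[OF ps_taylor_poly[of 1]]) simp
  ultimately show ?thesis using js by (simp add: taylor_coeff_def length_eq_deg)
qed

text \<open>Otherwise every exponent has a nonzero, hence at least unit, entry off the axis. The sum
  of the coordinates other than \<open>j\<close> is then at least 1 on the whole polyhedron, but it
  is 0 on the axis.\<close>

lemma convenient_axis_exponent:
  fixes P :: "real ^ 'd \<Rightarrow> real"
  assumes "convenient P"
  shows "\<exists>a\<in>psupp P. \<forall>i. i \<noteq> j \<longrightarrow> a $ i = 0"
proof (rule ccontr)
  assume neg: "\<not> ?thesis"
  obtain t where t: "axis j t \<in> newton_polyhedron P" using assms by (auto simp: convenient_def)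
  define l :: "real ^ 'd" where "l = (\<chi> i. if i = j then 0 else 1)"
  have "newton_polyhedron P \<subseteq> {x. l \<bullet> x \<ge> 1}"
    unfolding newton_polyhedron_def
  proof (rule hull_minimal, safe)
    fix a and y :: "real ^ 'd" assume a: "a \<in> psupp P" and y: "\<forall>i. 0 \<le> y $ i"
    obtain i where i: "i \<noteq> j" "a $ i \<noteq> 0" using neg a by blast
    have "1 \<le> l $ i * (rvec a + y) $ i" using i y by (simp add: l_def rvec_def add_increasing2)
    also have "\<dots> \<le> l \<bullet> (rvec a + y)" unfolding inner_vec_def inner_real_def
      using y by (intro member_le_sum) (auto simp: l_def rvec_def)
    finally show "1 \<le> l \<bullet> (rvec a + y)" .
  qed (simp add: convex_halfspace_ge)
  then have "1 \<le> l \<bullet> axis j t" using t by blast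
  then show False by (simp add: inner_axis l_def)
qed

lemma infnorm_attained: "\<exists>j. infnorm (x :: real ^ 'd) = \<bar>x $ j\<bar>"
proof -
  have "\<not> infnorm x < infnorm x" by simp
  then obtain j where "\<not> \<bar>x $ j\<bar> < infnorm x" unfolding infnorm_less_iff by blast
  then show ?thesis using component_le_infnorm_cart[of x j] by (intro exI[of _ j]) simp
qed

text \<open>Take the axis of a largest coordinate of \<open>e\<close> and an exponent
  \<open>a\<close> of \<open>P\<close> on it. As its degree is at most \<open>k\<close>,
  \<open>infnorm e ^ k\<close> is at most the monomial of \<open>a\<close>, which is at most that of
  some \<open>v\<close> below \<open>a\<close>.\<close>

lemma convenient_power_le:
  fixes e :: "real ^ 'd"
  assumes P: "convenient P" "\<And>a. a \<in> psupp P \<Longrightarrow> deg a \<le> k"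
    and V: "finite V" "\<And>a. a \<in> psupp P \<Longrightarrow> \<exists>v\<in>V. v \<le> a"
    and e: "\<And>j. 0 < e $ j \<and> e $ j < 1"
  shows "infnorm e ^ k \<le> (\<Sum>v\<in>V. mpow e v)"
proof -
  obtain j where j: "infnorm e = e $ j" using infnorm_attained[of e] e by (metis abs_of_pos)
  obtain a where a: "a \<in> psupp P" "\<And>i. i \<noteq> j \<Longrightarrow> a $ i = 0" using convenient_axis_exponent[OF P(1)] by blast
  have ae: "mpow e a = e $ j ^ (a $ j)"
    unfolding mpow_def by (subst prod.remove[of _ j]) (auto simp: a(2))
  obtain v where v: "v \<in> V" "v \<le> a" using V(2) a(1) by blast
  have "e $ j ^ k \<le> e $ j ^ (a $ j)"
    using e[of j] P(2)[OF a(1)] component_le_deg[of a j] by (intro power_decreasing) auto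
  also have "\<dots> = mpow e (v + (a - v))" using v(2) unfolding ae[symmetric]
    by (intro arg_cong[where f="mpow e"]) (simp add: vec_eq_iff less_eq_vec_def)
  also have "\<dots> \<le> mpow e v * 1" unfolding mpow_add
    using e by (intro mult_left_mono mpow_le_1 mpow_nonneg) (auto simp: less_imp_le)
  also have "\<dots> \<le> (\<Sum>v\<in>V. mpow e v)"
    using V(1) v(1) e by (auto intro!: member_le_sum mpow_nonneg simp: less_imp_le)
  finally show ?thesis by (simp add: j)
qed

subsection \<open>Rescaling\<close>

lemma lborel_integral_dilation:
  fixes F :: "real ^ 'd \<Rightarrow> complex"
  assumes e: "\<And>j. 0 < e $ j" and F: "F \<in> borel_measurable borel"
  shows "(LINT x|lborel. F x) = complex_of_real (\<Prod>j\<in>UNIV. e $ j) * (LINT y|lborel. F (e * y))"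
proof -
  \<comment> \<open>Componentwise multiplication by \<open>e\<close>, in the form that
    \<open>lborel_affine_euclidean\<close> expects.\<close>
  define T where "T = (\<lambda>x :: real ^ 'd. 0 + (\<Sum>b\<in>Basis. ((e \<bullet> b) * (x \<bullet> b)) *\<^sub>R b))"
  have B: "(Basis :: (real ^ 'd) set) = range (\<lambda>j. axis j 1)" by (auto simp: Basis_vec_def)
  have inj: "inj (\<lambda>j :: 'd. axis j (1 :: real))" by (auto simp: inj_on_def axis_eq_axis)
  have T: "T = (\<lambda>x. e * x)"
  proof
    fix x
    have "T x $ j = (e * x) $ j" for j
    proof -
      have "T x = (\<Sum>i\<in>UNIV. (e $ i * x $ i) *\<^sub>R axis i 1)"
        unfolding T_def B by (subst sum.reindex[OF inj]) (simp add: inner_axis)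
      then show ?thesis
        by (simp add: axis_def if_distrib[where f="\<lambda>a. _ * a"] cong: if_cong)
    qed
    then show "T x = e * x" by (simp add: vec_eq_iff)
  qed
  have p: "(\<Prod>b\<in>Basis. \<bar>e \<bullet> b\<bar>) = (\<Prod>j\<in>UNIV. e $ j)"
    unfolding B by (subst prod.reindex[OF inj]) (simp add: inner_axis abs_of_pos e)
  have "lborel = density (distr lborel borel T) (\<lambda>_. (\<Prod>b\<in>Basis. \<bar>e \<bullet> b\<bar>))"
    unfolding T_def
  proof (rule lborel_affine_euclidean)
    show "e \<bullet> b \<noteq> 0" if "b \<in> Basis" for b using that e unfolding B by (auto simp: inner_axis less_imp_neq[symmetric])
  qed
  then have lb: "lborel = density (distr lborel borel (\<lambda>x. e * x)) (\<lambda>_. (\<Prod>j\<in>UNIV. e $ j))"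
    by (simp only: T p)
  have [measurable]: "(\<lambda>x :: real ^ 'd. e * x) \<in> borel_measurable borel"
    by (intro borel_measurable_continuous_onI) (auto simp: times_vec_def intro!: continuous_intros)
  have "(LINT x|lborel. F x) = (LINT x|density (distr lborel borel (\<lambda>x. e * x)) (\<lambda>_. (\<Prod>j\<in>UNIV. e $ j)). F x)"
    using lb by simp
  also have "\<dots> = (LINT x|distr lborel borel (\<lambda>x. e * x). (\<Prod>j\<in>UNIV. e $ j) *\<^sub>R F x)"
  proof (rule integral_density)
    have "0 \<le> (\<Prod>j\<in>UNIV. e $ j)" using e by (intro prod_nonneg) (auto intro: less_imp_le)
    then show "AE x in distr lborel borel (\<lambda>x. e * x). 0 \<le> (\<Prod>j\<in>UNIV. e $ j)" by simp
  qed (use F in auto)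
  also have "\<dots> = (LINT y|lborel. (\<Prod>j\<in>UNIV. e $ j) *\<^sub>R F (e * y))"
    using F by (intro integral_distr) auto
  also have "\<dots> = complex_of_real (\<Prod>j\<in>UNIV. e $ j) * (LINT y|lborel. F (e * y))"
    by (simp add: scaleR_conv_of_real)
  finally show ?thesis .
qed

lemma unif_Ck_single:
  assumes "open W" "compact K" "U \<subseteq> K" "K \<subseteq> W" and "Ck_on n W f"
  shows "unif_Ck n I U (\<lambda>_. f)"
  using assms(5)
proof (induction n arbitrary: f)
  have bd: "\<exists>B. \<forall>i\<in>I. \<forall>x\<in>U. \<bar>f x\<bar> \<le> B" if "continuous_on W f" for f :: "real ^ 'a \<Rightarrow> real"
  proof -
    have "compact (f ` K)" using that assms by (intro compact_continuous_image) (auto intro: continuous_on_subset)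
    then obtain B where "\<And>y. y \<in> f ` K \<Longrightarrow> norm y \<le> B" using compact_imp_bounded bounded_iff by metis
    then show ?thesis using assms(3) by auto
  qed
  {
    case 0
    then have c: "continuous_on W f" by simp
    have "continuous_on U f" by (rule continuous_on_subset[OF c]) (use assms in auto)
    with bd[OF c] show ?case by simp
  next
    case (Suc n)
    have "unif_Ck n I U (\<lambda>_. partial j f)" for j using Suc.prems by (intro Suc.IH) simp
    moreover have "\<forall>x\<in>U. f differentiable at x" using Suc.prems assms by auto
    ultimately show ?case using bd[OF Ck_on_continuous[OF Suc.prems]] by simp
  }
qed

lemma mpow_Ck_on: "Ck_on n {x. infnorm x < r} (\<lambda>x. mpow x a)"
proof (rule ps_Ck_on)
  show "ps r (\<lambda>b. if b = a then 1 else 0) (\<lambda>x. mpow x a)"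
    unfolding ps_def
  proof (intro allI impI)
    fix x :: "real ^ 'a"
    show "((\<lambda>b. (if b = a then 1 else 0) * mpow x b) has_sum mpow x a) UNIV"
      by (rule has_sum_finite_neutralI[of "{a}"]) auto
  qed
qed

section \<open>Control of the rescaled phase\<close>

definition param_cube :: "real \<Rightarrow> (real ^ 'd) set" where
  "param_cube s = {e. \<forall>j. 0 < e $ j \<and> e $ j < s}"

text \<open>An open neighbourhood of the cube with sides [1,4] that carries \<eta>, with closure
  away from the coordinate hyperplanes. The bound 5 is the source of the conditions
  \<open>5 * s < r\<close>.\<close>

definition dilation_box :: "(real ^ 'd) set" where
  "dilation_box = {y. \<forall>j. 1/2 < y $ j \<and> y $ j < 5}"

lemma dilation_box_eq: "dilation_box = box (\<chi> j. 1/2) (\<chi> j. 5)"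
  by (auto simp: dilation_box_def mem_box_cart)

lemma infnorm_dilate:
  assumes "e \<in> param_cube s" "y \<in> dilation_box"
  shows "infnorm (e * y) \<le> 5 * infnorm e" "infnorm (e * y) < 5 * s"
proof -
  have *: "\<bar>(e * y) $ j\<bar> = \<bar>e $ j\<bar> * y $ j \<and> \<bar>e $ j\<bar> = e $ j \<and> 0 < e $ j \<and> e $ j < s \<and> 0 < y $ j \<and> y $ j < 5" for j
  proof -
    have "1/2 < y $ j" "y $ j < 5" "0 < e $ j" "e $ j < s"
      using assms by (auto simp: param_cube_def dilation_box_def)
    then show ?thesis by (simp add: abs_mult)
  qed
  have "\<bar>(e * y) $ j\<bar> \<le> 5 * infnorm e" for j
    using mult_mono[of "\<bar>e $ j\<bar>" "infnorm e" "y $ j" 5] component_le_infnorm_cart[of e j] * [of j]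
    by (simp add: infnorm_pos_le mult.commute)
  then show "infnorm (e * y) \<le> 5 * infnorm e" by (simp add: infnorm_le_iff)
  have "\<bar>(e * y) $ j\<bar> < 5 * s" for j
    using mult_strict_mono[of "e $ j" s "y $ j" 5] * [of j] by (simp add: mult.commute)
  then show "infnorm (e * y) < 5 * s" by (simp add: infnorm_less_iff)
qed

text \<open>With \<open>M(e) = \<Sum>v\<in>V. e\<^sup>v\<close>, the functions \<open>y \<mapsto> \<phi> (e y) / M(e)\<close> have derivatives up to order
  \<open>n\<close> bounded uniformly in \<open>e\<close>, and gradient uniformly bounded from below.\<close>

definition deriv_controlled :: "nat \<Rightarrow> real \<Rightarrow> (nat ^ 'd) set \<Rightarrow> (real ^ 'd \<Rightarrow> real) \<Rightarrow> bool" where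
  "deriv_controlled n s V \<phi> \<longleftrightarrow> (\<exists>W. Ck_on n W \<phi> \<and> (\<forall>e\<in>param_cube s. \<forall>y\<in>dilation_box. e * y \<in> W)) \<and>
     (\<forall>js. length js \<le> n \<longrightarrow> (\<exists>B. \<forall>e\<in>param_cube s. \<forall>y\<in>dilation_box.
        \<bar>mpow e (counts js) * foldr partial js \<phi> (e * y)\<bar> \<le> B * (\<Sum>v\<in>V. mpow e v)))"

definition grad_controlled :: "real \<Rightarrow> (nat ^ 'd) set \<Rightarrow> (real ^ 'd \<Rightarrow> real) \<Rightarrow> bool" where
  "grad_controlled s V \<phi> \<longleftrightarrow> (\<exists>c>0. \<forall>e\<in>param_cube s. \<forall>y\<in>dilation_box.
     c * (\<Sum>v\<in>V. mpow e v) \<le> (\<Sum>j\<in>UNIV. \<bar>(e * y) $ j * partial j \<phi> (e * y)\<bar>))"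

lemma deriv_controlled_unif_Ck:
  fixes \<phi> :: "real ^ 'd \<Rightarrow> real"
  assumes V: "finite V" "V \<noteq> {}" and d: "deriv_controlled n s V \<phi>"
  shows "unif_Ck n (param_cube s) dilation_box (\<lambda>e y. inverse (\<Sum>v\<in>V. mpow e v) * \<phi> (e * y))"
proof -
  obtain W where W: "Ck_on n W \<phi>" "\<And>e y. e \<in> param_cube s \<Longrightarrow> y \<in> dilation_box \<Longrightarrow> e * y \<in> W"
    using d unfolding deriv_controlled_def by blast
  have Mpos: "0 < (\<Sum>v\<in>V. mpow e v)" if "e \<in> param_cube s" for e
    using V that by (intro sum_pos mpow_pos) (auto simp: param_cube_def)
  show ?thesis
  proof (rule unif_Ck_scaled[OF _ W(2) W(1)])
    show "open (dilation_box :: (real ^ 'd) set)" by (simp add: dilation_box_eq open_box)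
    fix js :: "'d list" assume "length js \<le> n"
    then obtain B where B: "\<And>e y. e \<in> param_cube s \<Longrightarrow> y \<in> dilation_box \<Longrightarrow>
        \<bar>mpow e (counts js) * foldr partial js \<phi> (e * y)\<bar> \<le> B * (\<Sum>v\<in>V. mpow e v)"
      using d unfolding deriv_controlled_def by blast
    have "\<bar>inverse (\<Sum>v\<in>V. mpow e v) * (mpow e (counts js) * foldr partial js \<phi> (e * y))\<bar> \<le> B"
      if "e \<in> param_cube s" "y \<in> dilation_box" for e y
    proof -
      note M = Mpos[OF that(1)]
      have "\<bar>inverse (\<Sum>v\<in>V. mpow e v) * (mpow e (counts js) * foldr partial js \<phi> (e * y))\<bar>
        \<le> inverse (\<Sum>v\<in>V. mpow e v) * (B * (\<Sum>v\<in>V. mpow e v))"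
        using M by (intro abs_mult_le B that) simp
      also have "\<dots> = B" using M by simp
      finally show ?thesis .
    qed
    then show "\<exists>B. \<forall>e\<in>param_cube s. \<forall>y\<in>dilation_box.
        \<bar>inverse (\<Sum>v\<in>V. mpow e v) * (mpow e (counts js) * foldr partial js \<phi> (e * y))\<bar> \<le> B" by blast
  qed
qed

text \<open>Dividing the rescaled phase by \<open>M e\<close> leaves a family without stationary
  points, uniformly in \<open>e\<close>, so \<open>nonstationary_phase\<close> applies with
  frequency \<open>lam * M e\<close>. The two other factors are the Jacobian and what
  \<open>mpow x \<beta>\<close> contributes.\<close>

lemma oscillatory_integral_bound:
  fixes \<phi> \<eta> :: "real ^ 'd \<Rightarrow> real"
  assumes V: "finite V" "V \<noteq> {}"
    and \<phi>: "deriv_controlled (Suc N) s V \<phi>" "grad_controlled s V \<phi>"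
    and \<eta>: "Ck_on N UNIV \<eta>" "\<And>y. \<not> (\<forall>j. 1 \<le> y $ j \<and> y $ j \<le> 4) \<Longrightarrow> \<eta> y = 0"
  shows "\<exists>K\<ge>0. \<forall>e\<in>param_cube s. \<forall>lam>0.
     cmod (LINT x|lborel. exp (\<i> * complex_of_real (lam * \<phi> x)) *
         complex_of_real (mpow x \<beta> * \<eta> (\<chi> j. x $ j / e $ j)))
       \<le> (\<Prod>j\<in>UNIV. e $ j) * mpow e \<beta> * (K / (lam * (\<Sum>v\<in>V. mpow e v)) ^ N)"
proof -
  define M where "M = (\<lambda>e :: real ^ 'd. \<Sum>v\<in>V. mpow e v)"
  define U where "U = (dilation_box :: (real ^ 'd) set)"
  define Q where "Q = cbox (\<chi> j. 1) (\<chi> j. 4 :: real ^ 'd)"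
  define \<Phi> where "\<Phi> = (\<lambda>e y. inverse (M e) * \<phi> (e * y))"
  define \<psi> where "\<psi> = (\<lambda>y. mpow y \<beta> * \<eta> y)"
  have U: "open U" by (simp add: U_def dilation_box_eq open_box)
  have Q: "compact Q" "Q \<subseteq> U"
  proof -
    have "1/2 < y $ j \<and> y $ j < 5" if "y \<in> Q" for y j
    proof -
      have "1 \<le> y $ j" "y $ j \<le> 4" using that by (auto simp: Q_def mem_box_cart)
      then show ?thesis by simp
    qed
    then show "Q \<subseteq> U" by (auto simp: U_def dilation_box_def)
  qed (simp add: Q_def)
  have \<psi>0: "\<psi> y = 0" if "y \<notin> Q" for y
    using \<eta>(2)[of y] that by (auto simp: \<psi>_def Q_def mem_box_cart)
  have Mpos: "0 < M e" if "e \<in> param_cube s" for e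
    unfolding M_def using V that by (intro sum_pos mpow_pos) (auto simp: param_cube_def)
  have unif\<Phi>: "unif_Ck (Suc N) (param_cube s) U \<Phi>"
    unfolding \<Phi>_def M_def U_def by (rule deriv_controlled_unif_Ck[OF V \<phi>(1)])
  have unif\<psi>: "unif_Ck N (param_cube s) U (\<lambda>_. \<psi>)"
    unfolding \<psi>_def
  proof (rule unif_Ck_mult[OF U])
    have K: "compact (cbox (\<chi> j. 1/2) (\<chi> j. 5) :: (real ^ 'd) set)" "U \<subseteq> cbox (\<chi> j. 1/2) (\<chi> j. 5)"
      by (auto simp: U_def dilation_box_eq box_subset_cbox)
    show "unif_Ck N (param_cube s) U (\<lambda>_ y. mpow y \<beta>)"
    proof (rule unif_Ck_single[OF open_infnorm_less[of 6] K _ mpow_Ck_on])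
      have "\<bar>x $ j\<bar> < 6" if "\<forall>i. 1/2 \<le> x $ i \<and> x $ i \<le> 5" for x :: "real ^ 'd" and j
        using that[rule_format, of j] by simp
      then show "cbox (\<chi> j. 1/2) (\<chi> j. 5) \<subseteq> {x :: real ^ 'd. infnorm x < 6}"
        by (auto simp: mem_box_cart infnorm_less_iff)
    qed
    show "unif_Ck N (param_cube s) U (\<lambda>_. \<eta>)"
      by (rule unif_Ck_single[OF open_UNIV K _ \<eta>(1)]) auto
  qed
  obtain c where c: "c > 0" "\<And>e y. e \<in> param_cube s \<Longrightarrow> y \<in> dilation_box \<Longrightarrow>
     c * M e \<le> (\<Sum>j\<in>UNIV. \<bar>(e * y) $ j * partial j \<phi> (e * y)\<bar>)"
    using \<phi>(2) unfolding grad_controlled_def M_def by blast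
  obtain W where W: "Ck_on (Suc N) W \<phi>" "\<And>e y. e \<in> param_cube s \<Longrightarrow> y \<in> dilation_box \<Longrightarrow> e * y \<in> W"
    using \<phi>(1) unfolding deriv_controlled_def by blast
  \<comment> \<open>The 5 bounds \<open>y $ j\<close>; the cardinality comes from Cauchy-Schwarz,
    turning the sum of absolute values into a sum of squares.\<close>
  define c' where "c' = (c / 5)\<^sup>2 / CARD('d)"
  have grad: "c' \<le> (\<Sum>j\<in>UNIV. partial j (\<Phi> e) y * partial j (\<Phi> e) y)"
    if e: "e \<in> param_cube s" and y: "y \<in> U" for e y
  proof -
    have d: "\<phi> differentiable at (e * y)" using W e y by (auto simp: U_def)
    have le: "\<bar>(e * y) $ j * partial j \<phi> (e * y)\<bar> \<le> M e * (5 * \<bar>partial j (\<Phi> e) y\<bar>)" for j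
    proof -
      have "partial j (\<Phi> e) y = inverse (M e) * e $ j * partial j \<phi> (e * y)"
        unfolding \<Phi>_def by (rule partial_scaled(2)[OF d])
      then have eq: "(e * y) $ j * partial j \<phi> (e * y) = M e * (y $ j * partial j (\<Phi> e) y)"
        using Mpos[OF e] by (simp add: field_simps)
      have "\<bar>y $ j\<bar> \<le> 5"
      proof -
        have "1/2 < y $ j" "y $ j < 5" using y by (auto simp: U_def dilation_box_def)
        then show ?thesis by simp
      qed
      then show ?thesis unfolding eq using Mpos[OF e] by (intro abs_mult_le) auto
    qed

    have "c * M e \<le> (\<Sum>j\<in>UNIV. \<bar>(e * y) $ j * partial j \<phi> (e * y)\<bar>)"
      using c(2)[OF e] y unfolding U_def by blast
    also have "\<dots> \<le> (\<Sum>j\<in>UNIV. M e * (5 * \<bar>partial j (\<Phi> e) y\<bar>))" by (intro sum_mono le)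
    also have "\<dots> = M e * (5 * (\<Sum>j\<in>UNIV. \<bar>partial j (\<Phi> e) y\<bar>))" by (simp add: sum_distrib_left)
    finally have "c / 5 \<le> (\<Sum>j\<in>UNIV. \<bar>partial j (\<Phi> e) y\<bar>)" using Mpos[OF e] by (simp add: field_simps)
    then have "(c / 5)\<^sup>2 \<le> (\<Sum>j\<in>UNIV. \<bar>partial j (\<Phi> e) y\<bar>)\<^sup>2" using c(1) by (intro power_mono) auto
    also have "\<dots> \<le> (\<Sum>j\<in>UNIV. \<bar>partial j (\<Phi> e) y\<bar>\<^sup>2) * CARD('d)"
      by (rule sum_squared_le_sum_of_squares)
    finally show ?thesis by (simp add: c'_def field_simps power2_eq_square)
  qed
  have c': "c' > 0" using c(1) by (simp add: c'_def)
  have \<psi>0': "\<psi> y = 0" if "y \<in> U - Q" for y using \<psi>0 that by blast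
  obtain K0 where K0: "\<And>e \<mu> \<theta>. e \<in> param_cube s \<Longrightarrow> \<mu> > 0 \<Longrightarrow>
     \<bar>(LINT y|lborel. (if y \<in> U then cos (\<mu> * \<Phi> e y + \<theta>) * \<psi> y else 0))\<bar> \<le> K0 / \<mu> ^ N"
    using nonstationary_phase[OF U Q c' grad unif\<Phi> unif\<psi> \<psi>0'] by blast
  \<comment> \<open>Twice, for real and imaginary part; the maximum makes the bound nonnegative, so
    that it also holds for integrals that are 0 by convention.\<close>
  define K where "K = 2 * max K0 0"
  have "cmod (LINT x|lborel. exp (\<i> * complex_of_real (lam * \<phi> x)) *
         complex_of_real (mpow x \<beta> * \<eta> (\<chi> j. x $ j / e $ j)))
       \<le> (\<Prod>j\<in>UNIV. e $ j) * mpow e \<beta> * (K / (lam * M e) ^ N)" (is "cmod (integral\<^sup>L lborel ?F) \<le> ?R")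
    if e: "e \<in> param_cube s" and lam: "lam > 0" for e and lam :: real
  proof -
    have epos: "0 < e $ j" for j using e by (simp add: param_cube_def)
    have \<mu>: "lam * M e > 0" using lam Mpos[OF e] by simp
    have pe: "(\<Prod>j\<in>UNIV. e $ j) \<ge> 0" "mpow e \<beta> \<ge> 0"
      using epos by (auto intro!: prod_nonneg mpow_nonneg intro: less_imp_le)
    have R0: "?R \<ge> 0" using pe \<mu> by (simp add: K_def)
    define g where "g = (\<lambda>y. exp (\<i> * complex_of_real (lam * \<phi> (e * y))) * complex_of_real (\<psi> y))"
    have g: "Re (g y) = (if y \<in> U then cos ((lam * M e) * \<Phi> e y + 0) * \<psi> y else 0)"
      "Im (g y) = (if y \<in> U then cos ((lam * M e) * \<Phi> e y + (- pi / 2)) * \<psi> y else 0)" for y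
    proof -
      have m: "(lam * M e) * \<Phi> e y = lam * \<phi> (e * y)" using Mpos[OF e] by (simp add: \<Phi>_def)
      have s: "cos (a + (- pi / 2)) = sin a" for a :: real using cos_diff[of a "pi / 2"] by simp
      have z: "\<psi> y = 0" if "y \<notin> U" using \<psi>0 Q(2) that by blast
      show "Re (g y) = (if y \<in> U then cos ((lam * M e) * \<Phi> e y + 0) * \<psi> y else 0)"
        unfolding m g_def using z by (simp add: Re_exp)
      show "Im (g y) = (if y \<in> U then cos ((lam * M e) * \<Phi> e y + (- pi / 2)) * \<psi> y else 0)"
        unfolding m s g_def using z by (simp add: Im_exp)
    qed
    have gK: "cmod (integral\<^sup>L lborel g) \<le> K / (lam * M e) ^ N"
    proof (cases "integrable lborel g")
      case True
      have "cmod (integral\<^sup>L lborel g) \<le> \<bar>Re (integral\<^sup>L lborel g)\<bar> + \<bar>Im (integral\<^sup>L lborel g)\<bar>"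
        by (rule cmod_le)
      also have "\<dots> = \<bar>(LINT y|lborel. Re (g y))\<bar> + \<bar>(LINT y|lborel. Im (g y))\<bar>"
        using True by simp
      also have "\<dots> \<le> K0 / (lam * M e) ^ N + K0 / (lam * M e) ^ N"
        unfolding g by (intro add_mono K0 e \<mu>)
      also have "\<dots> \<le> K / (lam * M e) ^ N"
        using \<mu> by (simp add: K_def add_divide_distrib[symmetric] divide_right_mono)
      finally show ?thesis .
    next
      case False
      then show ?thesis using \<mu> by (simp add: not_integrable_integral_eq K_def)
    qed
    show ?thesis
    \<comment> \<open>\<open>\<phi>\<close> is controlled near the origin only, so measurability of
      the integrand is taken from integrability. Otherwise the Bochner integral is 0 by definition
      and the bound is trivial.\<close>
    proof (cases "integrable lborel ?F")
      case True
      then have "?F \<in> borel_measurable borel" using borel_measurable_integrable by fastforce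
      from lborel_integral_dilation[OF epos this]
      have "integral\<^sup>L lborel ?F = complex_of_real (\<Prod>j\<in>UNIV. e $ j) * (LINT y|lborel. ?F (e * y))" .
      also have "(\<lambda>y. ?F (e * y)) = (\<lambda>y. complex_of_real (mpow e \<beta>) * g y)"
      proof
        fix y
        have "(\<chi> j. (e * y) $ j / e $ j) = y" using epos by (simp add: vec_eq_iff less_imp_neq[symmetric])
        moreover have "mpow (e * y) \<beta> = mpow e \<beta> * mpow y \<beta>"
          using mpow_mult[of e y \<beta>] by (simp add: times_vec_def)
        ultimately show "?F (e * y) = complex_of_real (mpow e \<beta>) * g y" by (simp add: g_def \<psi>_def mult_ac)
      qed
      finally have "cmod (integral\<^sup>L lborel ?F) = (\<Prod>j\<in>UNIV. e $ j) * mpow e \<beta> * cmod (integral\<^sup>L lborel g)"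
        using pe by (simp add: norm_mult del: of_real_prod)
      also have "\<dots> \<le> ?R" using gK pe by (intro mult_left_mono) auto
      finally show ?thesis .
    next
      case False
      then show ?thesis using R0 by (simp add: not_integrable_integral_eq)
    qed
  qed
  then show ?thesis by (intro exI[of _ K]) (auto simp: M_def K_def)
qed

subsection \<open>Nondegenerate phases\<close>

lemma param_cube_iff: "e \<in> param_cube s \<longleftrightarrow> (\<forall>j. 0 < e $ j) \<and> infnorm e < s"
  by (simp add: param_cube_def infnorm_less_iff) (metis abs_of_pos)

lemma param_cube_mono: "s \<le> t \<Longrightarrow> param_cube s \<subseteq> param_cube t"
  by (auto simp: param_cube_def intro: less_le_trans)

text \<open>Differentiation lowers exponents by \<open>counts js\<close> and the factor
  \<open>mpow e (counts js)\<close> restores them, so that again only exponents of the support are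
  compared with \<open>V\<close>.\<close>

lemma ps_deriv_bound:
  fixes f :: "real ^ 'd \<Rightarrow> real"
  assumes ps: "ps r (pcoeff f) f" and V: "finite V" "\<And>a. a \<in> psupp f \<Longrightarrow> \<exists>v\<in>V. v \<le> a"
    and s: "0 < s" "s \<le> 1" "5 * s < r"
  shows "\<exists>B\<ge>0. \<forall>e\<in>param_cube s. \<forall>y\<in>dilation_box.
    \<bar>mpow e (counts js) * foldr partial js f (e * y)\<bar> \<le> B * (\<Sum>v\<in>V. mpow e v)"
proof -
  have "\<exists>v\<in>V. v \<le> a + counts js" if "foldr shift js (pcoeff f) a \<noteq> 0" for a
    using V(2)[of "a + counts js"] foldr_shift_eq_0[of "pcoeff f" a js] that by (auto simp: psupp_def)
  from ps_bound[OF ps_foldr[OF ps, of js] s V(1) this]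
  obtain B where B: "B \<ge> 0" "\<And>e y. (\<forall>j. 0 < e $ j \<and> e $ j < s) \<Longrightarrow> (\<forall>j. \<bar>y $ j\<bar> \<le> 5) \<Longrightarrow>
      \<bar>mpow e (counts js) * foldr partial js f (e * y)\<bar> \<le> B * (\<Sum>v\<in>V. mpow e v)" by blast
  have "\<bar>y $ j\<bar> \<le> 5" if "y \<in> dilation_box" for y :: "real ^ 'd" and j
  proof -
    have "1/2 < y $ j" "y $ j < 5" using that by (auto simp: dilation_box_def)
    then show ?thesis by simp
  qed
  then show ?thesis using B by (auto simp: param_cube_def intro!: exI[of _ B])
qed

lemma dilation_box_le: "y \<in> dilation_box \<Longrightarrow> 1/2 \<le> y $ j \<and> y $ j \<le> 5"
  by (auto simp: dilation_box_def intro: less_imp_le)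

lemma analytic_controlled:
  fixes f :: "real ^ 'd \<Rightarrow> real"
  assumes nd: "analytic_nondegenerate f"
    and V: "finite V" "V \<subseteq> psupp f" "\<And>a. a \<in> psupp f \<Longrightarrow> \<exists>v\<in>V. v \<le> a" and ne: "psupp f \<noteq> {}"
  shows "\<exists>s. 0 < s \<and> s < 1 \<and> grad_controlled s V f \<and> (\<forall>n. deriv_controlled n s V f)"
proof -
  obtain r where r: "r > 0" "ps r (pcoeff f) f"
    using nd unfolding analytic_nondegenerate_def analytic_near_0_ps by blast
  obtain s0 c where sc: "0 < s0" "0 < c"
    "\<And>e y. (\<forall>j. 0 < e $ j \<and> e $ j < s0) \<Longrightarrow> (\<forall>j. 1/2 \<le> y $ j \<and> y $ j \<le> 5) \<Longrightarrow>
      c * (\<Sum>v\<in>V. mpow e v) \<le> (\<Sum>j\<in>UNIV. \<bar>(e * y) $ j * partial j f (e * y)\<bar>)"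
    using gradient_lower_bound[OF nd V ne] by blast
  \<comment> \<open>\<open>r / 6\<close> leaves room for dilation by up to 5, and \<open>1/2\<close>
    ensures \<open>s < 1\<close>.\<close>
  define s where "s = min s0 (min (1/2) (r / 6))"
  have s: "0 < s" "s < 1" "s \<le> s0" "5 * s < r" using sc(1) r(1) by (auto simp: s_def)
  have "grad_controlled s V f"
    unfolding grad_controlled_def
  proof (intro exI conjI ballI)
    fix e y :: "real ^ 'd" assume e: "e \<in> param_cube s" and y: "y \<in> dilation_box"
    show "c * (\<Sum>v\<in>V. mpow e v) \<le> (\<Sum>j\<in>UNIV. \<bar>(e * y) $ j * partial j f (e * y)\<bar>)"
    proof (rule sc(3))
      show "\<forall>j. 0 < e $ j \<and> e $ j < s0" using subsetD[OF param_cube_mono[OF s(3)] e] by (simp add: param_cube_def)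
    qed (use dilation_box_le[OF y] in blast)
  qed fact
  moreover have "deriv_controlled n s V f" for n
    unfolding deriv_controlled_def
  proof (intro conjI exI[of _ "{x. infnorm x < r}"] ballI allI impI)
    show "Ck_on n {x. infnorm x < r} f" by (rule ps_Ck_on[OF r(2)])
    show "e * y \<in> {x. infnorm x < r}" if "e \<in> param_cube s" "y \<in> dilation_box" for e y
      using infnorm_dilate(2)[OF that] s(4) by simp
    show "\<exists>B. \<forall>e\<in>param_cube s. \<forall>y\<in>dilation_box.
        \<bar>mpow e (counts js) * foldr partial js f (e * y)\<bar> \<le> B * (\<Sum>v\<in>V. mpow e v)" for js
      using ps_deriv_bound[OF r(2) V(1,3) s(1) less_imp_le[OF s(2)] s(4), of js] by blast
  qed
  ultimately show ?thesis using s by blast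
qed

lemma infnorm_neighbourhood:
  fixes U :: "(real ^ 'd) set"
  assumes "open U" "0 \<in> U"
  obtains t where "t > 0" "\<And>x. infnorm x < t \<Longrightarrow> x \<in> U"
proof -
  obtain d where d: "d > 0" "ball 0 d \<subseteq> U" using assms open_contains_ball by blast
  have "x \<in> U" if "infnorm x < d / sqrt DIM(real ^ 'd)" for x
  proof -
    have "norm x \<le> sqrt DIM(real ^ 'd) * infnorm x" by (rule norm_le_infnorm)
    also have "\<dots> < d" using that by (simp add: field_simps)
    finally show ?thesis using d(2) by auto
  qed
  then show ?thesis using that[of "d / sqrt DIM(real ^ 'd)"] d(1) by simp
qed

text \<open>\<open>V\<close> belongs to the Taylor polynomial, the integral to \<open>f\<close>. Up
  to order \<open>k\<close> the two differ by a remainder that is small against the sum over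
  \<open>V\<close>; above order \<open>k\<close> no comparison is made, and plain boundedness of the
  derivatives of \<open>f\<close> suffices.\<close>

lemma k_nondegenerate_controlled:
  fixes f :: "real ^ 'd \<Rightarrow> real"
  assumes k: "k \<ge> 1" and knd: "k_nondegenerate k f"
    and V: "finite V" "V \<subseteq> psupp (taylor_poly k f)" "\<And>a. a \<in> psupp (taylor_poly k f) \<Longrightarrow> \<exists>v\<in>V. v \<le> a"
  shows "\<exists>s. 0 < s \<and> s < 1 \<and> grad_controlled s V f \<and>
    (\<forall>n. n \<le> k \<or> smooth_near_0 f \<longrightarrow> deriv_controlled n s V f)"
proof -
  define P where "P = taylor_poly k f"
  define R where "R = (\<lambda>x. f x - P x)"
  define M where "M = (\<lambda>e :: real ^ 'd. \<Sum>v\<in>V. mpow e v)"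
  have M_eq: "(\<Sum>v\<in>V. mpow e v) = M e" for e by (simp add: M_def)
  have nd: "analytic_nondegenerate P" and conv: "convenient P"
    using knd by (auto simp: k_nondegenerate_def P_def)
  note V' = V[folded P_def]
  have psP: "ps r (taylor_coeff k f) P" for r unfolding P_def by (rule ps_taylor_poly)
  have pc: "pcoeff P = taylor_coeff k f" by (rule pcoeff_eq[OF psP zero_less_one])
  have degP: "deg a \<le> k" if "a \<in> psupp P" for a
    using that by (auto simp: psupp_def pc taylor_coeff_def split: if_splits)
  have ne: "psupp P \<noteq> {}" using convenient_axis_exponent[OF conv] by blast
  \<comment> \<open>The neighbourhoods for class \<open>k\<close> and for smoothness may differ;
    their intersection serves both.\<close>
  obtain U0 where U0: "open U0" "0 \<in> U0" "Ck_on k U0 f" "smooth_near_0 f \<Longrightarrow> smooth_on U0 f"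
  proof -
    obtain A where A: "open A" "0 \<in> A" "Ck_on k A f"
      using knd unfolding k_nondegenerate_def Ck_near_0_def by blast
    show thesis
    proof (cases "smooth_near_0 f")
      case True
      then obtain S where S: "open S" "0 \<in> S" "smooth_on S f" unfolding smooth_near_0_def by blast
      show thesis
        by (rule that[of "A \<inter> S"])
           (use A S in \<open>auto simp: smooth_on_def intro: Ck_on_subset\<close>)
    next
      case False
      with A that show thesis by blast
    qed
  qed
  define U where "U = U0 \<inter> {x. infnorm x < 1}"
  have U: "open U" "0 \<in> U" "Ck_on k U f" "Ck_on k U P"
    using U0 open_infnorm_less ps_Ck_on[OF psP] by (auto simp: U_def infnorm_0 intro: Ck_on_subset)
  have smU: "Ck_on n U f" if "n \<le> k \<or> smooth_near_0 f" for n
    using that U0(4) Ck_on_mono[OF U(3)] by (auto simp: smooth_on_def U_def intro: Ck_on_subset)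
  have R: "Ck_on k U R" unfolding R_def by (rule Ck_on_diff[OF U(1,3,4)])
  have dR: "foldr partial js R x = foldr partial js f x - foldr partial js P x" if "length js \<le> k" "x \<in> U" for js x
    unfolding R_def using Ck_on_mono[OF U(3) that(1)] Ck_on_mono[OF U(4) that(1)] that(2)
    by (intro foldr_partial_diff[OF U(1)])
  have R0: "foldr partial js R 0 = 0" if "length js \<le> k" for js
    using dR[OF that U(2)] foldr_partial_taylor_poly[OF U(1,2,3) that] by (simp add: P_def)
  obtain s0 c where sc: "0 < s0" "0 < c"
    "\<And>e y. (\<forall>j. 0 < e $ j \<and> e $ j < s0) \<Longrightarrow> (\<forall>j. 1/2 \<le> y $ j \<and> y $ j \<le> 5) \<Longrightarrow>
      c * M e \<le> (\<Sum>j\<in>UNIV. \<bar>(e * y) $ j * partial j P (e * y)\<bar>)"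
    unfolding M_def using gradient_lower_bound[OF nd V' ne] by blast
  \<comment> \<open>Chosen so that the remainders, at most
    \<open>5 * (\<delta> * 5 ^ k * M e)\<close> in each coordinate, add up to half of the lower
    bound \<open>c * M e\<close>.\<close>
  define \<delta> where "\<delta> = c / (10 * (real CARD('d) * 5 ^ k))"
  have \<delta>: "\<delta> > 0" using sc(2) by (simp add: \<delta>_def)
  obtain sR where sR: "sR > 0" "\<And>js x. length js \<le> k \<Longrightarrow> infnorm x < sR \<Longrightarrow>
      \<bar>foldr partial js R x\<bar> \<le> \<delta> * infnorm x ^ (k - length js)"
    using taylor_remainder_bound[OF U(1,2) R R0 \<delta>] by blast
  obtain t where t: "t > 0" "\<And>x. infnorm x < t \<Longrightarrow> x \<in> U" using infnorm_neighbourhood[OF U(1,2)] by blast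
  define s where "s = min s0 (min (1/2) (min (sR / 5) (t / 6)))"
  have s: "0 < s" "s < 1" "s \<le> s0" "5 * s \<le> sR" "5 * s < t" "5 * s < 5"
    using sc(1) sR(1) t(1) by (auto simp: s_def)
  have inU: "e * y \<in> U" if "e \<in> param_cube s" "y \<in> dilation_box" for e y
    using infnorm_dilate(2)[OF that] s(5) by (intro t(2)) simp
  have M_ge: "infnorm e ^ k \<le> M e" if e: "e \<in> param_cube s" for e
    unfolding M_def
  proof (rule convenient_power_le[OF conv degP V'(1,3)])
    show "0 < e $ j \<and> e $ j < 1" for j
      using e s(2) less_trans[of "e $ j" s 1] by (auto simp: param_cube_def)
  qed
  \<comment> \<open>The factor \<open>infnorm e ^ length js\<close> makes up for the powers lost by
    differentiating, so every order up to \<open>k\<close> ends at \<open>infnorm e ^ k\<close>,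
    which convenience bounds by \<open>M e\<close>.\<close>
  have Rb: "infnorm e ^ length js * \<bar>foldr partial js R (e * y)\<bar> \<le> \<delta> * 5 ^ k * M e"
    if e: "e \<in> param_cube s" and y: "y \<in> dilation_box" and js: "length js \<le> k" for e y js
  proof -
    have "infnorm (e * y) < sR" using infnorm_dilate(2)[OF e y] s(4) by simp
    then have "\<bar>foldr partial js R (e * y)\<bar> \<le> \<delta> * infnorm (e * y) ^ (k - length js)" by (rule sR(2)[OF js])
    also have "\<dots> \<le> \<delta> * (5 * infnorm e) ^ (k - length js)"
      using infnorm_dilate(1)[OF e y] \<delta> by (intro mult_left_mono power_mono) (auto simp: infnorm_pos_le)
    finally have "infnorm e ^ length js * \<bar>foldr partial js R (e * y)\<bar>
       \<le> infnorm e ^ length js * (\<delta> * (5 * infnorm e) ^ (k - length js))"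
      by (intro mult_left_mono) (auto simp: infnorm_pos_le)
    also have "\<dots> = \<delta> * 5 ^ (k - length js) * infnorm e ^ k"
    proof -
      have "infnorm e ^ k = infnorm e ^ length js * infnorm e ^ (k - length js)"
        using js by (simp add: power_add[symmetric])
      then show ?thesis by (simp add: power_mult_distrib mult_ac)
    qed
    also have "\<dots> \<le> \<delta> * 5 ^ k * M e"
      using \<delta> M_ge[OF e] by (intro mult_mono mult_left_mono power_increasing) (auto simp: infnorm_pos_le)
    finally show ?thesis .
  qed
  have "grad_controlled s V f"
    unfolding grad_controlled_def M_eq
  proof (intro exI[of _ "c / 2"] conjI ballI)
    show "c / 2 > 0" using sc(2) by simp
    fix e y :: "real ^ 'd" assume e: "e \<in> param_cube s" and y: "y \<in> dilation_box"
    have 1: "c * M e \<le> (\<Sum>j\<in>UNIV. \<bar>(e * y) $ j * partial j P (e * y)\<bar>)"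
    proof (rule sc(3))
      show "\<forall>j. 0 < e $ j \<and> e $ j < s0" using subsetD[OF param_cube_mono[OF s(3)] e] by (simp add: param_cube_def)
    qed (use dilation_box_le[OF y] in blast)
    have "\<bar>(e * y) $ j * partial j P (e * y)\<bar> \<le> \<bar>(e * y) $ j * partial j f (e * y)\<bar> + 5 * (\<delta> * 5 ^ k * M e)" for j
    proof -
      have eq: "partial j P (e * y) = partial j f (e * y) - partial j R (e * y)"
        using dR[of "[j]" "e * y"] k inU[OF e y] by simp
      have "\<bar>(e * y) $ j * partial j R (e * y)\<bar> \<le> (5 * infnorm e) * \<bar>partial j R (e * y)\<bar>"
        unfolding abs_mult using component_le_infnorm_cart[of "e * y" j] infnorm_dilate(1)[OF e y]
        by (intro mult_right_mono) auto
      also have "\<dots> \<le> 5 * (\<delta> * 5 ^ k * M e)" using Rb[OF e y, of "[j]"] k by simp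
      finally show ?thesis unfolding eq right_diff_distrib by linarith
    qed
    then have "(\<Sum>j\<in>UNIV. \<bar>(e * y) $ j * partial j P (e * y)\<bar>)
       \<le> (\<Sum>j\<in>UNIV. \<bar>(e * y) $ j * partial j f (e * y)\<bar> + 5 * (\<delta> * 5 ^ k * M e))" by (intro sum_mono)
    also have "\<dots> = (\<Sum>j\<in>UNIV. \<bar>(e * y) $ j * partial j f (e * y)\<bar>) + c / 2 * M e"
      by (simp add: sum.distrib \<delta>_def)
    finally show "c / 2 * M e \<le> (\<Sum>j\<in>UNIV. \<bar>(e * y) $ j * partial j f (e * y)\<bar>)" using 1 by simp
  qed
  moreover have "deriv_controlled n s V f" if n: "n \<le> k \<or> smooth_near_0 f" for n
    unfolding deriv_controlled_def M_eq
  proof (intro conjI exI[of _ U] ballI allI impI)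
    show "Ck_on n U f" by (rule smU[OF n])
    show "e * y \<in> U" if "e \<in> param_cube s" "y \<in> dilation_box" for e y by (rule inU[OF that])
    fix js :: "'d list" assume js: "length js \<le> n"
    have mp: "\<bar>mpow e (counts js)\<bar> \<le> infnorm e ^ length js" for e
      unfolding length_eq_deg by (rule abs_mpow_le) (rule component_le_infnorm_cart)
    show "\<exists>B. \<forall>e\<in>param_cube s. \<forall>y\<in>dilation_box. \<bar>mpow e (counts js) * foldr partial js f (e * y)\<bar> \<le> B * M e"
    proof (cases "length js \<le> k")
      case True
      obtain B where B: "\<And>e y. e \<in> param_cube s \<Longrightarrow> y \<in> dilation_box \<Longrightarrow>
         \<bar>mpow e (counts js) * foldr partial js P (e * y)\<bar> \<le> B * M e"
        using ps_deriv_bound[OF psP[of 5, folded pc] V'(1,3) s(1) less_imp_le[OF s(2)] s(6), of js]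
        unfolding M_def by blast
      have "\<bar>mpow e (counts js) * foldr partial js f (e * y)\<bar> \<le> (B + \<delta> * 5 ^ k) * M e"
        if e: "e \<in> param_cube s" and y: "y \<in> dilation_box" for e y
      proof -
        have eq: "mpow e (counts js) * foldr partial js f (e * y) =
          mpow e (counts js) * foldr partial js P (e * y) + mpow e (counts js) * foldr partial js R (e * y)"
          unfolding dR[OF True inU[OF e y]] by (simp add: right_diff_distrib)
        have "\<bar>mpow e (counts js) * foldr partial js R (e * y)\<bar> \<le> infnorm e ^ length js * \<bar>foldr partial js R (e * y)\<bar>"
          by (rule abs_mult_le[OF mp order_refl])
        also have "\<dots> \<le> \<delta> * 5 ^ k * M e" by (rule Rb[OF e y True])
        finally show ?thesis unfolding eq distrib_right using B[OF e y] by linarith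
      qed
      then show ?thesis by blast
    next
      case False
      \<comment> \<open>Only the smooth case gets here. The rescaling factor is at most
        \<open>infnorm e ^ length js\<close>, hence at most \<open>infnorm e ^ k\<close> and
        \<open>M e\<close>; it remains to bound the derivative on a compact cube.\<close>
      then have "Ck_on (length js) U f" using n js by (intro smU) auto
      then have "continuous_on U (foldr partial js f)"
        using Ck_on_foldr[of "length js" U f js 0] by simp
      moreover define C where "C = {x :: real ^ 'd. infnorm x \<le> 5 * s}"
      have C: "compact C" "C \<subseteq> U"
      proof -
        have "C = cbox (\<chi> j. - (5 * s)) (\<chi> j. 5 * s)"
          by (auto simp: C_def infnorm_le_iff mem_box_cart abs_le_iff minus_le_iff)
        then show "compact C" by simp
        show "C \<subseteq> U" using t(2) s(5) by (auto simp: C_def)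
      qed
      ultimately have "compact (foldr partial js f ` C)"
        by (intro compact_continuous_image) (auto intro: continuous_on_subset)
      then obtain B where B: "\<And>y. y \<in> foldr partial js f ` C \<Longrightarrow> norm y \<le> B"
        using compact_imp_bounded bounded_iff by metis
      have "\<bar>mpow e (counts js) * foldr partial js f (e * y)\<bar> \<le> \<bar>B\<bar> * M e"
        if e: "e \<in> param_cube s" and y: "y \<in> dilation_box" for e y
      proof -
        have "e * y \<in> C" using infnorm_dilate(2)[OF e y] by (simp add: C_def)
        then have "\<bar>foldr partial js f (e * y)\<bar> \<le> \<bar>B\<bar>" using B[of "foldr partial js f (e * y)"] by auto
        moreover have "infnorm e ^ length js \<le> infnorm e ^ k"
          using False e s(2) by (intro power_decreasing) (auto simp: infnorm_pos_le param_cube_iff)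
        then have "\<bar>mpow e (counts js)\<bar> \<le> M e" using mp[of e] M_ge[OF e] by linarith
        ultimately have "\<bar>mpow e (counts js) * foldr partial js f (e * y)\<bar> \<le> M e * \<bar>B\<bar>"
          by (intro abs_mult_le)
        then show ?thesis by (simp only: mult.commute[of _ "M e"])
      qed
      then show ?thesis by blast
    qed
  qed
  ultimately show ?thesis using s by blast
qed

lemma mpowr_scaling_exponent:
  assumes e: "\<And>j. 0 < e $ j"
  shows "mpowr e (- (real N *\<^sub>R \<alpha> - rvec \<beta> - (\<chi> j. 1))) = (\<Prod>j\<in>UNIV. e $ j) * mpow e \<beta> / mpowr e \<alpha> ^ N"
proof -
  define l where "l = (\<chi> j. ln (e $ j))"
  have m: "mpowr e v = exp (l \<bullet> v)" for v unfolding l_def by (rule mpowr_exp[OF e])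
  have "exp (l \<bullet> (\<chi> j. 1)) = (\<Prod>j\<in>UNIV. e $ j)"
    using m[of "\<chi> j. 1"] e by (simp add: mpowr_def abs_of_pos)
  moreover have "exp (l \<bullet> rvec \<beta>) = mpow e \<beta>" unfolding l_def by (rule mpow_exp[OF e, symmetric])
  moreover have "l \<bullet> (- (real N *\<^sub>R \<alpha> - rvec \<beta> - (\<chi> j. 1))) = l \<bullet> (\<chi> j. 1) + l \<bullet> rvec \<beta> - real N * (l \<bullet> \<alpha>)"
    by (simp add: inner_diff_right)
  ultimately show ?thesis unfolding m by (simp add: exp_diff exp_add exp_of_nat_mult)
qed

text \<open>Trades the sum over \<open>V\<close> for \<open>mpowr \<epsilon> \<alpha>\<close> by
  \<open>newton_mpowr_le\<close>. \<open>f\<close> is the function that defines the polyhedron: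
  \<open>\<phi>\<close> itself or its Taylor polynomial.\<close>

lemma controlled_estimate:
  fixes \<phi> \<eta> :: "real ^ 'd \<Rightarrow> real"
  assumes V: "finite V" "V \<noteq> {}" "\<And>a. a \<in> psupp f \<Longrightarrow> \<exists>v\<in>V. v \<le> a" and s: "s < 1"
    and \<phi>: "deriv_controlled (Suc N) s V \<phi>" "grad_controlled s V \<phi>"
    and \<eta>: "Ck_on N UNIV \<eta>" "closure {x. \<eta> x \<noteq> 0} \<subseteq> {x. \<forall>j. 1 \<le> x $ j \<and> x $ j \<le> 4}"
    and \<alpha>: "\<alpha> \<in> newton_polyhedron f"
  shows "\<exists>C>0. \<forall>\<epsilon> lam. (\<forall>j. 0 < \<epsilon> $ j \<and> \<epsilon> $ j < 1) \<and> infnorm \<epsilon> < s \<and> lam > 2 \<longrightarrow>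
        cmod (LINT x|lborel. exp (\<i> * complex_of_real (lam * \<phi> x)) *
                 complex_of_real (mpow x \<beta> * \<eta> (\<chi> j. x $ j / \<epsilon> $ j)))
          \<le> C * lam powr (- real N) *
              mpowr \<epsilon> (- (real N *\<^sub>R \<alpha> - rvec \<beta> - (\<chi> j. 1)))"
proof -
  have \<eta>0: "\<eta> y = 0" if "\<not> (\<forall>j. 1 \<le> y $ j \<and> y $ j \<le> 4)" for y
    using \<eta>(2) closure_subset[of "{x. \<eta> x \<noteq> 0}"] that by blast
  obtain K where K: "K \<ge> 0" "\<And>e lam. e \<in> param_cube s \<Longrightarrow> lam > 0 \<Longrightarrow>
      cmod (LINT x|lborel. exp (\<i> * complex_of_real (lam * \<phi> x)) *
         complex_of_real (mpow x \<beta> * \<eta> (\<chi> j. x $ j / e $ j)))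
       \<le> (\<Prod>j\<in>UNIV. e $ j) * mpow e \<beta> * (K / (lam * (\<Sum>v\<in>V. mpow e v)) ^ N)"
    using oscillatory_integral_bound[OF V(1,2) \<phi> \<eta>(1) \<eta>0, of \<beta>] by blast
  show ?thesis
  \<comment> \<open>\<open>K\<close> may be 0, while a positive constant is asked for.\<close>
  proof (intro exI[of _ "K + 1"] conjI allI impI)
    show "K + 1 > 0" using K(1) by simp
    fix e :: "real ^ 'd" and lam :: real
    assume A: "(\<forall>j. 0 < e $ j \<and> e $ j < 1) \<and> infnorm e < s \<and> lam > 2"
    then have e: "e \<in> param_cube s" and epos: "\<And>j. 0 < e $ j" and lam: "lam > 0" by (auto simp: param_cube_iff)
    have pe: "(\<Prod>j\<in>UNIV. e $ j) * mpow e \<beta> \<ge> 0"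
      using epos by (intro mult_nonneg_nonneg prod_nonneg mpow_nonneg) (auto intro: less_imp_le)
    have pa: "mpowr e \<alpha> > 0" using epos by (simp add: mpowr_exp)
    have "mpowr e \<alpha> \<le> (\<Sum>v\<in>V. mpow e v)"
      using newton_mpowr_le[OF V(1,3) _ \<alpha>] A by blast
    then have "(lam * mpowr e \<alpha>) ^ N \<le> (lam * (\<Sum>v\<in>V. mpow e v)) ^ N"
      using lam pa by (intro power_mono mult_left_mono) auto
    then have "K / (lam * (\<Sum>v\<in>V. mpow e v)) ^ N \<le> (K + 1) / (lam * mpowr e \<alpha>) ^ N"
      using K(1) lam pa by (intro frac_le) auto
    then have "(\<Prod>j\<in>UNIV. e $ j) * mpow e \<beta> * (K / (lam * (\<Sum>v\<in>V. mpow e v)) ^ N)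
       \<le> (\<Prod>j\<in>UNIV. e $ j) * mpow e \<beta> * ((K + 1) / (lam * mpowr e \<alpha>) ^ N)"
      using pe by (rule mult_left_mono)
    also have "\<dots> = (K + 1) * lam powr (- real N) * mpowr e (- (real N *\<^sub>R \<alpha> - rvec \<beta> - (\<chi> j. 1)))"
      unfolding mpowr_scaling_exponent[OF epos] using lam
      by (simp add: powr_minus powr_realpow power_mult_distrib field_simps)
    finally show "cmod (LINT x|lborel. exp (\<i> * complex_of_real (lam * \<phi> x)) *
                 complex_of_real (mpow x \<beta> * \<eta> (\<chi> j. x $ j / e $ j)))
          \<le> (K + 1) * lam powr (- real N) * mpowr e (- (real N *\<^sub>R \<alpha> - rvec \<beta> - (\<chi> j. 1)))"
      using K(2)[OF e lam] by linarith
  qed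
qed

theorem lemma2p2:
  fixes k :: nat
    and \<beta> :: "nat ^ 'd"
    and \<phi> \<eta> :: "real ^ 'd \<Rightarrow> real"
    and NP :: "(real ^ 'd) set"
  assumes "k \<ge> 1"
    and "\<phi> 0 = 0"
    and "grad \<phi> 0 = 0"
    and "analytic_nondegenerate \<phi> \<and> NP = newton_polyhedron \<phi> \<or>
         k_nondegenerate k \<phi> \<and> NP = newton_polyhedron (taylor_poly k \<phi>)"
    and "Ck_on k UNIV \<eta>"
    and "closure {x. \<eta> x \<noteq> 0} \<subseteq> {x. \<forall>j. 1 \<le> x $ j \<and> x $ j \<le> 4}"
  shows "\<exists>s. 0 < s \<and> s < 1 \<and>
    (\<forall>N::nat. N \<le> k - 1 \<or> smooth_near_0 \<phi> \<and> smooth_on UNIV \<eta> \<longrightarrow>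
      (\<forall>\<alpha>\<in>NP. \<exists>C>0. \<forall>\<epsilon> lam. (\<forall>j. 0 < \<epsilon> $ j \<and> \<epsilon> $ j < 1) \<and> infnorm \<epsilon> < s \<and> lam > 2 \<longrightarrow>
        cmod (LINT x|lborel. exp (\<i> * complex_of_real (lam * \<phi> x)) *
                 complex_of_real (mpow x \<beta> * \<eta> (\<chi> j. x $ j / \<epsilon> $ j)))
          \<le> C * lam powr (- real N) *
              mpowr \<epsilon> (- (real N *\<^sub>R \<alpha> - rvec \<beta> - (\<chi> j. 1)))))"
proof -
  obtain f where f: "NP = newton_polyhedron f"
    "analytic_nondegenerate \<phi> \<and> f = \<phi> \<or> k_nondegenerate k \<phi> \<and> f = taylor_poly k \<phi>"
    using assms(4) by blast
  show ?thesis
  proof (cases "psupp f = {}")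
    \<comment> \<open>Without exponents the polyhedron is empty, and the claim is vacuous in
      \<alpha>.\<close>
    case True
    then have "NP = {}" by (simp add: f(1) newton_polyhedron_def)
    then show ?thesis by (intro exI[of _ "1/2"]) auto
  next
    case False
    obtain V where V: "finite V" "V \<subseteq> psupp f" "\<And>a. a \<in> psupp f \<Longrightarrow> \<exists>v\<in>V. v \<le> a"
      using dickson[of "psupp f"] by blast
    have Vne: "V \<noteq> {}" using False V(3) by blast
    \<comment> \<open>One \<open>s\<close> for all orders \<open>n\<close>, because \<open>N\<close>
      and \<alpha> are quantified after \<open>s\<close>; only the constants may depend on
      them.\<close>
    have "\<exists>s. 0 < s \<and> s < 1 \<and> grad_controlled s V \<phi> \<and>
        (\<forall>n. n \<le> k \<or> smooth_near_0 \<phi> \<longrightarrow> deriv_controlled n s V \<phi>)"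
      using f(2)
    proof
      assume "analytic_nondegenerate \<phi> \<and> f = \<phi>"
      then show ?thesis using analytic_controlled[of \<phi> V] V False by blast
    next
      assume "k_nondegenerate k \<phi> \<and> f = taylor_poly k \<phi>"
      then show ?thesis using k_nondegenerate_controlled[OF assms(1), of \<phi> V] V by blast
    qed
    then obtain s where s: "0 < s" "s < 1" "grad_controlled s V \<phi>"
      "\<And>n. n \<le> k \<or> smooth_near_0 \<phi> \<Longrightarrow> deriv_controlled n s V \<phi>" by blast
    show ?thesis
    proof (rule exI[of _ s], intro conjI allI impI ballI s(1,2))
      fix N :: nat and \<alpha> assume N: "N \<le> k - 1 \<or> smooth_near_0 \<phi> \<and> smooth_on UNIV \<eta>" and \<alpha>: "\<alpha> \<in> NP"
      \<comment> \<open>One order more than \<open>N\<close>, for the gradient of the phase;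
        \<open>k \<ge> 1\<close> is what makes the truncated \<open>k - 1\<close> a true
        predecessor.\<close>
      have "Suc N \<le> k \<or> smooth_near_0 \<phi>" using N assms(1) by auto
      moreover have "Ck_on N UNIV \<eta>"
        using N Ck_on_mono[OF assms(5), of N] by (auto simp: smooth_on_def)
      ultimately show "\<exists>C>0. \<forall>\<epsilon> lam. (\<forall>j. 0 < \<epsilon> $ j \<and> \<epsilon> $ j < 1) \<and> infnorm \<epsilon> < s \<and> lam > 2 \<longrightarrow>
        cmod (LINT x|lborel. exp (\<i> * complex_of_real (lam * \<phi> x)) *
                 complex_of_real (mpow x \<beta> * \<eta> (\<chi> j. x $ j / \<epsilon> $ j)))
          \<le> C * lam powr (- real N) *
              mpowr \<epsilon> (- (real N *\<^sub>R \<alpha> - rvec \<beta> - (\<chi> j. 1)))"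
        using \<alpha> by (intro controlled_estimate[OF V(1) Vne V(3) s(2) s(4) s(3) _ assms(6)]) (simp_all add: f(1))
    qed
  qed
qed

end
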